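(* Let $\nu\in\mathcal P(\mathbb C)$ and let $\phi:\mathbb C\to\mathbb R$ be a continuous function such that $\liminf_{z\to\infty}\{\phi(z)-2\log\|z\|\}>-\infty$. For $n\ge 1$ let $\langle p,q\rangle_n=\int_{\mathbb C}\overline{p(z)}q(z)e^{-n\phi(z)}\,d\nu(z)$ on $\mathbb C_n[z]$, assumed non-degenerate, and let $\mathcal G_n$ be the associated complex Gaussian measure on $\mathbb C_n[z]$. Define $G:\mathbb C\times\mathbb C\to(-\infty,\infty]$ by $$G(z,w)=-2\log\|z-w\|+\phi(z)+\phi(w).$$ Then $G$ is lower semicontinuous and bounded from below, and $\int_{\mathbb C}e^{-2\phi(z)}\,d\mathrm{Leb}(z)<\infty$. Define $\pi\in\mathcal P(\mathbb C)$ by $d\pi(z)=\frac{e^{-2\phi(z)}}{\int_{\mathbb C}e^{-2\phi}\,d\mathrm{Leb}}\,d\mathrm{Leb}(z)$, the symmetric measurable function $w_n:\mathbb C^n\to(-\infty,\infty]$ by $$w_n(z_1,\dots,z_n)=\frac1{n^2}\sum_{i<j}G(z_i,z_j)+\frac{n+1}{n^2}\log\left(\int_{\mathbb C}e^{-\sum_{i=1}^nG(z,z_i)}\,d\nu(z)\right),$$ and the measure $\gamma_n$ on $\mathbb C^n$ by $d\gamma_n=e^{-n^2w_n}\,d\pi^{\otimes n}$. Then the zeros of a random polynomial chosen according to $\mathcal G_n$ follow the law $\frac{\gamma_n}{\gamma_n(\mathbb C^n)}$; more precisely, $$j_n(\mathcal G_n)=i_n\left(\frac{\gamma_n}{\gamma_n(\mathbb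 C^n)}\right).$$
   Context: $\mathbb C_n[z]$ is the space of complex polynomials of degree at most $n$. The complex Gaussian measure $\mathcal G_n$ associated to the inner product $\langle\cdot,\cdot\rangle_n$ is the law of $\sum_{k=0}^na_kp_k$, where $p_0,\dots,p_n$ is an orthonormal basis of $(\mathbb C_n[z],\langle\cdot,\cdot\rangle_n)$ and $a_0,\dots,a_n$ are i.i.d. standard complex Gaussian variables (it has density proportional to $e^{-\langle p,p\rangle_n}$). $j_n:\mathbb C_n[z]\setminus\mathbb C_{n-1}[z]\to\mathcal P(\mathbb C)$ is $j_n(p)=\frac1n\sum_{i=1}^n\delta_{z_i}$ if $p(z)=a\prod_{i=1}^n(z-z_i)$, $a\ne0$; $j_n(\mathcal G_n)$ is the pushforward by $j_n$ of the restriction of $\mathcal G_n$ to $\mathbb C_n[z]\setminus\mathbb C_{n-1}[z]$ (a probability measure since $\mathcal G_n(\mathbb C_{n-1}[z])=0$). $i_n:\mathbb C^n\to\mathcal P(\mathbb C)$ is $i_n(z_1,\dots,z_n)=\frac1n\sum_{i=1}^n\delta_{z_i}$ and $i_n(\cdot)$ of a measure denotes pushforward. $\mathrm{Leb}$ is Lebesgue measure on $\mathbb C$, and $\|\cdot\|$ the modulus. *)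

theory Defs
  imports "HOL-Probability.Probability" "HOL-Computational_Algebra.Polynomial"
begin

section \<open>Extended-valued logarithm and exponential\<close>

definition elog :: "ennreal \<Rightarrow> ereal" where
  "elog x = (if x = 0 then -\<infinity> else if x = \<top> then \<infinity> else ereal (ln (enn2real x)))"

definition eexp :: "ereal \<Rightarrow> ennreal" where
  "eexp x = (case x of ereal r \<Rightarrow> ennreal (exp r) | PInfty \<Rightarrow> \<top> | MInfty \<Rightarrow> 0)"

definition lower_semicontinuous :: "('a::topological_space \<Rightarrow> ereal) \<Rightarrow> bool" where
  "lower_semicontinuous f \<longleftrightarrow> (\<forall>c. open {x. c < f x})"

section \<open>Probability measures on the plane\<close>

abbreviation prob_measures :: "complex measure set" where
  "prob_measures \<equiv> {\<mu>. prob_space \<mu> \<and> sets \<mu> = sets borel}"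

definition weak_topology :: "complex measure topology" where
  "weak_topology = topology_generated_by
     {{\<mu> \<in> prob_measures. (\<integral>x. f x \<partial>\<mu>) \<in> U} | (f :: complex \<Rightarrow> real) U.
        continuous_on UNIV f \<and> bounded (range f) \<and> open U}"

text \<open>The Borel space of the probability measures, as a measurable space
  (the null measure that \<^const>\<open>sigma\<close> attaches to it is irrelevant).\<close>

definition weak_borel :: "complex measure measure" where
  "weak_borel = sigma prob_measures {U. openin weak_topology U}"

text \<open>\<open>(1/n) \<Sum>\<^sub>i \<delta>\<^bsub>z i\<^esub>\<close>; points of the \<open>n\<close>-th power of the plane are functions on \<open>{..<n}\<close>,
  indexed from \<open>0\<close>.\<close>

definition empirical :: "nat \<Rightarrow> (nat \<Rightarrow> complex) \<Rightarrow> complex measure" where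
  "empirical n z = measure_of UNIV (sets borel)
     (\<lambda>A. (\<Sum>i<n. emeasure (return borel (z i)) A) / of_nat n)"

section \<open>Random polynomials\<close>

definition polys :: "nat \<Rightarrow> complex poly set" where
  "polys n = {p. degree p \<le> n}"

text \<open>The topology on the coefficient sequences is the product topology; its trace on sequences
  supported in \<open>{..n}\<close> is the usual topology of the finite-dimensional space \<^term>\<open>polys n\<close>.\<close>

definition polys_borel :: "nat \<Rightarrow> complex poly measure" where
  "polys_borel n = vimage_algebra (polys n) coeff (borel :: (nat \<Rightarrow> complex) measure)"

definition weighted_inner ::
  "(complex \<Rightarrow> real) \<Rightarrow> complex measure \<Rightarrow> nat \<Rightarrow> complex poly \<Rightarrow> complex poly \<Rightarrow> complex" where
  "weighted_inner \<phi> \<nu> n p q =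
     (\<integral>z. cnj (poly p z) * poly q z * of_real (exp (- real n * \<phi> z)) \<partial>\<nu>)"

definition nondegenerate_on ::
  "nat \<Rightarrow> (complex poly \<Rightarrow> complex poly \<Rightarrow> complex) \<Rightarrow> bool" where
  "nondegenerate_on n B \<longleftrightarrow>
     (\<forall>p\<in>polys n. (\<forall>q\<in>polys n. B p q = 0) \<longrightarrow> p = 0)"

definition orthonormal_basis_on ::
  "nat \<Rightarrow> (complex poly \<Rightarrow> complex poly \<Rightarrow> complex) \<Rightarrow> (nat \<Rightarrow> complex poly) \<Rightarrow> bool" where
  "orthonormal_basis_on n B b \<longleftrightarrow>
     (\<forall>k\<le>n. b k \<in> polys n) \<and>
     (\<forall>j\<le>n. \<forall>k\<le>n. B (b j) (b k) = (if j = k then 1 else 0)) \<and>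
     (\<forall>p\<in>polys n. \<exists>c. p = (\<Sum>k\<le>n. smult (c k) (b k)))"

text \<open>Normalised by \<open>E \<bar>a\<bar>\<^sup>2 = 1\<close>.\<close>

definition std_complex_gaussian :: "complex measure" where
  "std_complex_gaussian = density lborel (\<lambda>z. ennreal (exp (- (cmod z)\<^sup>2) / pi))"

definition gaussian_polynomial_law :: "nat \<Rightarrow> (nat \<Rightarrow> complex poly) \<Rightarrow> complex poly measure" where
  "gaussian_polynomial_law n b =
     distr (\<Pi>\<^sub>M k\<in>{..n}. std_complex_gaussian) (polys_borel n) (\<lambda>a. \<Sum>k\<le>n. smult (a k) (b k))"

text \<open>The law does not depend on the orthonormal basis, so at most one measure qualifies; the
  definition does not rely on this.\<close>

definition is_complex_gaussian ::
  "nat \<Rightarrow> (complex poly \<Rightarrow> complex poly \<Rightarrow> complex) \<Rightarrow> complex poly measure \<Rightarrow> bool" where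
  "is_complex_gaussian n B \<G> \<longleftrightarrow>
     (\<exists>b. orthonormal_basis_on n B b \<and> \<G> = gaussian_polynomial_law n b)"

text \<open>Well defined for \<open>degree p = n\<close>, since the factorisation is unique up to order.\<close>

definition zero_measure :: "nat \<Rightarrow> complex poly \<Rightarrow> complex measure" where
  "zero_measure n p =
     (THE \<mu>. \<exists>a z. a \<noteq> 0 \<and> p = smult a (\<Prod>i<n. [:- z i, 1:]) \<and> \<mu> = empirical n z)"

section \<open>The Gibbs measure\<close>

definition pair_energy :: "(complex \<Rightarrow> real) \<Rightarrow> complex \<Rightarrow> complex \<Rightarrow> ereal" where
  "pair_energy \<phi> z w = - (2 * elog (ennreal (cmod (z - w)))) + ereal (\<phi> z) + ereal (\<phi> w)"

definition ref_measure :: "(complex \<Rightarrow> real) \<Rightarrow> complex measure" where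
  "ref_measure \<phi> = density lborel
     (\<lambda>z. ennreal (exp (- 2 * \<phi> z)) / (\<integral>\<^sup>+ u. ennreal (exp (- 2 * \<phi> u)) \<partial>lborel))"

definition energy ::
  "(complex \<Rightarrow> real) \<Rightarrow> complex measure \<Rightarrow> nat \<Rightarrow> (nat \<Rightarrow> complex) \<Rightarrow> ereal" where
  "energy \<phi> \<nu> n z =
     ereal (1 / (real n)\<^sup>2) * (\<Sum>j<n. \<Sum>i<j. pair_energy \<phi> (z i) (z j))
     + ereal ((real n + 1) / (real n)\<^sup>2)
       * elog (\<integral>\<^sup>+ u. eexp (- (\<Sum>i<n. pair_energy \<phi> u (z i))) \<partial>\<nu>)"

definition gibbs_measure ::
  "(complex \<Rightarrow> real) \<Rightarrow> complex measure \<Rightarrow> nat \<Rightarrow> (nat \<Rightarrow> complex) measure" where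
  "gibbs_measure \<phi> \<nu> n = density (\<Pi>\<^sub>M i\<in>{..<n}. ref_measure \<phi>)
     (\<lambda>z. eexp (- (ereal ((real n)\<^sup>2) * energy \<phi> \<nu> n z)))"

definition normalize_measure :: "'a measure \<Rightarrow> 'a measure" where
  "normalize_measure M = scale_measure (inverse (emeasure M (space M))) M"

end

(*
  Write a polynomial as a (X - z_1) ... (X - z_n). The map from (a, z_1, ..., z_n) to the coefficients
  is n!-to-one with real Jacobian |a|^(2n) prod_{i<j} |z_i - z_j|^2. The Gaussian law has a density
  proportional to exp(-<p,p>) with respect to Lebesgue measure on the coefficients, and integrating
  out a turns exp(-|a|^2 <q,q>) |a|^(2n) into a multiple of <q,q>^(-(n+1)), q being the monic
  polynomial with roots z_i. Up to a constant, the product of this power with the Vandermonde factor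
  is exactly the density exp(-n^2 w_n) of gamma_n times that of the n-th power of pi.
*)

theory Submission
  imports Defs "HOL-Complex_Analysis.Conformal_Mappings"
    "HOL-Computational_Algebra.Fundamental_Theorem_Algebra"
begin

section \<open>The area formula for complex polynomials\<close>

text \<open>The map from roots to coefficients is never differentiated as a map on n-dimensional
  space: that would call for a determinant of size 2n and for a partition of the space into domains
  of injectivity. Roots are split off one at a time instead, so that the only nonlinear change of
  variables happens in the plane, where a polynomial h covers almost every value deg h times and the
  Jacobian is |h'|^2. The Vandermonde product and the factor n! both build up along this induction.
  The passage from coordinates in an orthonormal basis to coefficients avoids determinants in
  another way: each of the two pushes Lebesgue measure to a measure on polynomials that is invariant
  under translation, which forces proportionality. The price is an unknown constant, harmless as
  long as it is shown to be positive and finite. The reference density e^(-2 \<phi>) is dictated by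
  the count of the powers of e^\<phi>: the pairs and the integral against \<nu> together leave e^(2
  \<phi>) at each root.\<close>

definition complex_to_real2 :: "complex \<Rightarrow> real^2" where
  "complex_to_real2 z = vector [Re z, Im z]"

definition real2_to_complex :: "real^2 \<Rightarrow> complex" where
  "real2_to_complex v = Complex (v $ 1) (v $ 2)"

lemma complex_to_real2_inverse [simp]:
  "real2_to_complex (complex_to_real2 z) = z"
  "complex_to_real2 (real2_to_complex v) = v"
  by (simp_all add: complex_to_real2_def real2_to_complex_def vec_eq_iff forall_2)

lemma bounded_linear_complex_to_real2: "bounded_linear complex_to_real2"
  by (intro linear_conv_bounded_linear[THEN iffD1] linearI)
     (simp_all add: complex_to_real2_def vec_eq_iff forall_2)

lemma bounded_linear_real2_to_complex: "bounded_linear real2_to_complex"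
  by (intro linear_conv_bounded_linear[THEN iffD1] linearI)
     (simp_all add: real2_to_complex_def complex_eq_iff)

lemma borel_measurable_complex_to_real2 [measurable]: "complex_to_real2 \<in> borel_measurable borel"
  by (intro borel_measurable_continuous_onI linear_continuous_on bounded_linear_complex_to_real2)

lemma borel_measurable_real2_to_complex [measurable]: "real2_to_complex \<in> borel_measurable borel"
  by (intro borel_measurable_continuous_onI linear_continuous_on bounded_linear_real2_to_complex)

lemma Basis_real2: "(Basis :: (real^2) set) = {axis 1 1, axis 2 1}"
  by (auto simp: Basis_vec_def UNIV_2)

text \<open>Both measures give a box the product of its two side lengths, and these values
  characterise Lebesgue measure. The transfer is made because the change of variables theorem used
  below speaks of determinants of matrices on \<open>real^'n\<close>.\<close>

lemma lborel_real2_eq: "(lborel :: (real^2) measure) = distr lborel borel complex_to_real2"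
proof (rule lborel_eqI)
  fix l u :: "real^2" assume le: "\<And>b. b \<in> Basis \<Longrightarrow> l \<bullet> b \<le> u \<bullet> b"
  have le': "l $ 1 \<le> u $ 1" "l $ 2 \<le> u $ 2"
    using le[of "axis 1 1"] le[of "axis 2 1"] by (auto simp: Basis_real2 inner_axis)
  have ne: "(axis 1 1 :: real^2) \<noteq> axis 2 1"
    by (simp add: axis_eq_axis)
  have eq: "complex_to_real2 -` box l u = box (real2_to_complex l) (real2_to_complex u)"
    by (auto simp: box_def Basis_real2 inner_axis Basis_complex_def complex_to_real2_def
        real2_to_complex_def)
  have "emeasure (distr lborel borel complex_to_real2) (box l u)
      = emeasure lborel (box (real2_to_complex l) (real2_to_complex u))"
    by (subst emeasure_distr) (auto simp: eq)
  also have "\<dots> = (\<Prod>b\<in>Basis. (u - l) \<bullet> b)"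
    using le' ne
    by (subst emeasure_lborel_box)
       (auto simp: Basis_complex_def Basis_real2 real2_to_complex_def inner_axis ennreal_mult' complex_i_not_one[symmetric])
  finally show "emeasure (distr lborel borel complex_to_real2) (box l u)
      = ennreal (\<Prod>b\<in>Basis. (u - l) \<bullet> b)" .
qed simp

lemma emeasure_lborel_complex_image:
  assumes [measurable]: "A \<in> sets borel"
  shows "complex_to_real2 ` A \<in> sets borel"
    and "emeasure lborel (complex_to_real2 ` A) = emeasure lborel A"
proof -
  have eq: "complex_to_real2 ` A = real2_to_complex -` A \<inter> space borel"
    by (auto simp: image_iff) (metis complex_to_real2_inverse(2))
  show m: "complex_to_real2 ` A \<in> sets borel"
    unfolding eq by measurable
  have "complex_to_real2 -` (complex_to_real2 ` A) = A"
    by (auto simp: image_iff) (metis complex_to_real2_inverse(1))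
  then show "emeasure lborel (complex_to_real2 ` A) = emeasure lborel A"
    using m by (subst lborel_real2_eq, subst emeasure_distr) auto
qed

text \<open>The real Jacobian of a holomorphic map is \<open>\<bar>f'\<bar>\<^sup>2\<close>.\<close>

lemma emeasure_image_complex_derivative:
  fixes f f' :: "complex \<Rightarrow> complex"
  assumes S [measurable]: "S \<in> sets borel" and "bounded S" and inj: "inj_on f S"
    and fS: "f ` S \<in> sets borel"
    and der: "\<And>x. (f has_field_derivative f' x) (at x)"
    and cont: "continuous_on UNIV f'"
  shows "emeasure lborel (f ` S) = (\<integral>\<^sup>+ x. ennreal ((cmod (f' x))\<^sup>2) * indicator S x \<partial>lborel)"
proof -
  define g where "g = complex_to_real2 \<circ> f \<circ> real2_to_complex"
  define g' where "g' v = complex_to_real2 \<circ> (\<lambda>w. f' (real2_to_complex v) * w) \<circ> real2_to_complex" for v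
  define S2 where "S2 = complex_to_real2 ` S"
  have [measurable]: "f' \<in> borel_measurable borel"
    using cont by (rule borel_measurable_continuous_onI)
  have S2: "S2 \<in> sets borel"
    unfolding S2_def by (rule emeasure_lborel_complex_image) fact
  \<comment> \<open>Multiplication by a + ib has the matrix with rows (a, -b) and (b, a), of
    determinant a^2 + b^2.\<close>
  have det: "\<bar>det (matrix (g' v))\<bar> = (cmod (f' (real2_to_complex v)))\<^sup>2" for v
  proof -
    have "det (matrix (g' v)) = Re (f' (real2_to_complex v)) * Re (f' (real2_to_complex v))
        + Im (f' (real2_to_complex v)) * Im (f' (real2_to_complex v))"
      by (simp add: det_2 matrix_def g'_def complex_to_real2_def real2_to_complex_def axis_def)
    also have "\<dots> = (cmod (f' (real2_to_complex v)))\<^sup>2"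
      unfolding cmod_power2 by (simp add: power2_eq_square)
    finally show ?thesis by simp
  qed
  have gder: "(g has_derivative g' v) (at v within S2)" for v
  proof -
    have 1: "(real2_to_complex has_derivative real2_to_complex) (at v)"
      by (rule bounded_linear_imp_has_derivative[OF bounded_linear_real2_to_complex])
    have 2: "(f has_derivative (*) (f' (real2_to_complex v))) (at (real2_to_complex v))"
      using der[of "real2_to_complex v"] by (simp add: has_field_derivative_def)
    have 3: "(complex_to_real2 has_derivative complex_to_real2) (at ((f \<circ> real2_to_complex) v))"
      by (rule bounded_linear_imp_has_derivative[OF bounded_linear_complex_to_real2])
    show ?thesis
      using diff_chain_at[OF diff_chain_at[OF 1 2] 3] unfolding g_def g'_def o_assoc
      by (rule has_derivative_at_withinI)
  qed
  have ginj: "inj_on g S2"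
    using inj unfolding g_def S2_def inj_on_def
    by (auto dest!: arg_cong[of _ _ real2_to_complex])
  have gS: "g ` S2 = complex_to_real2 ` (f ` S)"
    by (auto simp: g_def S2_def image_comp)
  obtain B where B: "\<And>x. x \<in> S \<Longrightarrow> cmod x \<le> B"
    using \<open>bounded S\<close> by (auto simp: bounded_iff)
  have "bounded (f' ` cball 0 B)"
    by (intro compact_imp_bounded compact_continuous_image continuous_on_subset[OF cont]) auto
  then obtain C where C: "\<forall>x\<in>cball 0 B. cmod (f' x) \<le> C"
    by (auto simp: bounded_iff)
  \<comment> \<open>Boundedness of \<open>S\<close> makes \<open>I\<close> finite; the gauge
    integral below needs a real number \<open>r\<close> as its value.\<close>
  define I where "I = (\<integral>\<^sup>+ x. ennreal ((cmod (f' x))\<^sup>2) * indicator S x \<partial>lborel)"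
  have "I \<le> (\<integral>\<^sup>+ x. ennreal (C\<^sup>2) * indicator S x \<partial>lborel)"
    unfolding I_def using B C
    by (intro nn_integral_mono) (auto simp: indicator_def intro!: ennreal_leI power_mono)
  also have "\<dots> = ennreal (C\<^sup>2) * emeasure lborel S"
    by (simp add: nn_integral_cmult_indicator)
  also have "\<dots> < \<infinity>"
    using emeasure_bounded_finite[OF \<open>bounded S\<close>] by (simp add: ennreal_mult_less_top)
  finally obtain r where r: "I = ennreal r" "0 \<le> r"
    by (cases I) auto
  have "(\<integral>\<^sup>+ v. ennreal ((cmod (f' (real2_to_complex v)))\<^sup>2 * indicator S2 v) \<partial>lborel)
      = (\<integral>\<^sup>+ x. ennreal ((cmod (f' x))\<^sup>2 * indicator S2 (complex_to_real2 x)) \<partial>lborel)"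
    using S2 by (subst lborel_real2_eq, subst nn_integral_distr) auto
  also have "\<dots> = I"
    unfolding I_def S2_def
    by (intro nn_integral_cong) 
      (auto simp: indicator_def image_iff dest!: arg_cong[of _ _ real2_to_complex])
  finally have "((\<lambda>v. (cmod (f' (real2_to_complex v)))\<^sup>2 * indicator S2 v) has_integral r) UNIV"
    using S2 r by (intro nn_integral_has_integral) (auto simp: mult_nonneg_nonneg)
  then have "((\<lambda>v. \<bar>det (matrix (g' v))\<bar>) has_integral r) S2"
    unfolding det by (subst has_integral_restrict_UNIV[symmetric])
      (simp add: indicator_def of_bool_def if_distrib cong: if_cong)
  then have *: "g ` S2 \<in> lmeasurable" "measure lebesgue (g ` S2) = r"
    using has_measure_differentiable_image[OF _ gder ginj, of r] S2 by auto
  have "emeasure lborel (f ` S) = emeasure lborel (g ` S2)"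
    unfolding gS using fS by (simp add: emeasure_lborel_complex_image)
  also have "\<dots> = emeasure lebesgue (g ` S2)"
    using fS by (simp add: gS emeasure_lborel_complex_image)
  also have "\<dots> = ennreal r"
    using * by (simp add: emeasure_eq_measure2)
  finally show ?thesis using r unfolding I_def by simp
qed

section \<open>Fibres of a polynomial and the covering number\<close>

text \<open>The polynomials \<open>h\<close> and \<open>h - [:u:]\<close> have the same derivative,
  so at a noncritical value \<open>u\<close> the latter shares no root with its derivative. All its
  roots are then simple, and their number is the degree.\<close>

lemma card_roots_generic:
  fixes h :: "complex poly"
  assumes h: "degree h > 0" and u: "u \<notin> poly h ` {w. poly (pderiv h) w = 0}"
  shows "finite {w. poly h w = u}" "card {w. poly h w = u} = degree h"
proof -
  define k where "k = h - [:u:]"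
  have k: "degree k = degree h" "k \<noteq> 0"
  proof -
    show "degree k = degree h"
      unfolding k_def diff_conv_add_uminus using h by (subst degree_add_eq_left) auto
    then show "k \<noteq> 0" using h by auto
  qed
  have eq: "{w. poly h w = u} = {w. poly k w = 0}"
    by (auto simp: k_def)
  have fin: "finite {w. poly k w = 0}"
    by (rule poly_roots_finite) (rule k)
  have "rsquarefree k"
    unfolding rsquarefree_roots using u by (auto simp: k_def pderiv_diff)
  then have "proots k = mset_set {w. poly k w = 0}"
    using k(2) fin by (intro multiset_eqI) (force simp: rsquarefree_def count_mset_set' order_root)
  then have "card {w. poly k w = 0} = degree k"
    by (metis size_mset_set size_proots_complex)
  then show "card {w. poly h w = u} = degree h"
    by (simp add: eq k)
  show "finite {w. poly h w = u}"
    unfolding eq by (rule fin)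
qed

text \<open>The open set is a countable union of compact ones, so the image is a countable union of
  compact sets. This elementary criterion explains the shape of the pieces in
  \<open>locally_injective_cover\<close>.\<close>

lemma borel_image_compact_open:
  fixes f :: "complex \<Rightarrow> complex"
  assumes f: "continuous_on UNIV f" and "compact K" and "open V"
  shows "f ` (K \<inter> V) \<in> sets borel"
proof -
  obtain C where C: "\<And>n::nat. compact (C n)" "\<Union> (range C) = V"
    using open_Union_compact_subsets[OF \<open>open V\<close>] by metis
  have "f ` (K \<inter> V) = (\<Union>n. f ` (K \<inter> C n))"
    using C(2) by auto
  moreover have "closed (f ` (K \<inter> C n))" for n
    by (intro compact_imp_closed compact_continuous_image continuous_on_subset[OF f]
        compact_Int C \<open>compact K\<close>) auto
  ultimately show ?thesis
    by (auto intro!: sets.countable_UN)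
qed

text \<open>Off its critical points \<open>h\<close> is locally injective, and the Lindelof property
  leaves countably many closed balls of injectivity. Made disjoint, each becomes a closed ball minus
  finitely many closed balls, hence compact intersected with open, and its image stays
  Borel.\<close>

lemma locally_injective_cover:
  fixes h :: "complex poly"
  assumes h: "degree h > 0"
  obtains S :: "nat \<Rightarrow> complex set" where
    "\<And>i. S i \<in> sets borel" "\<And>i. bounded (S i)" "\<And>i. inj_on (poly h) (S i)"
    "\<And>i. poly h ` S i \<in> sets borel" "disjoint_family S"
    "(\<Union>i. S i) = {w. poly (pderiv h) w \<noteq> 0}"
proof -
  define U where "U = {w. poly (pderiv h) w \<noteq> 0}"
  have "U \<noteq> {}"
  proof
    assume "U = {}"
    then have "infinite {w. poly (pderiv h) w = 0}"
      by (simp add: U_def infinite_UNIV_char_0)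
    then have "pderiv h = 0"
      using poly_roots_finite by blast
    then show False using h by (simp add: pderiv_eq_0_iff)
  qed
  have "\<exists>r>0. cball w r \<subseteq> U \<and> inj_on (poly h) (cball w r)" if w: "w \<in> U" for w
  proof -
    have "deriv (poly h) w \<noteq> 0"
      using w by (simp add: U_def DERIV_imp_deriv[OF poly_DERIV])
    then obtain r where r: "r > 0" "inj_on (poly h) (ball w r)"
      by (rule has_complex_derivative_locally_injective[of "poly h" UNIV w, rotated 3]) 
        (auto intro!: holomorphic_intros)
    have "open U"
      unfolding U_def by (intro open_Collect_neq continuous_intros)
    then obtain e where e: "e > 0" "cball w e \<subseteq> U"
      using w open_contains_cball by blast
    \<comment> \<open>Halving \<open>r\<close> puts the closed ball inside the open ball of
      injectivity.\<close>
    have "cball w (min e (r/2)) \<subseteq> ball w r" "cball w (min e (r/2)) \<subseteq> cball w e"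
      using r by auto
    then show ?thesis
      using r e by (intro exI[of _ "min e (r/2)"]) (auto intro: inj_on_subset)
  qed
  then obtain r where r: "\<And>w. w \<in> U \<Longrightarrow> r w > 0 \<and> cball w (r w) \<subseteq> U \<and> inj_on (poly h) (cball w (r w))"
    by metis
  obtain F where F: "F \<subseteq> (\<lambda>w. ball w (r w)) ` U" "countable F"
    "\<Union>F = (\<Union>w\<in>U. ball w (r w))"
    using Lindelof[of "(\<lambda>w. ball w (r w)) ` U"] by (metis (no_types, lifting) imageE open_ball)
  obtain W where W: "W \<subseteq> U" "countable W" "F = (\<lambda>w. ball w (r w)) ` W"
    using countable_subset_image[of F "\<lambda>w. ball w (r w)" U] F by auto
  have UW: "U = (\<Union>w\<in>W. cball w (r w))"
  proof
    show "U \<subseteq> (\<Union>w\<in>W. cball w (r w))"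
    proof
      fix x assume x: "x \<in> U"
      then have "x \<in> \<Union>F" unfolding F(3) using r[OF x] by (intro UN_I[of x]) auto
      then show "x \<in> (\<Union>w\<in>W. cball w (r w))"
        unfolding W(3) using ball_subset_cball by blast
    qed
    show "(\<Union>w\<in>W. cball w (r w)) \<subseteq> U"
      using r W(1) by blast
  qed
  have "W \<noteq> {}" using \<open>U \<noteq> {}\<close> UW by auto
  define B where "B i = cball (from_nat_into W i) (r (from_nat_into W i))" for i
  define S where "S = disjointed B"
  have iW: "from_nat_into W i \<in> U" for i
    using from_nat_into[OF \<open>W \<noteq> {}\<close>] W(1) by auto
  have SB: "S i \<subseteq> B i" for i
    unfolding S_def by (rule disjointed_subset)
  have Seq: "S i = B i \<inter> - (\<Union>j<i. B j)" for i
    by (auto simp: S_def disjointed_def lessThan_atLeast0)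
  have opn: "open (- (\<Union>j<i. B j))" for i
    by (auto simp: B_def intro!: closed_UN)
  show ?thesis
  proof (rule that)
    show "S i \<in> sets borel" for i
      unfolding Seq using opn by (intro sets.Int) (auto simp: B_def)
    show "bounded (S i)" for i
      using SB by (rule bounded_subset[rotated]) (simp add: B_def)
    show "inj_on (poly h) (S i)" for i
      using r[OF iW, of i] SB unfolding B_def by (metis inj_on_subset)
    show "poly h ` S i \<in> sets borel" for i
      unfolding Seq by (intro borel_image_compact_open opn) (auto simp: B_def intro!: continuous_intros)
    show "disjoint_family S"
      unfolding S_def by (rule disjoint_family_disjointed)
    have "(\<Union>i. S i) = (\<Union>i. B i)"
      unfolding S_def by (rule UN_disjointed_eq)
    also have "\<dots> = (\<Union>w\<in>range (from_nat_into W). cball w (r w))"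
      by (simp add: B_def)
    also have "\<dots> = U"
      unfolding UW range_from_nat_into[OF \<open>W \<noteq> {}\<close> W(2)] ..
    finally show "(\<Union>i. S i) = {w. poly (pderiv h) w \<noteq> 0}" by (simp add: U_def)
  qed
qed

lemma borel_measurable_poly [measurable]: "poly (p :: complex poly) \<in> borel_measurable borel"
  by (intro borel_measurable_continuous_onI continuous_intros)

text \<open>On a piece where \<open>h\<close> is injective the weight integrates to the area of the
  image. Summed over the pieces, a value \<open>u\<close> is counted once for each preimage, which
  is \<open>degree h\<close> times unless \<open>u\<close> is one of the finitely many critical
  values.\<close>

lemma distr_poly_area:
  fixes h :: "complex poly"
  assumes h: "degree h > 0"
  shows "distr (density lborel (\<lambda>w. ennreal ((cmod (poly (pderiv h) w))\<^sup>2))) borel (poly h)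
       = scale_measure (of_nat (degree h)) lborel"
proof (rule measure_eqI)
  fix A assume "A \<in> sets (distr (density lborel (\<lambda>w. ennreal ((cmod (poly (pderiv h) w))\<^sup>2))) borel (poly h))"
  then have A [measurable]: "A \<in> sets borel" by simp
  obtain S where S [measurable]: "\<And>i. S i \<in> sets borel" and S2: "\<And>i::nat. bounded (S i)" 
    "\<And>i. inj_on (poly h) (S i)"
    and S3 [measurable]: "\<And>i. poly h ` S i \<in> sets borel" and S4: "disjoint_family S"
    "(\<Union>i. S i) = {w. poly (pderiv h) w \<noteq> 0}"
    using locally_injective_cover[OF h] by metis
  define J where "J w = ennreal ((cmod (poly (pderiv h) w))\<^sup>2)" for w
  have [measurable]: "J \<in> borel_measurable borel" unfolding J_def by measurable
  define E where "E = poly h -` A"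
  have E [measurable]: "E \<in> sets borel"
    using measurable_sets[OF borel_measurable_poly A] by (simp add: E_def)
  have "emeasure (distr (density lborel J) borel (poly h)) A = (\<integral>\<^sup>+ w. J w * indicator E w \<partial>lborel)"
    using E unfolding E_def by (subst emeasure_distr) (auto simp: emeasure_density)
  also have "\<dots> = (\<integral>\<^sup>+ w. (\<Sum>i. J w * indicator (S i \<inter> E) w) \<partial>lborel)"
  proof (intro nn_integral_cong)
    fix w
    have "(\<Sum>i. J w * indicator (S i \<inter> E) w) = J w * (\<Sum>i. indicator (S i \<inter> E) w)"
      by simp
    also have "(\<Sum>i. indicator (S i \<inter> E) w :: ennreal) = indicator (\<Union>i. S i \<inter> E) w"
      using S4(1) by (intro suminf_indicator) (auto simp: disjoint_family_on_def)
    \<comment> \<open>The pieces miss only the critical points, where \<open>J\<close>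
      vanishes.\<close>
    also have "J w * \<dots> = J w * indicator E w"
      using S4(2) by (auto simp: indicator_def J_def)
    finally show "J w * indicator E w = (\<Sum>i. J w * indicator (S i \<inter> E) w)" by simp
  qed
  also have "\<dots> = (\<Sum>i. \<integral>\<^sup>+ w. J w * indicator (S i \<inter> E) w \<partial>lborel)"
    by (rule nn_integral_suminf) measurable
  also have "\<dots> = (\<Sum>i. \<integral>\<^sup>+ u. indicator (poly h ` S i) u * indicator A u \<partial>lborel)"
  proof (rule suminf_cong)
    fix i
    have eq: "poly h ` (S i \<inter> E) = poly h ` S i \<inter> A" by (auto simp: E_def)
    have "(\<integral>\<^sup>+ w. J w * indicator (S i \<inter> E) w \<partial>lborel) = emeasure lborel (poly h ` (S i \<inter> E))"
      unfolding J_def using S2 S S3 A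
      by (subst emeasure_image_complex_derivative[of _ "poly h" "poly (pderiv h)"])
         (auto intro!: poly_DERIV continuous_intros inj_on_Int bounded_Int simp: eq)
    also have "\<dots> = (\<integral>\<^sup>+ u. indicator (poly h ` S i) u * indicator A u \<partial>lborel)"
      unfolding eq by (simp add: indicator_inter_arith[symmetric])
    finally show "(\<integral>\<^sup>+ w. J w * indicator (S i \<inter> E) w \<partial>lborel)
        = (\<integral>\<^sup>+ u. indicator (poly h ` S i) u * indicator A u \<partial>lborel)" .
  qed
  also have "\<dots> = (\<integral>\<^sup>+ u. (\<Sum>i. indicator (poly h ` S i) u) * indicator A u \<partial>lborel)"
    by (subst nn_integral_suminf[symmetric]) (auto intro!: nn_integral_cong)
  also have "\<dots> = (\<integral>\<^sup>+ u. of_nat (degree h) * indicator A u \<partial>lborel)"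
  proof (rule nn_integral_cong_AE)
    define crit where "crit = poly h ` {w. poly (pderiv h) w = 0}"
    have "pderiv h \<noteq> 0" using h by (simp add: pderiv_eq_0_iff)
    then have "finite crit" unfolding crit_def by (intro finite_imageI poly_roots_finite)
    then have "AE u in lborel. u \<notin> crit"
      by (intro AE_not_in finite_imp_null_set_lborel)
    then show "AE u in lborel. (\<Sum>i. indicator (poly h ` S i) u) * indicator A u
        = (of_nat (degree h) * indicator A u :: ennreal)"
    proof eventually_elim
      fix u assume u: "u \<notin> crit"
      define R where "R = {w. poly h w = u}"
      have R: "finite R" "card R = degree h" "R \<subseteq> (\<Union>i. S i)"
        using card_roots_generic[OF h, of u] u S4(2) by (auto simp: R_def crit_def)
      \<comment> \<open>No preimage of \<open>u\<close> is critical, so each lies in exactly one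
        piece, and by injectivity a piece contains at most one of them.\<close>
      have "(\<Sum>i. indicator (poly h ` S i) u) = (\<Sum>i. \<Sum>w\<in>R. indicator (S i) w :: ennreal)"
      proof (rule suminf_cong)
        fix i
        have "inj_on (poly h) (S i)" by fact
        show "indicator (poly h ` S i) u = (\<Sum>w\<in>R. indicator (S i) w :: ennreal)"
        proof (cases "u \<in> poly h ` S i")
          case True
          then obtain w where w: "w \<in> S i" "u = poly h w" by auto
          then have "R \<inter> S i = {w}" using S2(2)[of i] by (auto simp: R_def inj_on_def)
          moreover have "(\<Sum>w\<in>R. indicator (S i) w :: ennreal) = of_nat (card (R \<inter> S i))"
            using R(1) by (simp add: indicator_def sum_of_bool_eq)
          ultimately show ?thesis using True by simp
        next
          case False
          then have "\<forall>w\<in>R. indicator (S i) w = (0 :: ennreal)" by (auto simp: R_def indicator_def)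
          then show ?thesis using False by simp
        qed
      qed
      also have "\<dots> = (\<Sum>w\<in>R. \<Sum>i. indicator (S i) w :: ennreal)"
        by (rule suminf_sum) auto
      also have "\<dots> = (\<Sum>w\<in>R. indicator (\<Union>i. S i) w)"
        by (intro sum.cong refl suminf_indicator S4)
      also have "\<dots> = of_nat (degree h)"
        using R by (simp add: subset_iff indicator_def)
      finally show "(\<Sum>i. indicator (poly h ` S i) u) * indicator A u
        = (of_nat (degree h) * indicator A u :: ennreal)" by simp
    qed
  qed
  also have "\<dots> = emeasure (scale_measure (of_nat (degree h)) lborel) A"
    by (simp add: nn_integral_cmult_indicator)
  finally show "emeasure (distr (density lborel (\<lambda>w. ennreal ((cmod (poly (pderiv h) w))\<^sup>2))) borel (poly h)) A
      = emeasure (scale_measure (of_nat (degree h)) lborel) A"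
    by (simp add: J_def[abs_def])
qed simp

lemma nn_integral_poly_area:
  fixes h :: "complex poly"
  assumes h: "degree h > 0" and [measurable]: "f \<in> borel_measurable borel"
  shows "(\<integral>\<^sup>+ w. f (poly h w) * ennreal ((cmod (poly (pderiv h) w))\<^sup>2) \<partial>lborel)
       = of_nat (degree h) * (\<integral>\<^sup>+ u. f u \<partial>lborel)"
proof -
  define J where "J w = ennreal ((cmod (poly (pderiv h) w))\<^sup>2)" for w
  have [measurable]: "J \<in> borel_measurable borel" unfolding J_def by measurable
  have "(\<integral>\<^sup>+ w. f (poly h w) * J w \<partial>lborel) = (\<integral>\<^sup>+ w. J w * f (poly h w) \<partial>lborel)"
    by (simp only: mult.commute)
  also have "\<dots> = (\<integral>\<^sup>+ w. f (poly h w) \<partial>density lborel J)"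
    by (rule nn_integral_density[symmetric]) measurable
  also have "\<dots> = (\<integral>\<^sup>+ u. f u \<partial>distr (density lborel J) borel (poly h))"
    by (rule nn_integral_distr[symmetric]) measurable
  also have "\<dots> = (\<integral>\<^sup>+ u. f u \<partial>scale_measure (of_nat (degree h)) lborel)"
    unfolding distr_poly_area[OF h, folded J_def] ..
  also have "\<dots> = of_nat (degree h) * (\<integral>\<^sup>+ u. f u \<partial>lborel)"
    by (rule nn_integral_scale_measure) measurable
  finally show ?thesis unfolding J_def .
qed

text \<open>The area formula for the linear polynomial \<open>[:0, c:]\<close>, with constant
  derivative \<open>c\<close> and covering number 1.\<close>

lemma nn_integral_complex_scale:
  fixes c :: complex
  assumes "c \<noteq> 0" and [measurable]: "f \<in> borel_measurable borel"
  shows "(\<integral>\<^sup>+ w. f (c * w) * ennreal ((cmod c)\<^sup>2) \<partial>lborel) = (\<integral>\<^sup>+ u. f u \<partial>lborel)"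
proof -
  have 1: "pderiv [:0, c:] = [:c:]"
    by (rule poly_eqI) (auto simp: coeff_pderiv coeff_pCons split: nat.splits)
  have 2: "poly [:0, c:] w = c * w" "poly [:c:] w = c" for w by simp_all
  have 3: "degree [:0, c:] = 1" using assms(1) by simp
  show ?thesis
    using nn_integral_poly_area[of "[:0, c:]" f] assms(2) unfolding 1 2 3 by simp
qed

section \<open>Lebesgue measure on coefficients and on roots\<close>

lemma space_polys_borel [simp]: "space (polys_borel n) = polys n"
  by (simp add: polys_borel_def)

lemma measurable_polys_borelI:
  assumes "\<And>x. x \<in> space M \<Longrightarrow> f x \<in> polys n"
    and "\<And>i. (\<lambda>x. coeff (f x) i) \<in> borel_measurable M"
  shows "f \<in> measurable M (polys_borel n)"
  unfolding polys_borel_def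
  by (rule measurable_vimage_algebra2)
     (use assms in \<open>auto intro!: measurable_coordinatewise_then_product\<close>)

lemma measurable_polys_borel_coeff [measurable]:
  "(\<lambda>p. coeff p i) \<in> borel_measurable (polys_borel n)"
proof -
  have "coeff \<in> measurable (polys_borel n) (borel :: (nat \<Rightarrow> complex) measure)"
    unfolding polys_borel_def by (rule measurable_vimage_algebra1) auto
  then show ?thesis by (rule measurable_product_then_coordinatewise)
qed

lemma measurable_coeff_compose:
  assumes "f \<in> measurable M (polys_borel n)"
  shows "(\<lambda>x. coeff (f x) i) \<in> borel_measurable M"
  by (rule measurable_compose[OF assms measurable_polys_borel_coeff])

lemma measurable_polys_borel_in:
  assumes "f \<in> measurable M (polys_borel n)" "x \<in> space M"
  shows "f x \<in> polys n"
  using measurable_space[OF assms] by simp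

lemma poly_eq_sum_le:
  assumes "p \<in> polys n"
  shows "poly p x = (\<Sum>i\<le>n. coeff p i * x ^ i)"
  unfolding poly_altdef
  by (rule sum.mono_neutral_left) (use assms in \<open>auto simp: polys_def coeff_eq_0\<close>)

lemma measurable_poly_eval:
  assumes f: "f \<in> measurable M (polys_borel n)" and [measurable]: "g \<in> borel_measurable M"
  shows "(\<lambda>x. poly (f x) (g x)) \<in> borel_measurable M"
proof -
  have [measurable]: "(\<lambda>x. coeff (f x) i) \<in> borel_measurable M" for i
    by (rule measurable_coeff_compose[OF f])
  have "(\<lambda>x. \<Sum>i\<le>n. coeff (f x) i * g x ^ i) \<in> borel_measurable M"
    by measurable
  then show ?thesis
    by (rule measurable_cong[THEN iffD1, rotated])
       (simp add: poly_eq_sum_le[OF measurable_polys_borel_in[OF f]])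
qed

lemma measurable_poly_mult:
  assumes f: "f \<in> measurable M (polys_borel n)" and g: "g \<in> measurable M (polys_borel m)"
  shows "(\<lambda>x. f x * g x) \<in> measurable M (polys_borel (n + m))"
proof (rule measurable_polys_borelI)
  show "f x * g x \<in> polys (n + m)" if "x \<in> space M" for x
    using measurable_polys_borel_in[OF f that] measurable_polys_borel_in[OF g that]
    by (auto simp: polys_def intro: order.trans[OF degree_mult_le])
  have [measurable]: "(\<lambda>x. coeff (f x) i) \<in> borel_measurable M" "(\<lambda>x. coeff (g x) i) \<in> borel_measurable M" for i
    by (rule measurable_coeff_compose[OF f] measurable_coeff_compose[OF g])+
  show "(\<lambda>x. coeff (f x * g x) i) \<in> borel_measurable M" for i
    unfolding coeff_mult by measurable
qed

lemma measurable_poly_pCons: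
  assumes f: "f \<in> measurable M (polys_borel n)" and [measurable]: "g \<in> borel_measurable M"
  shows "(\<lambda>x. pCons (g x) (f x)) \<in> measurable M (polys_borel (Suc n))"
proof (rule measurable_polys_borelI)
  show "pCons (g x) (f x) \<in> polys (Suc n)" if "x \<in> space M" for x
    using measurable_polys_borel_in[OF f that]
    by (auto simp: polys_def intro: order.trans[OF degree_pCons_le])
  show "(\<lambda>x. coeff (pCons (g x) (f x)) i) \<in> borel_measurable M" for i
    using measurable_coeff_compose[OF f] by (cases i) auto
qed

lemma measurable_poly_smult:
  assumes f: "f \<in> measurable M (polys_borel n)" and [measurable]: "g \<in> borel_measurable M"
  shows "(\<lambda>x. smult (g x) (f x)) \<in> measurable M (polys_borel n)"
proof (rule measurable_polys_borelI)
  show "smult (g x) (f x) \<in> polys n" if "x \<in> space M" for x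
    using measurable_polys_borel_in[OF f that]
    by (auto simp: polys_def intro: order.trans[OF degree_smult_le])
  have [measurable]: "(\<lambda>x. coeff (f x) i) \<in> borel_measurable M" for i
    by (rule measurable_coeff_compose[OF f])
  show "(\<lambda>x. coeff (smult (g x) (f x)) i) \<in> borel_measurable M" for i
    by simp
qed

lemma measurable_poly_pderiv:
  assumes f: "f \<in> measurable M (polys_borel n)"
  shows "(\<lambda>x. pderiv (f x)) \<in> measurable M (polys_borel n)"
proof (rule measurable_polys_borelI)
  show "pderiv (f x) \<in> polys n" if "x \<in> space M" for x
    using measurable_polys_borel_in[OF f that] by (auto simp: polys_def degree_pderiv)
  have [measurable]: "(\<lambda>x. coeff (f x) i) \<in> borel_measurable M" for i
    by (rule measurable_coeff_compose[OF f])
  show "(\<lambda>x. coeff (pderiv (f x)) i) \<in> borel_measurable M" for i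
    unfolding coeff_pderiv by measurable
qed

lemma measurable_linear_factor:
  assumes [measurable]: "g \<in> borel_measurable M"
  shows "(\<lambda>x. [:- g x, 1:]) \<in> measurable M (polys_borel 1)"
  unfolding One_nat_def
  by (intro measurable_poly_pCons measurable_polys_borelI) (auto simp: polys_def)

lemma measurable_prod_linear:
  assumes "\<And>i. i < n \<Longrightarrow> g i \<in> borel_measurable M"
  shows "(\<lambda>x. \<Prod>i<n. [:- g i x, 1:]) \<in> measurable M (polys_borel n)"
  using assms
proof (induction n)
  case 0
  show ?case by (rule measurable_polys_borelI) (auto simp: polys_def)
next
  case (Suc n)
  from measurable_poly_mult[OF Suc.IH measurable_linear_factor[of "g n"]] Suc.prems
  show ?case by simp
qed

text \<open>Polynomials of degree at most \<open>n\<close> with leading coefficient \<open>a\<close>. The remaining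
  coefficients are listed from the top downwards, so that a new one is always the constant
  coefficient.\<close>

primrec lead_poly :: "complex \<Rightarrow> nat \<Rightarrow> (nat \<Rightarrow> complex) \<Rightarrow> complex poly" where
  "lead_poly a 0 x = [:a:]"
| "lead_poly a (Suc n) x = pCons (x n) (lead_poly a n x)"

lemma measurable_lead_poly:
  assumes "g \<in> borel_measurable M" "\<And>i. i < n \<Longrightarrow> (\<lambda>x. f x i) \<in> borel_measurable M"
  shows "(\<lambda>x. lead_poly (g x) n (f x)) \<in> measurable M (polys_borel n)"
  using assms(2)
proof (induction n)
  case 0
  show ?case using assms(1) by (intro measurable_polys_borelI) (auto simp: polys_def coeff_pCons split: nat.splits)
next
  case (Suc n)
  then show ?case by (auto intro!: measurable_poly_pCons)
qed

lemma lead_poly_cong: "(\<And>i. i < n \<Longrightarrow> x i = y i) \<Longrightarrow> lead_poly a n x = lead_poly a n y"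
  by (induction n) auto

lemma lead_poly_upd [simp]: "lead_poly a n (x(n := y)) = lead_poly a n x"
  by (rule lead_poly_cong) auto

lemma degree_lead_poly: "a \<noteq> 0 \<Longrightarrow> degree (lead_poly a n x) = n \<and> lead_poly a n x \<noteq> 0"
  by (induction n) auto

section \<open>Lebesgue measure on powers of the plane and the shear\<close>

interpretation lebesgue_powers: product_sigma_finite "\<lambda>_ :: nat. lborel :: complex measure"
  by standard

abbreviation lebesgue_power :: "nat \<Rightarrow> (nat \<Rightarrow> complex) measure" where
  "lebesgue_power n \<equiv> \<Pi>\<^sub>M i\<in>{..<n}. (lborel :: complex measure)"

lemma measurable_component: "i < m \<Longrightarrow> (\<lambda>z. z i) \<in> borel_measurable (lebesgue_power m)"
  using measurable_component_singleton[of i "{..<m}" "\<lambda>_. lborel :: complex measure"] by simp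

lemma sigma_finite_lebesgue_power: "sigma_finite_measure (lebesgue_power n)"
  by (rule lebesgue_powers.sigma_finite) simp

text \<open>The first form keeps the last coordinate innermost and serves for a constant
  coefficient; the second puts it outermost and serves for a root or a leading coefficient.\<close>

lemma nn_integral_lebesgue_power_Suc:
  assumes [measurable]: "f \<in> borel_measurable (lebesgue_power (Suc n))"
  shows "(\<integral>\<^sup>+ x. f x \<partial>lebesgue_power (Suc n))
      = (\<integral>\<^sup>+ x. \<integral>\<^sup>+ y. f (x(n := y)) \<partial>lborel \<partial>lebesgue_power n)"
    and "(\<integral>\<^sup>+ x. f x \<partial>lebesgue_power (Suc n))
      = (\<integral>\<^sup>+ y. \<integral>\<^sup>+ x. f (x(n := y)) \<partial>lebesgue_power n \<partial>lborel)"
  using assms unfolding lessThan_Suc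
  by (intro lebesgue_powers.product_nn_integral_insert lebesgue_powers.product_nn_integral_insert_rev; simp)+

lemma nn_integral_complex_translate:
  fixes c :: complex
  assumes [measurable]: "f \<in> borel_measurable borel"
  shows "(\<integral>\<^sup>+ w. f (c + w) \<partial>lborel) = (\<integral>\<^sup>+ w. f w \<partial>lborel)"
  by (subst (2) lborel_distr_plus[symmetric, of c], subst nn_integral_distr) auto

text \<open>For monic q with lower coefficients \<open>c 0\<close>, \<open>c 1\<close>, ... from the
  top, these are the coefficients of (X - w) q between the leading and the constant one. The case
  \<open>k = 0\<close> stands for the leading coefficient 1 of q. Synthetic division is the inverse
  map.\<close>

definition horner_shear :: "complex \<Rightarrow> (nat \<Rightarrow> complex) \<Rightarrow> nat \<Rightarrow> complex" where
  "horner_shear w c k = c k - w * (if k = 0 then 1 else c (k - 1))"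

lemma coeff_0_lead_poly: "coeff (lead_poly a n x) 0 = (if n = 0 then a else x (n - 1))"
  by (cases n) auto

lemma lead_poly_mult_linear:
  "lead_poly 1 n c * [:- w, 1:]
    = pCons (- w * coeff (lead_poly 1 n c) 0) (lead_poly 1 n (horner_shear w c))"
proof (induction n)
  case (Suc n)
  have "lead_poly 1 (Suc n) c * [:- w, 1:]
      = smult (c n) [:- w, 1:] + pCons 0 (lead_poly 1 n c * [:- w, 1:])"
    by (simp only: lead_poly.simps mult_pCons_left)
  also have "\<dots> = pCons (- w * coeff (lead_poly 1 (Suc n) c) 0) (lead_poly 1 (Suc n) (horner_shear w c))"
    by (subst Suc.IH) (simp add: horner_shear_def coeff_0_lead_poly)
  finally show ?case .
qed simp

lemma borel_measurable_lead_poly: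
  assumes [measurable]: "H \<in> borel_measurable (polys_borel n)" 
   and "g \<in> borel_measurable M" "\<And>i. i < n \<Longrightarrow> (\<lambda>x. f x i) \<in> borel_measurable M"
  shows "(\<lambda>x. H (lead_poly (g x) n (f x))) \<in> borel_measurable M"
  by (rule measurable_compose[OF measurable_lead_poly assms(1)]) fact+

text \<open>The shear is triangular with unit diagonal: each coordinate is shifted by a quantity
  that depends on the preceding one only. Integrating from the last coordinate inwards, translation
  invariance removes one shift at a time.\<close>

lemma nn_integral_horner_shear:
  assumes "H \<in> borel_measurable (polys_borel n)"
  shows "(\<integral>\<^sup>+ c. H (lead_poly 1 n (horner_shear w c)) \<partial>lebesgue_power n)
       = (\<integral>\<^sup>+ c. H (lead_poly 1 n c) \<partial>lebesgue_power n)"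
  using assms
proof (induction n arbitrary: H)
  case 0
  then show ?case by simp
next
  case (Suc n)
  note H [measurable] = Suc.prems
  have H' [measurable]: "(\<lambda>q. \<integral>\<^sup>+ y. H (pCons y q) \<partial>lborel) \<in> borel_measurable (polys_borel n)"
  proof (rule lborel.borel_measurable_nn_integral)
    have "(\<lambda>p. pCons (snd p) (fst p)) \<in> measurable (polys_borel n \<Otimes>\<^sub>M lborel) (polys_borel (Suc n))"
      by (intro measurable_poly_pCons) auto
    from measurable_compose[OF this H]
    show "(\<lambda>(q, y). H (pCons y q)) \<in> borel_measurable (polys_borel n \<Otimes>\<^sub>M lborel)"
      by (simp add: case_prod_unfold)
  qed
  have m1: "(\<lambda>c. H (lead_poly 1 (Suc n) (horner_shear w c))) \<in> borel_measurable (lebesgue_power (Suc n))"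
  proof (rule borel_measurable_lead_poly[OF H])
    show "(\<lambda>x. horner_shear w x i) \<in> borel_measurable (lebesgue_power (Suc n))" if "i < Suc n" for i
      using that unfolding horner_shear_def by (cases i) (auto intro!: borel_measurable_diff borel_measurable_times)
  qed simp
  have m2: "(\<lambda>c. H (lead_poly 1 (Suc n) c)) \<in> borel_measurable (lebesgue_power (Suc n))"
    by (rule borel_measurable_lead_poly[OF H]) auto
  \<comment> \<open>With \<open>q\<close> held fixed, the constant coefficient undergoes a
    translation of the plane.\<close>
  have *: "(\<integral>\<^sup>+ y. H (pCons (y - s) q) \<partial>lborel) = (\<integral>\<^sup>+ y. H (pCons y q) \<partial>lborel)" if "q \<in> polys n" for q s
  proof -
    have "(\<lambda>y. H (pCons y q)) \<in> borel_measurable borel"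
      using that by (intro measurable_compose[OF _ H] measurable_poly_pCons measurable_const) auto
    from nn_integral_complex_translate[OF this, of "-s"] show ?thesis by simp
  qed
  have shear: "lead_poly 1 n (horner_shear w (c(n := y))) = lead_poly 1 n (horner_shear w c)" for c y
    by (rule lead_poly_cong) (auto simp: horner_shear_def)
  have last: "horner_shear w (c(n := y)) n = y - w * (if n = 0 then 1 else c (n - 1))" for c y
    by (cases n) (auto simp: horner_shear_def)
  have deg: "lead_poly 1 n c \<in> polys n" for c
    using degree_lead_poly[of 1 n c] by (auto simp: polys_def)
  have "(\<integral>\<^sup>+ c. H (lead_poly 1 (Suc n) (horner_shear w c)) \<partial>lebesgue_power (Suc n))
      = (\<integral>\<^sup>+ c. \<integral>\<^sup>+ y. H (pCons (y - w * (if n = 0 then 1 else c (n - 1))) (lead_poly 1 n (horner_shear w c))) \<partial>lborel \<partial>lebesgue_power n)"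
    unfolding nn_integral_lebesgue_power_Suc(1)[OF m1]
    by (simp add: shear last)
  also have "\<dots> = (\<integral>\<^sup>+ c. \<integral>\<^sup>+ y. H (pCons y (lead_poly 1 n (horner_shear w c))) \<partial>lborel \<partial>lebesgue_power n)"
    by (simp only: *[OF deg])
  also have "\<dots> = (\<integral>\<^sup>+ c. \<integral>\<^sup>+ y. H (pCons y (lead_poly 1 n c)) \<partial>lborel \<partial>lebesgue_power n)"
    by (rule Suc.IH[OF H'])
  also have "\<dots> = (\<integral>\<^sup>+ c. H (lead_poly 1 (Suc n) c) \<partial>lebesgue_power (Suc n))"
    unfolding nn_integral_lebesgue_power_Suc(1)[OF m2] by simp
  finally show ?case .
qed

section \<open>The change of variables between roots and coefficients\<close>

definition vandermonde_sq :: "nat \<Rightarrow> (nat \<Rightarrow> complex) \<Rightarrow> real" where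
  "vandermonde_sq n z = (\<Prod>j<n. \<Prod>i<j. (cmod (z i - z j))\<^sup>2)"

lemma borel_measurable_vandermonde_sq [measurable]:
  "vandermonde_sq n \<in> borel_measurable (lebesgue_power n)"
proof -
  note measurable_component [measurable]
  have "(\<lambda>z. (cmod (z i - z j))\<^sup>2) \<in> borel_measurable (lebesgue_power n)" if "j < n" "i < j" for i j
  proof -
    have [simp]: "i < n" using that by simp
    show ?thesis using that by measurable
  qed
  then show ?thesis
    unfolding vandermonde_sq_def[abs_def] by (intro borel_measurable_prod) auto
qed

lemma vandermonde_sq_nonneg: "vandermonde_sq n z \<ge> 0"
  by (auto simp: vandermonde_sq_def intro!: prod_nonneg)

text \<open>The factor of the new root \<open>w\<close> is |q(w)|^2 = |p'(w)|^2 for p = (X - w) q,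
  exactly the weight in the area formula.\<close>

lemma vandermonde_sq_Suc_upd:
  "vandermonde_sq (Suc n) (z(n := w))
    = (cmod (poly (\<Prod>i<n. [:- z i, 1:]) w))\<^sup>2 * vandermonde_sq n z"
proof -
  have "vandermonde_sq n (z(n := w)) = vandermonde_sq n z"
    by (auto simp: vandermonde_sq_def intro!: prod.cong)
  moreover have "(\<Prod>i<n. (cmod ((z(n := w)) i - (z(n := w)) n))\<^sup>2) = (cmod (poly (\<Prod>i<n. [:- z i, 1:]) w))\<^sup>2"
    by (auto simp: poly_prod prod_norm[symmetric] prod_power_distrib norm_minus_commute intro!: prod.cong)
  ultimately show ?thesis
    by (simp add: vandermonde_sq_def)
qed

lemma prod_linear_polys: "(\<Prod>i<n. [:- z i, 1:]) \<in> polys n"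
proof -
  have "degree (\<Prod>i<n. [:- z i, 1:]) \<le> (\<Sum>i<n. degree [:- z i, 1:])"
    by (rule order.trans[OF degree_prod_sum_le]) auto
  then show ?thesis by (simp add: polys_def)
qed

lemma borel_measurable_prod_linear [measurable]:
  assumes "F \<in> borel_measurable (polys_borel n)"
  shows "(\<lambda>z. F (\<Prod>i<n. [:- z i, 1:])) \<in> borel_measurable (lebesgue_power n)"
  by (rule measurable_compose[OF _ assms], rule measurable_prod_linear) simp

text \<open>The root \<open>w\<close> is split off: \<open>p = (X - w) q\<close> has \<open>p'(w) = q(w)\<close>, and for fixed \<open>w\<close> the
  non-constant coefficients of \<open>p\<close> are a unipotent shear of those of \<open>q\<close>; for fixed non-constant
  coefficients, the constant one is minus a polynomial of degree \<open>n\<close> in \<open>w\<close>, to which the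
  one-dimensional area formula applies.\<close>

lemma nn_integral_roots_coeffs:
  assumes "F \<in> borel_measurable (polys_borel n)"
  shows "(\<integral>\<^sup>+ z. F (\<Prod>i<n. [:- z i, 1:]) * ennreal (vandermonde_sq n z) \<partial>lebesgue_power n)
       = fact n * (\<integral>\<^sup>+ c. F (lead_poly 1 n c) \<partial>lebesgue_power n)"
  using assms
proof (induction n arbitrary: F)
  case 0
  then show ?case by (simp add: vandermonde_sq_def one_pCons)
next
  case (Suc n)
  note F [measurable] = Suc.prems
  interpret LP: sigma_finite_measure "lebesgue_power n" by (rule sigma_finite_lebesgue_power)
  interpret pair_sigma_finite "lborel :: complex measure" "lebesgue_power n" by standard
  \<comment> \<open>\<open>G\<close> expresses the integrand through the cofactor q of the root
    \<open>w\<close>; \<open>K\<close> expresses it through the nonconstant coefficients of p = (X -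
    w) q. In \<open>K\<close> the constant coefficient is forced by p(w) = 0, and it does not affect
    the derivative.\<close>
  define G where "G w q = F (q * [:- w, 1:]) * ennreal ((cmod (poly q w))\<^sup>2)" for w q
  define K where "K w q = F (pCons (- poly (pCons 0 q) w) q)
      * ennreal ((cmod (poly (pderiv (pCons 0 q)) w))\<^sup>2)" for w q
  have G [measurable]: "G w \<in> borel_measurable (polys_borel n)" for w
  proof -
    have "(\<lambda>q. q * [:- w, 1:]) \<in> measurable (polys_borel n) (polys_borel (n + 1))"
      by (intro measurable_poly_mult measurable_linear_factor) auto
    then have "(\<lambda>q. q * [:- w, 1:]) \<in> measurable (polys_borel n) (polys_borel (Suc n))"
      unfolding Suc_eq_plus1 .
    from measurable_compose[OF this F]
    have [measurable]: "(\<lambda>q. F (q * [:- w, 1:])) \<in> borel_measurable (polys_borel n)" .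
    have [measurable]: "(\<lambda>q. poly q w) \<in> borel_measurable (polys_borel n)"
      by (intro measurable_poly_eval[where n = n]) auto
    show ?thesis unfolding G_def[abs_def] by measurable
  qed
  have K2: "(\<lambda>x. K (g x) (f x)) \<in> borel_measurable M"
    if f: "f \<in> measurable M (polys_borel n)" and g [measurable]: "g \<in> borel_measurable M" for M :: "'b measure" and f g
  proof -
    have p0: "(\<lambda>x. pCons 0 (f x)) \<in> measurable M (polys_borel (Suc n))"
      by (intro measurable_poly_pCons f) auto
    have [measurable]: "(\<lambda>x. poly (pCons 0 (f x)) (g x)) \<in> borel_measurable M"
      "(\<lambda>x. poly (pderiv (pCons 0 (f x))) (g x)) \<in> borel_measurable M"
      by (rule measurable_poly_eval[OF _ g] measurable_poly_pderiv p0)+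
    have [measurable]: "(\<lambda>x. F (pCons (- poly (pCons 0 (f x)) (g x)) (f x))) \<in> borel_measurable M"
      by (rule measurable_compose[OF _ F], rule measurable_poly_pCons[OF f]) measurable
    show ?thesis unfolding K_def by measurable
  qed
  have K [measurable]: "K w \<in> borel_measurable (polys_borel n)" for w
    using K2[of "\<lambda>q. q" "polys_borel n" "\<lambda>_. w"] by simp
  have GK: "G w (lead_poly 1 n c) = K w (lead_poly 1 n (horner_shear w c))" for w c
  proof -
    let ?q = "lead_poly 1 n c" and ?r = "lead_poly 1 n (horner_shear w c)"
    define c0 where "c0 = - w * coeff ?q 0"
    have eq: "?q * [:- w, 1:] = pCons c0 ?r"
      unfolding c0_def by (rule lead_poly_mult_linear)
    have "poly (pCons c0 ?r) w = 0"
      unfolding eq[symmetric] by simp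
    then have c0: "c0 = - poly (pCons 0 ?r) w"
      by (simp add: add_eq_0_iff2)
    have "poly (pderiv (pCons 0 ?r)) w = poly (pderiv (?q * [:- w, 1:])) w"
      unfolding eq by (simp add: pderiv_pCons)
    \<comment> \<open>The derivative is q + (X - w) q', whose second term vanishes at
      \<open>w\<close>.\<close>
    also have "\<dots> = poly ?q w"
      unfolding pderiv_mult by (simp add: pderiv.simps)
    finally show ?thesis
      unfolding G_def K_def eq c0 by simp
  qed
  have area: "(\<integral>\<^sup>+ w. K w (lead_poly 1 n d) \<partial>lborel)
      = of_nat (Suc n) * (\<integral>\<^sup>+ u. F (lead_poly 1 (Suc n) (d(n := u))) \<partial>lborel)" for d
  proof -
    let ?r = "lead_poly 1 n d"
    have deg: "degree (pCons 0 ?r) = Suc n"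
      using degree_lead_poly[of 1 n d] by simp
    have r: "?r \<in> polys n" using degree_lead_poly[of 1 n d] by (simp add: polys_def)
    have m1 [measurable]: "(\<lambda>u. F (pCons u ?r)) \<in> borel_measurable borel"
      by (intro measurable_compose[OF _ F] measurable_poly_pCons measurable_const) (use r in auto)
    have m2: "(\<lambda>u. F (pCons (- u) ?r)) \<in> borel_measurable borel"
      by measurable
    \<comment> \<open>The polynomial whose area formula is used has degree \<open>Suc n\<close>;
      these degrees multiply up to the factorial.\<close>
    have "(\<integral>\<^sup>+ w. K w ?r \<partial>lborel) = of_nat (Suc n) * (\<integral>\<^sup>+ u. F (pCons (- u) ?r) \<partial>lborel)"
      unfolding K_def using nn_integral_poly_area[OF _ m2, of "pCons 0 ?r"] deg by simp
    also have "(\<integral>\<^sup>+ u. F (pCons (- u) ?r) \<partial>lborel) = (\<integral>\<^sup>+ u. F (pCons u ?r) \<partial>lborel)"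
      using nn_integral_complex_scale[OF _ m1, of "-1"] by simp
    finally show ?thesis by simp
  qed
  have mz: "(\<lambda>z. F (\<Prod>i<Suc n. [:- z i, 1:]) * ennreal (vandermonde_sq (Suc n) z))
      \<in> borel_measurable (lebesgue_power (Suc n))"
    by measurable
  have mc: "(\<lambda>c. F (lead_poly 1 (Suc n) c)) \<in> borel_measurable (lebesgue_power (Suc n))"
    by (rule borel_measurable_lead_poly[OF F]) auto
  have Kjoint: "(\<lambda>(w, d). K w (lead_poly 1 n d)) \<in> borel_measurable (lborel \<Otimes>\<^sub>M lebesgue_power n)"
    unfolding case_prod_unfold by (intro K2 measurable_lead_poly) auto
  have "(\<integral>\<^sup>+ z. F (\<Prod>i<Suc n. [:- z i, 1:]) * ennreal (vandermonde_sq (Suc n) z) \<partial>lebesgue_power (Suc n))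
      = (\<integral>\<^sup>+ w. \<integral>\<^sup>+ z. G w (\<Prod>i<n. [:- z i, 1:]) * ennreal (vandermonde_sq n z) \<partial>lebesgue_power n \<partial>lborel)"
  proof (subst nn_integral_lebesgue_power_Suc(2)[OF mz], intro nn_integral_cong)
    fix w :: complex and z :: "nat \<Rightarrow> complex"
    have "(\<Prod>i<n. [:- (z(n := w)) i, 1:]) = (\<Prod>i<n. [:- z i, 1:])"
      by (auto intro!: prod.cong)
    then show "F (\<Prod>i<Suc n. [:- (z(n := w)) i, 1:]) * ennreal (vandermonde_sq (Suc n) (z(n := w)))
        = G w (\<Prod>i<n. [:- z i, 1:]) * ennreal (vandermonde_sq n z)"
      unfolding vandermonde_sq_Suc_upd G_def
      by (simp add: ennreal_mult' mult.assoc vandermonde_sq_nonneg)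
  qed
  also have "\<dots> = (\<integral>\<^sup>+ w. fact n * (\<integral>\<^sup>+ c. G w (lead_poly 1 n c) \<partial>lebesgue_power n) \<partial>lborel)"
    by (simp only: Suc.IH[OF G])
  also have "\<dots> = (\<integral>\<^sup>+ w. fact n * (\<integral>\<^sup>+ d. K w (lead_poly 1 n d) \<partial>lebesgue_power n) \<partial>lborel)"
    by (simp only: GK nn_integral_horner_shear[OF K])
  also have "\<dots> = fact n * (\<integral>\<^sup>+ w. \<integral>\<^sup>+ d. K w (lead_poly 1 n d) \<partial>lebesgue_power n \<partial>lborel)"
    using LP.borel_measurable_nn_integral[OF Kjoint] by (intro nn_integral_cmult) simp
  also have "(\<integral>\<^sup>+ w. \<integral>\<^sup>+ d. K w (lead_poly 1 n d) \<partial>lebesgue_power n \<partial>lborel)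
      = (\<integral>\<^sup>+ d. \<integral>\<^sup>+ w. K w (lead_poly 1 n d) \<partial>lborel \<partial>lebesgue_power n)"
    using Fubini[OF Kjoint] by simp
  also have "\<dots> = (\<integral>\<^sup>+ d. of_nat (Suc n) * (\<integral>\<^sup>+ u. F (lead_poly 1 (Suc n) (d(n := u))) \<partial>lborel) \<partial>lebesgue_power n)"
    by (simp only: area)
  also have "\<dots> = of_nat (Suc n) * (\<integral>\<^sup>+ d. \<integral>\<^sup>+ u. F (lead_poly 1 (Suc n) (d(n := u))) \<partial>lborel \<partial>lebesgue_power n)"
  proof (rule nn_integral_cmult, rule lborel.borel_measurable_nn_integral)
    have "(\<lambda>p. pCons (snd p) (lead_poly 1 n (fst p))) \<in> measurable (lebesgue_power n \<Otimes>\<^sub>M lborel) (polys_borel (Suc n))"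
      by (intro measurable_poly_pCons measurable_lead_poly) auto
    from measurable_compose[OF this F]
    show "(\<lambda>(d, u). F (lead_poly 1 (Suc n) (d(n := u)))) \<in> borel_measurable (lebesgue_power n \<Otimes>\<^sub>M lborel)"
      by (simp add: case_prod_unfold)
  qed
  also have "(\<integral>\<^sup>+ d. \<integral>\<^sup>+ u. F (lead_poly 1 (Suc n) (d(n := u))) \<partial>lborel \<partial>lebesgue_power n)
      = (\<integral>\<^sup>+ c. F (lead_poly 1 (Suc n) c) \<partial>lebesgue_power (Suc n))"
    by (rule nn_integral_lebesgue_power_Suc(1)[OF mc, symmetric])
  finally show ?case by (simp add: mult.assoc[symmetric] mult.commute[of "fact n"])
qed

section \<open>Gaussian measures on polynomials\<close>

text \<open>\<open>restrict\<close> keeps the translated point inside the space of the product,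
  whose points are \<open>undefined\<close> off the index set.\<close>

lemma nn_integral_lebesgue_power_translate:
  assumes "f \<in> borel_measurable (lebesgue_power n)"
  shows "(\<integral>\<^sup>+ x. f (restrict (\<lambda>k. x k + v k) {..<n}) \<partial>lebesgue_power n) = (\<integral>\<^sup>+ x. f x \<partial>lebesgue_power n)"
  using assms
proof (induction n arbitrary: f)
  case 0
  show ?case by (simp add: restrict_def lebesgue_powers.nn_integral_empty del: nn_integral_const)
next
  case (Suc n)
  note f [measurable] = Suc.prems
  define R where "R x = restrict (\<lambda>k. x k + v k) {..<n}" for x
  have R: "R x \<in> space (lebesgue_power n)" for x
    by (auto simp: R_def space_PiM)
  have mf: "(\<lambda>(x, y). f (x(n := y))) \<in> borel_measurable (lebesgue_power n \<Otimes>\<^sub>M lborel)"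
    using measurable_comp[OF measurable_add_dim[of n "{..<n}" "\<lambda>_. lborel :: complex measure"], of f borel] f
    by (simp add: lessThan_Suc comp_def case_prod_unfold)
  have mfx: "(\<lambda>y. f (x(n := y))) \<in> borel_measurable borel" if "x \<in> space (lebesgue_power n)" for x
    using measurable_compose[OF measurable_Pair1'[OF that] mf] by simp
  have upd: "restrict (\<lambda>k. (x(n := y)) k + v k) {..<Suc n} = (R x)(n := v n + y)" for x y
    by (auto simp: R_def restrict_def fun_eq_iff)
  have "(\<lambda>x. restrict (\<lambda>k. x k + v k) {..<Suc n}) \<in> measurable (lebesgue_power (Suc n)) (lebesgue_power (Suc n))"
    by (rule measurable_restrict) auto
  from measurable_compose[OF this f]
  have "(\<integral>\<^sup>+ x. f (restrict (\<lambda>k. x k + v k) {..<Suc n}) \<partial>lebesgue_power (Suc n))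
      = (\<integral>\<^sup>+ x. \<integral>\<^sup>+ y. f ((R x)(n := v n + y)) \<partial>lborel \<partial>lebesgue_power n)"
    unfolding upd[symmetric] by (rule nn_integral_lebesgue_power_Suc(1))
  also have "\<dots> = (\<integral>\<^sup>+ x. \<integral>\<^sup>+ y. f ((R x)(n := y)) \<partial>lborel \<partial>lebesgue_power n)"
    by (simp only: nn_integral_complex_translate[OF mfx[OF R]])
  also have "\<dots> = (\<integral>\<^sup>+ x. \<integral>\<^sup>+ y. f (x(n := y)) \<partial>lborel \<partial>lebesgue_power n)"
    unfolding R_def by (rule Suc.IH) (rule lborel.borel_measurable_nn_integral[OF mf])
  also have "\<dots> = (\<integral>\<^sup>+ x. f x \<partial>lebesgue_power (Suc n))"
    by (rule nn_integral_lebesgue_power_Suc(1)[symmetric]) measurable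
  finally show ?case .
qed

text \<open>The common features of coordinates in a basis and of coefficients that make the image of
  Lebesgue measure translation invariant. The congruence clause makes \<open>M\<close> insensitive
  to values beyond index \<open>n\<close>, which \<open>restrict\<close> alters.\<close>

definition linear_coordinates :: "nat \<Rightarrow> ((nat \<Rightarrow> complex) \<Rightarrow> complex poly) \<Rightarrow> bool" where
  "linear_coordinates n M \<longleftrightarrow> M \<in> measurable (lebesgue_power (Suc n)) (polys_borel n) \<and>
     (\<forall>x y. M (\<lambda>k. x k + y k) = M x + M y) \<and>
     (\<forall>x y. (\<forall>k\<le>n. x k = y k) \<longrightarrow> M x = M y) \<and> (\<forall>p\<in>polys n. \<exists>x. M x = p)"

lemma measurable_linear_coordinates:
  "linear_coordinates n M \<Longrightarrow> M \<in> measurable (lebesgue_power (Suc n)) (polys_borel n)"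
  unfolding linear_coordinates_def by (rule conjunct1)

text \<open>By surjectivity \<open>q\<close> has coordinates \<open>v\<close>, so adding
  \<open>q\<close> to the polynomial is translating its coordinates by \<open>v\<close>.\<close>

lemma linear_coordinates_translate:
  assumes M: "linear_coordinates n M" and H: "H \<in> borel_measurable (polys_borel n)" and q: "q \<in> polys n"
  shows "(\<integral>\<^sup>+ x. H (M x + q) \<partial>lebesgue_power (Suc n)) = (\<integral>\<^sup>+ x. H (M x) \<partial>lebesgue_power (Suc n))"
proof -
  have Mm: "M \<in> measurable (lebesgue_power (Suc n)) (polys_borel n)"
    and add: "\<And>x y. M (\<lambda>k. x k + y k) = M x + M y"
    and cong: "\<And>x y. (\<And>k. k \<le> n \<Longrightarrow> x k = y k) \<Longrightarrow> M x = M y"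
    using M unfolding linear_coordinates_def by blast+
  from M q obtain v where v: "M v = q" by (auto simp: linear_coordinates_def)
  have "M (restrict (\<lambda>k. x k + v k) {..<Suc n}) = M x + q" for x
    by (subst add[of x v, unfolded v, symmetric], rule cong) simp
  then show ?thesis
    using nn_integral_lebesgue_power_translate[OF measurable_compose[OF Mm H], of v] by simp
qed

lemma polys_add: "p \<in> polys n \<Longrightarrow> q \<in> polys n \<Longrightarrow> p + q \<in> polys n"
  by (auto simp: polys_def intro: degree_add_le)

lemma polys_uminus: "p \<in> polys n \<Longrightarrow> - p \<in> polys n"
  by (auto simp: polys_def)

lemma measurable_poly_add:
  assumes f: "f \<in> measurable M (polys_borel n)" and g: "g \<in> measurable M (polys_borel n)"
  shows "(\<lambda>x. f x + g x) \<in> measurable M (polys_borel n)"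
proof (rule measurable_polys_borelI)
  show "f x + g x \<in> polys n" if "x \<in> space M" for x
    by (intro polys_add measurable_polys_borel_in[OF f that] measurable_polys_borel_in[OF g that])
  show "(\<lambda>x. coeff (f x + g x) i) \<in> borel_measurable M" for i
    unfolding coeff_add
    by (intro borel_measurable_add measurable_coeff_compose[OF f] measurable_coeff_compose[OF g])
qed

lemma measurable_poly_uminus:
  assumes f: "f \<in> measurable M (polys_borel n)"
  shows "(\<lambda>x. - f x) \<in> measurable M (polys_borel n)"
proof (rule measurable_polys_borelI)
  show "- f x \<in> polys n" if "x \<in> space M" for x
    by (intro polys_uminus measurable_polys_borel_in[OF f that])
  have [measurable]: "(\<lambda>x. coeff (f x) i) \<in> borel_measurable M" for i
    by (rule measurable_coeff_compose[OF f])
  show "(\<lambda>x. coeff (- f x) i) \<in> borel_measurable M" for i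
    unfolding coeff_minus by measurable
qed

text \<open>Uniqueness of Haar measure on the additive group of polynomials: two Lebesgue measures
  differ by a factor, as double integration of \<open>f (p) g (q - p)\<close> shows.\<close>

lemma linear_coordinates_change:
  assumes M: "linear_coordinates n M" and N: "linear_coordinates n N"
    and f: "f \<in> borel_measurable (polys_borel n)" and g: "g \<in> borel_measurable (polys_borel n)"
  shows "(\<integral>\<^sup>+ a. f (M a) \<partial>lebesgue_power (Suc n)) * (\<integral>\<^sup>+ y. g (N y) \<partial>lebesgue_power (Suc n))
    = (\<integral>\<^sup>+ a. g (- M a) \<partial>lebesgue_power (Suc n)) * (\<integral>\<^sup>+ y. f (N y) \<partial>lebesgue_power (Suc n))"
proof -
  let ?L = "lebesgue_power (Suc n)"
  interpret L: sigma_finite_measure ?L by (rule sigma_finite_lebesgue_power)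
  interpret pair_sigma_finite ?L ?L by standard
  have Mm: "M \<in> measurable ?L (polys_borel n)" and Nm: "N \<in> measurable ?L (polys_borel n)"
    using M N by (auto simp: linear_coordinates_def)
  have [measurable]: "(\<lambda>a. f (M a)) \<in> borel_measurable ?L" "(\<lambda>a. f (N a)) \<in> borel_measurable ?L"
    "(\<lambda>a. g (N a)) \<in> borel_measurable ?L" "(\<lambda>a. g (- M a)) \<in> borel_measurable ?L"
    by (rule measurable_compose[OF Mm f] measurable_compose[OF Nm f] measurable_compose[OF Nm g]
        measurable_compose[OF measurable_poly_uminus[OF Mm] g])+
  have M2: "(\<lambda>p. M (fst p)) \<in> measurable (?L \<Otimes>\<^sub>M ?L) (polys_borel n)"
    by (rule measurable_compose[OF measurable_fst Mm])
  have N2: "(\<lambda>p. N (snd p)) \<in> measurable (?L \<Otimes>\<^sub>M ?L) (polys_borel n)"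
    by (rule measurable_compose[OF measurable_snd Nm])
  have Mp: "M a \<in> polys n" and Np: "N a \<in> polys n" if "a \<in> space ?L" for a
    using that measurable_polys_borel_in[OF Mm] measurable_polys_borel_in[OF Nm] by auto
  have "(\<integral>\<^sup>+ a. f (M a) \<partial>?L) * (\<integral>\<^sup>+ y. g (N y) \<partial>?L) = (\<integral>\<^sup>+ a. f (M a) * (\<integral>\<^sup>+ y. g (N y) \<partial>?L) \<partial>?L)"
    by (subst nn_integral_multc) auto
  also have "\<dots> = (\<integral>\<^sup>+ a. f (M a) * (\<integral>\<^sup>+ y. g (N y + - M a) \<partial>?L) \<partial>?L)"
    by (intro nn_integral_cong) (simp only: linear_coordinates_translate[OF N g polys_uminus[OF Mp]])
  also have "\<dots> = (\<integral>\<^sup>+ a. \<integral>\<^sup>+ y. f (M a) * g (N y + - M a) \<partial>?L \<partial>?L)"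
  proof (intro nn_integral_cong nn_integral_cmult[symmetric])
    fix a assume "a \<in> space ?L"
    then show "(\<lambda>y. g (N y + - M a)) \<in> borel_measurable ?L"
      by (intro measurable_compose[OF measurable_poly_add[OF Nm measurable_const] g])
         (simp add: polys_uminus Mp)
  qed
  also have "\<dots> = (\<integral>\<^sup>+ y. \<integral>\<^sup>+ a. f (M a) * g (N y + - M a) \<partial>?L \<partial>?L)"
  proof (rule Fubini'[symmetric])
    have "(\<lambda>p. f (M (fst p))) \<in> borel_measurable (?L \<Otimes>\<^sub>M ?L)"
      by (rule measurable_compose[OF M2 f])
    moreover have "(\<lambda>p. g (N (snd p) + - M (fst p))) \<in> borel_measurable (?L \<Otimes>\<^sub>M ?L)"
      by (rule measurable_compose[OF measurable_poly_add[OF N2 measurable_poly_uminus[OF M2]] g])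
    ultimately show "(\<lambda>(a, y). f (M a) * g (N y + - M a)) \<in> borel_measurable (?L \<Otimes>\<^sub>M ?L)"
      unfolding case_prod_unfold by (rule borel_measurable_times_ennreal)
  qed
  \<comment> \<open>For fixed \<open>y\<close>, the polynomial \<open>M a\<close> is replaced by
    \<open>M a + N y\<close>, which frees the argument of \<open>g\<close> from \<open>y\<close>;
    this is where the sign in \<open>g (- M a)\<close> comes from. A last translation, of
    \<open>N y\<close> by \<open>M a\<close>, will separate the two integrals.\<close>
  also have "\<dots> = (\<integral>\<^sup>+ y. \<integral>\<^sup>+ a. f (M a + N y) * g (- M a) \<partial>?L \<partial>?L)"
  proof (rule nn_integral_cong)
    fix y assume y: "y \<in> space ?L"
    have id: "(\<lambda>p. p) \<in> measurable (polys_borel n) (polys_borel n)" by simp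
    have "(\<lambda>p. f (p + N y) * g (- p)) \<in> borel_measurable (polys_borel n)"
      by (intro borel_measurable_times_ennreal measurable_compose[OF measurable_poly_uminus[OF id] g]
          measurable_compose[OF measurable_poly_add[OF id measurable_const] f]) (simp add: Np y)
    from linear_coordinates_translate[OF M this polys_uminus[OF Np[OF y]]]
    show "(\<integral>\<^sup>+ a. f (M a) * g (N y + - M a) \<partial>?L) = (\<integral>\<^sup>+ a. f (M a + N y) * g (- M a) \<partial>?L)"
      by simp
  qed
  also have "\<dots> = (\<integral>\<^sup>+ a. \<integral>\<^sup>+ y. f (M a + N y) * g (- M a) \<partial>?L \<partial>?L)"
  proof (rule Fubini')
    have "(\<lambda>p. f (M (fst p) + N (snd p))) \<in> borel_measurable (?L \<Otimes>\<^sub>M ?L)"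
      by (rule measurable_compose[OF measurable_poly_add[OF M2 N2] f])
    moreover have "(\<lambda>p. g (- M (fst p))) \<in> borel_measurable (?L \<Otimes>\<^sub>M ?L)"
      by (rule measurable_compose[OF measurable_poly_uminus[OF M2] g])
    ultimately show "(\<lambda>(a, y). f (M a + N y) * g (- M a)) \<in> borel_measurable (?L \<Otimes>\<^sub>M ?L)"
      unfolding case_prod_unfold by (rule borel_measurable_times_ennreal)
  qed
  also have "\<dots> = (\<integral>\<^sup>+ a. (\<integral>\<^sup>+ y. f (N y + M a) \<partial>?L) * g (- M a) \<partial>?L)"
  proof (intro nn_integral_cong)
    fix a assume "a \<in> space ?L"
    then have "(\<lambda>y. f (N y + M a)) \<in> borel_measurable ?L"
      by (intro measurable_compose[OF measurable_poly_add[OF Nm measurable_const] f]) (simp add: Mp)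
    then show "(\<integral>\<^sup>+ y. f (M a + N y) * g (- M a) \<partial>?L) = (\<integral>\<^sup>+ y. f (N y + M a) \<partial>?L) * g (- M a)"
      by (subst nn_integral_multc[symmetric]) (auto simp: add.commute)
  qed
  also have "\<dots> = (\<integral>\<^sup>+ a. (\<integral>\<^sup>+ y. f (N y) \<partial>?L) * g (- M a) \<partial>?L)"
    by (intro nn_integral_cong) (simp only: linear_coordinates_translate[OF N f Mp])
  also have "\<dots> = (\<integral>\<^sup>+ a. g (- M a) \<partial>?L) * (\<integral>\<^sup>+ y. f (N y) \<partial>?L)"
    by (subst nn_integral_cmult) (auto simp: mult.commute)
  finally show ?thesis .
qed

text \<open>Coordinate \<open>n\<close> is the leading coefficient, and the coordinates below
  \<open>n\<close> are the remaining ones from the top downwards.\<close>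

lemma linear_coordinates_lead_poly: "linear_coordinates n (\<lambda>y. lead_poly (y n) n y)"
  unfolding linear_coordinates_def
proof (intro conjI allI impI ballI)
  show "(\<lambda>y. lead_poly (y n) n y) \<in> measurable (lebesgue_power (Suc n)) (polys_borel n)"
    by (rule measurable_lead_poly) auto
  show "lead_poly (x n + y n) n (\<lambda>k. x k + y k) = lead_poly (x n) n x + lead_poly (y n) n y" for x y
  proof -
    have "lead_poly (a + b) m (\<lambda>k. x k + y k) = lead_poly a m x + lead_poly b m y" for a b m
      by (induction m) auto
    then show ?thesis .
  qed
  show "lead_poly (x n) n x = lead_poly (y n) n y" if "\<forall>k\<le>n. x k = y k" for x y
    using lead_poly_cong[of n x y] that by auto
  have *: "\<exists>a x. lead_poly a n x = p" if "degree p \<le> n" for p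
    using that
  proof (induction n arbitrary: p)
    case 0
    then show ?case by (auto elim!: degree_eq_zeroE)
  next
    case (Suc n)
    obtain c q where p: "p = pCons c q" by (cases p)
    have "degree q \<le> n" using Suc.prems unfolding p by (auto split: if_splits)
    from Suc.IH[OF this] obtain a x where ax: "lead_poly a n x = q" by auto
    have "lead_poly a (Suc n) (x(n := c)) = p" using ax by (simp add: p)
    then show ?case by blast
  qed
  show "\<exists>x. lead_poly (x n) n x = p" if p: "p \<in> polys n" for p
  proof -
    from *[of p] p obtain a x where "lead_poly a n x = p" unfolding polys_def by blast
    then have "lead_poly ((x(n := a)) n) n (x(n := a)) = p" by simp
    then show ?thesis by blast
  qed
qed

text \<open>Provides a Gaussian test function on polynomials whose integral in coefficient
  coordinates is explicit.\<close>

lemma sum_norm_coeff_lead_poly: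
  "(\<Sum>i\<le>n. (cmod (coeff (lead_poly a n x) i))\<^sup>2) = (\<Sum>k<n. (cmod (x k))\<^sup>2) + (cmod a)\<^sup>2"
  by (induction n) (simp_all add: sum.atMost_Suc_shift del: sum.atMost_Suc)

section \<open>Product densities and Gaussian integrals\<close>

text \<open>The two measures are compared on boxes, where the integral of a product of functions of
  single coordinates factorises. The hypothesis \<open>prob\<close> gives the sigma-finiteness under
  which boxes determine the product measure.\<close>

lemma PiM_density_power:
  assumes "finite I" "sigma_finite_measure M" and [measurable]: "f \<in> borel_measurable M"
    and prob: "prob_space (density M f)"
  shows "(\<Pi>\<^sub>M i\<in>I. density M f) = density (\<Pi>\<^sub>M i\<in>I. M) (\<lambda>x. \<Prod>i\<in>I. f (x i))"
proof -
  interpret M: product_sigma_finite "\<lambda>_. M"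
    using assms by (simp add: product_sigma_finite_def)
  interpret D: product_sigma_finite "\<lambda>_. density M f"
    using prob by (simp add: product_sigma_finite_def prob_space_imp_sigma_finite)
  show ?thesis
  proof (rule D.PiM_eqI[symmetric])
    show "sets (density (\<Pi>\<^sub>M i\<in>I. M) (\<lambda>x. \<Prod>i\<in>I. f (x i))) = sets (\<Pi>\<^sub>M i\<in>I. density M f)"
      by (simp cong: sets_PiM_cong)
    fix A assume A: "\<And>i. i \<in> I \<Longrightarrow> A i \<in> sets (density M f)"
    then have A' [measurable]: "\<And>i. i \<in> I \<Longrightarrow> A i \<in> sets M" by simp
    have PA: "Pi\<^sub>E I A \<in> sets (\<Pi>\<^sub>M i\<in>I. M)"
      using A' \<open>finite I\<close> by (intro sets_PiM_I_finite) auto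
    have m: "(\<lambda>x. \<Prod>i\<in>I. f (x i)) \<in> borel_measurable (\<Pi>\<^sub>M i\<in>I. M)"
      by (intro borel_measurable_prod_ennreal measurable_compose[OF _ assms(3)]) auto
    have "emeasure (density (\<Pi>\<^sub>M i\<in>I. M) (\<lambda>x. \<Prod>i\<in>I. f (x i))) (Pi\<^sub>E I A)
        = (\<integral>\<^sup>+ x. (\<Prod>i\<in>I. f (x i)) * indicator (Pi\<^sub>E I A) x \<partial>(\<Pi>\<^sub>M i\<in>I. M))"
      by (rule emeasure_density[OF m PA])
    also have "\<dots> = (\<integral>\<^sup>+ x. (\<Prod>i\<in>I. f (x i) * indicator (A i) (x i)) \<partial>(\<Pi>\<^sub>M i\<in>I. M))"
    proof (intro nn_integral_cong)
      fix x assume x: "x \<in> space (\<Pi>\<^sub>M i\<in>I. M)"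
      have "indicator (Pi\<^sub>E I A) x = (\<Prod>i\<in>I. indicator (A i) (x i) :: ennreal)"
        using x \<open>finite I\<close> by (auto simp: indicator_def space_PiM PiE_iff prod_zero_iff)
      then show "(\<Prod>i\<in>I. f (x i)) * indicator (Pi\<^sub>E I A) x = (\<Prod>i\<in>I. f (x i) * indicator (A i) (x i))"
        by (simp add: prod.distrib)
    qed
    also have "\<dots> = (\<Prod>i\<in>I. \<integral>\<^sup>+ x. f x * indicator (A i) x \<partial>M)"
      using \<open>finite I\<close> by (intro M.product_nn_integral_prod) auto
    also have "\<dots> = (\<Prod>i\<in>I. emeasure (density M f) (A i))"
      by (intro prod.cong refl emeasure_density[symmetric]) auto
    finally show "emeasure (density (\<Pi>\<^sub>M i\<in>I. M) (\<lambda>x. \<Prod>i\<in>I. f (x i))) (Pi\<^sub>E I A)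
        = (\<Prod>i\<in>I. emeasure (density M f) (A i))" .
  qed fact
qed

lemma nn_integral_complex_prod:
  fixes f :: "real \<Rightarrow> real"
  assumes [measurable]: "f \<in> borel_measurable borel" and nn: "\<And>x. f x \<ge> 0"
  shows "(\<integral>\<^sup>+ z. ennreal (f (Re z) * f (Im z)) \<partial>lborel) = (\<integral>\<^sup>+ x. ennreal (f x) \<partial>lborel)\<^sup>2"
proof -
  have "(\<integral>\<^sup>+ z. (\<Prod>b\<in>Basis. ennreal (f (z \<bullet> b))) \<partial>(lborel :: complex measure))
      = (\<Prod>b\<in>(Basis :: complex set). (\<integral>\<^sup>+ x. ennreal (f x) \<partial>lborel))"
    by (rule nn_integral_lborel_prod) auto
  then show ?thesis
    using nn by (simp add: Basis_complex_def complex_i_not_one[symmetric] ennreal_mult' power2_eq_square)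
qed

lemma nn_integral_exp_neg_sq: "(\<integral>\<^sup>+ x. ennreal (exp (- x\<^sup>2)) \<partial>lborel) = ennreal (sqrt pi)"
proof -
  \<comment> \<open>The standard deviation \<open>1 / sqrt 2\<close> turns the exponent into
    -x^2.\<close>
  have eq: "normal_density 0 (1 / sqrt 2) x = exp (- x\<^sup>2) / sqrt pi" for x
    by (simp add: normal_density_def power_divide real_sqrt_divide)
  have "(\<integral>\<^sup>+ x. ennreal (exp (- x\<^sup>2)) \<partial>lborel)
      = (\<integral>\<^sup>+ x. ennreal (sqrt pi) * ennreal (normal_density 0 (1 / sqrt 2) x) \<partial>lborel)"
    unfolding eq by (subst ennreal_mult'[symmetric]) auto
  also have "\<dots> = ennreal (sqrt pi) * (\<integral>\<^sup>+ x. ennreal (normal_density 0 (1 / sqrt 2) x) \<partial>lborel)"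
    by (rule nn_integral_cmult) auto
  also have "(\<integral>\<^sup>+ x. ennreal (normal_density 0 (1 / sqrt 2) x) \<partial>lborel) = ennreal 1"
    by (subst nn_integral_eq_integral) auto
  finally show ?thesis by simp
qed

lemma nn_integral_complex_gaussian: "(\<integral>\<^sup>+ z. ennreal (exp (- (cmod z)\<^sup>2)) \<partial>lborel) = ennreal pi"
proof -
  have "(\<integral>\<^sup>+ z. ennreal (exp (- (cmod z)\<^sup>2)) \<partial>lborel)
      = (\<integral>\<^sup>+ z. ennreal (exp (- (Re z)\<^sup>2) * exp (- (Im z)\<^sup>2)) \<partial>lborel)"
    by (simp add: cmod_power2 exp_add[symmetric])
  also have "\<dots> = (ennreal (sqrt pi))\<^sup>2"
    by (subst nn_integral_complex_prod[of "\<lambda>x. exp (- x\<^sup>2)"]) (auto simp: nn_integral_exp_neg_sq)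
  also have "\<dots> = ennreal pi"
    by (simp add: ennreal_power)
  finally show ?thesis .
qed

lemma prob_space_std_complex_gaussian: "prob_space std_complex_gaussian"
proof (rule prob_spaceI)
  have "emeasure std_complex_gaussian (space std_complex_gaussian)
      = (\<integral>\<^sup>+ z. ennreal (1 / pi) * ennreal (exp (- (cmod z)\<^sup>2)) \<partial>lborel)"
    unfolding std_complex_gaussian_def by (simp add: emeasure_density ennreal_mult'[symmetric])
  also have "\<dots> = ennreal (1 / pi) * ennreal pi"
    by (subst nn_integral_cmult) (auto simp: nn_integral_complex_gaussian)
  also have "\<dots> = 1" by (subst ennreal_mult'[symmetric]) auto
  finally show "emeasure std_complex_gaussian (space std_complex_gaussian) = 1" .
qed

lemma prod_exp_ennreal:
  fixes n :: nat
  shows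
  "(\<Prod>i<n. ennreal (exp (- (cmod (x i))\<^sup>2))) = ennreal (exp (- (\<Sum>i<n. (cmod (x i))\<^sup>2)))"
proof -
  have "exp (- (\<Sum>i<n. (cmod (x i))\<^sup>2)) = (\<Prod>i<n. exp (- (cmod (x i))\<^sup>2))"
    unfolding sum_negf[symmetric] by (rule exp_sum) simp
  then show ?thesis by (simp add: prod_ennreal)
qed

lemma nn_integral_gaussian_power:
  "(\<integral>\<^sup>+ x. ennreal (exp (- (\<Sum>i<n. (cmod (x i))\<^sup>2))) \<partial>lebesgue_power n) = ennreal pi ^ n"
  unfolding prod_exp_ennreal[symmetric]
  by (subst lebesgue_powers.product_nn_integral_prod) (auto simp: nn_integral_complex_gaussian)

lemma PiM_std_complex_gaussian:
  "(\<Pi>\<^sub>M i\<in>{..<n}. std_complex_gaussian)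
    = density (lebesgue_power n) (\<lambda>x. ennreal (1 / pi) ^ n * ennreal (exp (- (\<Sum>i<n. (cmod (x i))\<^sup>2))))"
proof -
  have eq: "(\<lambda>z. ennreal (exp (- (cmod z)\<^sup>2) / pi)) = (\<lambda>z. ennreal (1 / pi) * ennreal (exp (- (cmod z)\<^sup>2)))"
    by (auto simp: ennreal_mult'[symmetric])
  have "(\<Pi>\<^sub>M i\<in>{..<n}. std_complex_gaussian)
      = density (lebesgue_power n) (\<lambda>x. \<Prod>i<n. ennreal (1 / pi) * ennreal (exp (- (cmod (x i))\<^sup>2)))"
    using prob_space_std_complex_gaussian unfolding std_complex_gaussian_def eq
    by (intro PiM_density_power) (auto intro: lborel.sigma_finite_measure_axioms)
  then show ?thesis
    by (simp only: prod.distrib prod_exp_ennreal prod_constant card_lessThan)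
qed

section \<open>Measurability of the zero measure\<close>

text \<open>A \<open>measure_of\<close> takes its intended values only if the set function is
  countably additive. The image of the uniform law on the indices is a measure with these values,
  which settles this.\<close>

lemma empirical_eq_pmf:
  assumes "n \<ge> 1"
  shows "empirical n z = distr (measure_pmf (pmf_of_set {..<n})) borel z"
proof -
  define M where "M = distr (measure_pmf (pmf_of_set {..<n})) borel z"
  have ne: "{..<n} \<noteq> {}" "finite {..<n}" using assms by (auto simp: lessThan_empty_iff)
  have *: "(\<Sum>i<n. emeasure (return borel (z i)) A) / of_nat n = emeasure M A" if A: "A \<in> sets borel" for A
  proof -
    have "emeasure M A = emeasure (measure_pmf (pmf_of_set {..<n})) (z -` A)"
      unfolding M_def using A by (subst emeasure_distr) auto
    also have "\<dots> = ennreal (real (card ({..<n} \<inter> z -` A)) / real n)"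
      by (simp add: emeasure_pmf_of_set[OF ne])
    also have "\<dots> = of_nat (card ({..<n} \<inter> z -` A)) / of_nat n"
      using assms by (simp add: divide_ennreal[symmetric] ennreal_of_nat_eq_real_of_nat)
    also have "(of_nat (card ({..<n} \<inter> z -` A)) :: ennreal) = (\<Sum>i<n. indicator A (z i))"
      by (simp add: indicator_def sum_of_bool_eq vimage_def)
    also have "\<dots> = (\<Sum>i<n. emeasure (return borel (z i)) A)"
      using A by simp
    finally show ?thesis by simp
  qed
  have "sigma_sets UNIV (sets borel) = sets (borel :: complex measure)"
    using sets.sigma_sets_eq[of "borel :: complex measure"] by simp
  then have "empirical n z = measure_of UNIV (sets borel) (emeasure M)"
    unfolding empirical_def by (intro measure_of_eq *) auto
  also have "\<dots> = M"
    using measure_of_of_measure[of M] by (simp add: M_def)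
  finally show ?thesis by (simp add: M_def)
qed

lemma empirical_prob_measures: "n \<ge> 1 \<Longrightarrow> empirical n z \<in> prob_measures"
  by (auto simp: empirical_eq_pmf intro!: measure_pmf.prob_space_distr)

lemma integral_empirical:
  fixes f :: "complex \<Rightarrow> real"
  assumes "n \<ge> 1" and [measurable]: "f \<in> borel_measurable borel"
  shows "(\<integral>x. f x \<partial>empirical n z) = (\<Sum>i<n. f (z i)) / real n"
proof -
  have ne: "{..<n} \<noteq> {}" "finite {..<n}" using assms by (auto simp: lessThan_empty_iff)
  show ?thesis
    using assms(1)
    by (subst empirical_eq_pmf, simp, subst integral_distr) (auto simp: integral_pmf_of_set[OF ne])
qed

lemma empirical_cong: "(\<And>i. i < n \<Longrightarrow> x i = y i) \<Longrightarrow> empirical n x = empirical n y"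
  by (simp add: empirical_def)

lemma openin_weak_topology_subset: "openin weak_topology U \<Longrightarrow> U \<subseteq> prob_measures"
  using openin_subset[of weak_topology U] by (auto simp: weak_topology_def)

text \<open>It suffices to treat the generating sets of the weak topology. The integral of a
  continuous \<open>f\<close> is an average of the values \<open>f (z i)\<close>, continuous in
  finitely many coordinates.\<close>

lemma open_vimage_empirical:
  assumes n: "n \<ge> 1" and U: "openin weak_topology U"
  shows "open {z. empirical n z \<in> U}"
proof -
  have "continuous_map euclidean weak_topology (empirical n)"
    unfolding weak_topology_def
  proof (rule continuous_on_generated_topo)
    fix V assume "V \<in> {{\<mu> \<in> prob_measures. (\<integral>x. f x \<partial>\<mu>) \<in> U} | (f :: complex \<Rightarrow> real) U.
        continuous_on UNIV f \<and> bounded (range f) \<and> open U}"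
    then obtain f :: "complex \<Rightarrow> real" and T where V: "V = {\<mu> \<in> prob_measures. (\<integral>x. f x \<partial>\<mu>) \<in> T}"
      and f: "continuous_on UNIV f" and T: "open T" by auto
    have [measurable]: "f \<in> borel_measurable borel" using f by (rule borel_measurable_continuous_onI)
    have "continuous_on UNIV (\<lambda>z :: nat \<Rightarrow> complex. (\<Sum>i<n. f (z i)) / real n)"
      by (intro continuous_intros continuous_on_compose2[OF f] continuous_on_product_coordinates) (use n in auto)
    moreover have "empirical n -` V = (\<lambda>z. (\<Sum>i<n. f (z i)) / real n) -` T"
      using empirical_prob_measures[OF n] by (auto simp: V integral_empirical[OF n])
    ultimately show "openin euclidean (empirical n -` V \<inter> topspace euclidean)"
      using T by (simp add: open_vimage)
  next
    \<comment> \<open>The test function 0 makes the whole of \<open>prob_measures\<close> a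
      generating set.\<close>
    have "empirical n z \<in> {\<mu> \<in> prob_measures. (\<integral>x. 0 \<partial>\<mu>) \<in> (UNIV :: real set)}" for z
      using empirical_prob_measures[OF n] by auto
    then show "empirical n ` topspace euclidean \<subseteq> \<Union> {{\<mu> \<in> prob_measures. (\<integral>x. f x \<partial>\<mu>) \<in> U} | (f :: complex \<Rightarrow> real) U.
        continuous_on UNIV f \<and> bounded (range f) \<and> open U}"
      by (auto intro!: exI[of _ "\<lambda>_. 0"] exI[of _ UNIV] exI)
  qed
  from openin_continuous_map_preimage[OF this U] show ?thesis by simp
qed

lemma measurable_weak_borel:
  assumes "\<And>x. x \<in> space M \<Longrightarrow> f x \<in> prob_measures"
    and "\<And>U. openin weak_topology U \<Longrightarrow> {x \<in> space M. f x \<in> U} \<in> sets M"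
  shows "f \<in> measurable M weak_borel"
  unfolding weak_borel_def
proof (rule measurable_measure_of)
  show "{U. openin weak_topology U} \<subseteq> Pow prob_measures"
    using openin_weak_topology_subset by blast
  show "f \<in> space M \<rightarrow> prob_measures" using assms(1) by blast
  show "f -` U \<inter> space M \<in> sets M" if "U \<in> {U. openin weak_topology U}" for U
    using assms(2)[of U] that by (simp add: vimage_def Int_def conj_commute)
qed

text \<open>Points of the finite product are \<open>undefined\<close> from index \<open>n\<close>
  on, so the infinitely many remaining coordinates are constant.\<close>

lemma measurable_PiM_borel_fun: "(\<lambda>x. x) \<in> measurable (lebesgue_power n) (borel :: (nat \<Rightarrow> complex) measure)"
proof (rule measurable_coordinatewise_then_product)
  fix i
  show "(\<lambda>x. x i) \<in> borel_measurable (lebesgue_power n)"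
  proof (cases "i < n")
    case True
    then show ?thesis
      by (rule measurable_component)
  next
    case False
    have "(\<lambda>x. x i) \<in> borel_measurable (lebesgue_power n)
        \<longleftrightarrow> (\<lambda>_. undefined :: complex) \<in> borel_measurable (lebesgue_power n)"
      by (intro measurable_cong) (use False in \<open>auto simp: space_PiM PiE_def extensional_def\<close>)
    then show ?thesis by simp
  qed
qed

lemma measurable_empirical:
  assumes n: "n \<ge> 1"
  shows "empirical n \<in> measurable (lebesgue_power n) weak_borel"
proof (rule measurable_weak_borel)
  show "empirical n x \<in> prob_measures" for x by (rule empirical_prob_measures[OF n])
  fix U assume U: "openin weak_topology U"
  have "{z. empirical n z \<in> U} \<in> sets borel"
    by (rule borel_open[OF open_vimage_empirical[OF n U]])
  from measurable_sets[OF measurable_PiM_borel_fun this]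
  show "{x \<in> space (lebesgue_power n). empirical n x \<in> U} \<in> sets (lebesgue_power n)"
    by (simp add: vimage_def Int_def conj_commute)
qed

section \<open>Factored polynomials and their zero measures\<close>

lemma prod_linear_nonzero: "(\<Prod>i<n. [:- z i, 1:]) \<noteq> (0 :: complex poly)" for n :: nat
  by (simp add: prod_zero_iff)

lemma degree_smult_prod_linear:
  "a \<noteq> 0 \<Longrightarrow> degree (smult a (\<Prod>i<n. [:- z i, 1:] :: complex poly)) = n" for n :: nat
  by (simp add: degree_prod_sum_eq)

text \<open>Two factorisations have the same multiset of roots, and \<open>empirical\<close> is a
  sum over that multiset, so the description picks out a unique measure.\<close>

lemma zero_measure_smult_prod:
  assumes a: "a \<noteq> 0"
  shows "zero_measure n (smult a (\<Prod>i<n. [:- z i, 1:])) = empirical n z"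
  unfolding zero_measure_def
proof (rule the_equality)
  show "\<exists>b y. b \<noteq> 0 \<and> smult a (\<Prod>i<n. [:- z i, 1:]) = smult b (\<Prod>i<n. [:- y i, 1:]) \<and>
      empirical n z = empirical n y" using a by blast
  have proots: "proots (smult b (\<Prod>i<n. [:- y i, 1:])) = (\<Sum>i<n. {#y i#})" if "b \<noteq> 0" for b y
    using that by (simp add: proots_prod)
  have sums: "(\<Sum>x\<in>#(\<Sum>i<n. {#y i#}). h x) = (\<Sum>i<n. h (y i))" for h :: "complex \<Rightarrow> ennreal" and y
    by (induction n) (simp_all add: add.commute)
  fix \<mu> assume "\<exists>b y. b \<noteq> 0 \<and> smult a (\<Prod>i<n. [:- z i, 1:]) = smult b (\<Prod>i<n. [:- y i, 1:]) \<and> \<mu> = empirical n y"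
  then obtain b y where bz: "b \<noteq> 0" "smult a (\<Prod>i<n. [:- z i, 1:]) = smult b (\<Prod>i<n. [:- y i, 1:])" "\<mu> = empirical n y"
    by blast
  have "(\<Sum>i<n. {#z i#}) = (\<Sum>i<n. {#y i#})"
    using proots[OF a, of z] proots[OF bz(1), of y] bz(2) by simp
  then have "(\<Sum>i<n. h (z i)) = (\<Sum>i<n. h (y i))" for h :: "complex \<Rightarrow> ennreal"
    using sums[of h z] sums[of h y] by simp
  from this[of "\<lambda>x. emeasure (return borel x) _"] show "\<mu> = empirical n z"
    unfolding bz(3) empirical_def by simp
qed

lemma complex_poly_factorization:
  assumes "degree p = n" "p \<noteq> 0"
  obtains a z where "a \<noteq> 0" "p = smult a (\<Prod>i<n. [:- z i, 1:] :: complex poly)"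
proof -
  obtain xs where xs: "mset xs = proots p" using ex_mset by blast
  have len: "length xs = n"
    using size_proots_complex[of p] assms xs by (metis size_mset)
  have "smult (lead_coeff p) (\<Prod>x\<in>#proots p. [:- x, 1:]) = p"
    by (rule complex_poly_decompose_multiset)
  moreover have "(\<Prod>x\<in>#proots p. [:- x, 1:]) = (\<Prod>i<n. [:- (xs ! i), 1:])"
    unfolding xs[symmetric] len[symmetric]
    by (simp add: prod_mset_prod_list prod.list_conv_set_nth atLeast0LessThan flip: mset_map)
  moreover have "lead_coeff p \<noteq> 0" using assms(2) by simp
  ultimately show thesis by (metis that)
qed

text \<open>The closed sets consist of the points at distance at least
  \<open>1 / real (Suc j)\<close> from the complement. The whole space is treated apart, since
  \<open>infdist\<close> to the empty set is 0 by convention.\<close>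

lemma open_eq_UN_closed:
  fixes V :: "'a :: metric_space set"
  assumes "open V"
  obtains C :: "nat \<Rightarrow> 'a set" where "\<And>j. closed (C j)" "V = (\<Union>j. C j)"
proof (cases "V = UNIV")
  case True
  then show ?thesis using that[of "\<lambda>_. UNIV"] by simp
next
  case False
  then have ne: "- V \<noteq> {}" and cl: "closed (- V)" using assms by auto
  show ?thesis
  proof (rule that)
    show "closed {x. infdist x (- V) \<ge> 1 / real (Suc j)}" for j
      by (intro closed_Collect_le continuous_intros)
    show "V = (\<Union>j. {x. infdist x (- V) \<ge> 1 / real (Suc j)})"
    proof (intro set_eqI iffI)
      fix x assume "x \<in> V"
      then have "infdist x (- V) > 0"
        using infdist_pos_not_in_closed[OF cl ne] by simp
      then obtain j where "inverse (real (Suc j)) < infdist x (- V)"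
        using reals_Archimedean by blast
      then have "1 / real (Suc j) \<le> infdist x (- V)" by (simp add: inverse_eq_divide)
      then show "x \<in> (\<Union>j. {x. infdist x (- V) \<ge> 1 / real (Suc j)})" by blast
    next
      fix x assume "x \<in> (\<Union>j. {x. infdist x (- V) \<ge> 1 / real (Suc j)})"
      then obtain j where "1 / real (Suc j) \<le> infdist x (- V)" by blast
      then have "infdist x (- V) > 0" by (rule less_le_trans[rotated]) simp
      then show "x \<in> V" using infdist_zero[of x "- V"] by fastforce
    qed
  qed
qed

lemma continuous_on_coeff_prod_linear:
  "continuous_on UNIV (\<lambda>x :: nat \<Rightarrow> complex. coeff (\<Prod>i<n. [:- x i, 1:]) k)"
proof (induction n arbitrary: k)
  case (Suc n)
  have eq: "coeff (\<Prod>i<Suc n. [:- x i, 1:]) k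
      = (if k = 0 then 0 else coeff (\<Prod>i<n. [:- x i, 1:]) (k - 1)) - x n * coeff (\<Prod>i<n. [:- x i, 1:]) k"
    for x :: "nat \<Rightarrow> complex"
    by (cases k) (simp_all add: mult.commute[of _ "[:- x n, 1:]"])
  show ?case
    unfolding eq by (cases k) (auto intro!: continuous_intros Suc.IH)
qed simp

text \<open>The set of polynomials whose zero measure lies in an open set is a continuous image of a
  \<open>\<sigma>\<close>-compact set; this replaces the continuous dependence of the roots on the coefficients.\<close>

lemma measurable_zero_measure:
  assumes n: "n \<ge> 1" and G: "sets G = sets (polys_borel n)"
  shows "zero_measure n \<in> measurable (restrict_space G (polys n - polys (n - 1))) weak_borel"
proof (rule measurable_weak_borel)
  let ?D = "polys n - polys (n - 1)"
  have D: "p \<in> ?D \<longleftrightarrow> degree p = n" for p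
    using n by (auto simp: polys_def)
  have sp: "space (restrict_space G ?D) = ?D"
    using sets_eq_imp_space_eq[OF G] by (auto simp: space_restrict_space)
  show "zero_measure n p \<in> prob_measures" if "p \<in> space (restrict_space G ?D)" for p
  proof -
    have "degree p = n" "p \<noteq> 0" using that n unfolding sp D by auto
    then obtain a z where "a \<noteq> 0" "p = smult a (\<Prod>i<n. [:- z i, 1:])"
      by (rule complex_poly_factorization)
    then show ?thesis using empirical_prob_measures[OF n] by (simp add: zero_measure_smult_prod)
  qed
  fix U assume U: "openin weak_topology U"
  \<comment> \<open>Slot \<open>n\<close> holds the leading coefficient, the slots below it the
    roots. \<open>E\<close> fixes all further slots at 0, so that it is a countable union of the
    compact boxes \<open>K m\<close>.\<close>
  define W where "W = {x. x n \<noteq> 0 \<and> empirical n x \<in> U}"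
  define E where "E = {x :: nat \<Rightarrow> complex. \<forall>k>n. x k = 0}"
  define \<Phi> where "\<Phi> x = coeff (smult (x n) (\<Prod>i<n. [:- x i, 1:]))" for x :: "nat \<Rightarrow> complex"
  have \<Phi>: "continuous_on UNIV \<Phi>"
  proof (rule continuous_on_coordinatewise_then_product)
    show "continuous_on UNIV (\<lambda>x. \<Phi> x k)" for k
      unfolding \<Phi>_def coeff_smult by (intro continuous_on_mult continuous_on_product_coordinates continuous_on_coeff_prod_linear)
  qed
  have "open W"
    unfolding W_def Collect_conj_eq
    by (intro open_Int open_vimage_empirical[OF n U] open_Collect_neq continuous_on_const)
       (rule continuous_on_product_coordinates)
  then obtain C where C: "\<And>j::nat. closed (C j)" "W = (\<Union>j. C j)"
    using open_eq_UN_closed by metis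
  define K where "K m = Pi\<^sub>E UNIV (\<lambda>k. if k \<le> n then cball (0::complex) (real m) else {0})" for m
  have K: "compact (K m)" for m
  proof -
    have "compactin (product_topology (\<lambda>_. euclidean) UNIV) (K m)"
      unfolding K_def by (subst compactin_PiE) auto
    then show ?thesis by (simp add: euclidean_product_topology)
  qed
  have EK: "E = (\<Union>m. K m)"
  proof (intro set_eqI iffI)
    fix x assume x: "x \<in> E"
    obtain m where m: "(\<Sum>k\<le>n. cmod (x k)) \<le> real m" using real_arch_simple by blast
    have "cmod (x k) \<le> real m" if "k \<le> n" for k
      by (rule order.trans[OF member_le_sum m]) (use that in auto)
    with x have "x \<in> K m" by (auto simp: K_def E_def PiE_iff)
    then show "x \<in> (\<Union>m. K m)" by blast
  next
    fix x assume "x \<in> (\<Union>m. K m)"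
    then obtain m where "x \<in> K m" by blast
    then have "x k \<in> (if k \<le> n then cball 0 (real m) else {0})" for k
      unfolding K_def by (rule PiE_mem) simp
    then have "x k = 0" if "k > n" for k
      using that by (metis not_le singletonD)
    then show "x \<in> E" by (simp add: E_def)
  qed
  have "\<Phi> ` (W \<inter> E) = (\<Union>m. \<Union>j. \<Phi> ` (K m \<inter> C j))"
    unfolding C(2) EK by auto
  moreover have "closed (\<Phi> ` (K m \<inter> C j))" for m j
    by (intro compact_imp_closed compact_continuous_image continuous_on_subset[OF \<Phi>]
        compact_Int_closed K C) auto
  ultimately have B: "\<Phi> ` (W \<inter> E) \<in> sets borel"
    by (auto intro!: sets.countable_UN)
  have "{p \<in> ?D. zero_measure n p \<in> U} = coeff -` (\<Phi> ` (W \<inter> E)) \<inter> polys n"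
  proof (intro set_eqI iffI)
    fix p assume p: "p \<in> {p \<in> ?D. zero_measure n p \<in> U}"
    then have "degree p = n" using D[of p] by blast
    moreover from this have "p \<noteq> 0" using n by auto
    ultimately obtain a z where az: "a \<noteq> 0" "p = smult a (\<Prod>i<n. [:- z i, 1:])"
      by (rule complex_poly_factorization)
    define x where "x k = (if k < n then z k else if k = n then a else 0)" for k
    have "empirical n x = empirical n z" by (rule empirical_cong) (simp add: x_def)
    then have "empirical n x \<in> U"
      using p az by (simp add: zero_measure_smult_prod)
    then have "x \<in> W \<inter> E" using az(1) by (auto simp: W_def E_def x_def)
    moreover have "\<Phi> x = coeff p"
      by (simp add: \<Phi>_def az(2) x_def)
    ultimately show "p \<in> coeff -` (\<Phi> ` (W \<inter> E)) \<inter> polys n"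
      using p by (auto intro!: image_eqI)
  next
    fix p assume "p \<in> coeff -` (\<Phi> ` (W \<inter> E)) \<inter> polys n"
    then obtain x where x: "x \<in> W" "coeff p = \<Phi> x" by auto
    then have p: "p = smult (x n) (\<Prod>i<n. [:- x i, 1:])"
      by (simp add: \<Phi>_def coeff_inject)
    have xn: "x n \<noteq> 0" and xU: "empirical n x \<in> U" using x(1) by (auto simp: W_def)
    have "p \<in> ?D"
      unfolding D p using xn by (rule degree_smult_prod_linear)
    moreover have "zero_measure n p = empirical n x"
      unfolding p using xn by (rule zero_measure_smult_prod)
    ultimately show "p \<in> {p \<in> ?D. zero_measure n p \<in> U}" using xU by simp
  qed
  also have "\<dots> \<in> sets (polys_borel n)"
    unfolding polys_borel_def by (rule in_vimage_algebra[OF B])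
  finally have "{p \<in> ?D. zero_measure n p \<in> U} \<in> sets (polys_borel n)" .
  then have "?D \<inter> {p \<in> ?D. zero_measure n p \<in> U} \<in> (\<inter>) ?D ` sets G"
    unfolding G by (rule imageI)
  moreover have "?D \<inter> {p \<in> ?D. zero_measure n p \<in> U} = {p \<in> ?D. zero_measure n p \<in> U}"
    by blast
  ultimately show "{p \<in> space (restrict_space G ?D). zero_measure n p \<in> U} \<in> sets (restrict_space G ?D)"
    unfolding sp sets_restrict_space by (simp only:)
qed

section \<open>Energies and the weight\<close>

lemma pair_energy_eq:
  "pair_energy \<phi> z w = (if z = w then \<infinity> else ereal (\<phi> z + \<phi> w - 2 * ln (cmod (z - w))))"
proof (cases "z = w")
  case False
  then have "ennreal (cmod (z - w)) \<noteq> 0" by (simp add: ennreal_eq_0_iff)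
  then have "elog (ennreal (cmod (z - w))) = ereal (ln (cmod (z - w)))"
    by (simp add: elog_def)
  then show ?thesis using False by (simp add: pair_energy_def)
qed (simp add: pair_energy_def elog_def)

lemma pair_energy_not_MInfty: "pair_energy \<phi> z w \<noteq> - \<infinity>"
  by (simp add: pair_energy_eq)

lemma pair_energy_commute: "pair_energy \<phi> z w = pair_energy \<phi> w z"
  by (simp add: pair_energy_eq norm_minus_commute add.commute)

text \<open>The logarithmic singularity becomes a zero of the squared distance, so one formula
  covers the diagonal as well.\<close>

lemma eexp_neg_pair_energy:
  "eexp (- pair_energy \<phi> z w) = ennreal ((cmod (z - w))\<^sup>2 * exp (- (\<phi> z + \<phi> w)))"
proof (cases "z = w")
  case False
  have "exp (2 * ln (cmod (z - w)) - \<phi> z - \<phi> w) = exp (ln (cmod (z - w)) + ln (cmod (z - w)) + - (\<phi> z + \<phi> w))"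
    by (simp add: algebra_simps)
  also have "\<dots> = (cmod (z - w))\<^sup>2 * exp (- (\<phi> z + \<phi> w))"
    using False by (simp only: exp_add) (simp add: power2_eq_square)
  finally show ?thesis using False by (simp add: pair_energy_eq eexp_def algebra_simps)
qed (simp add: pair_energy_eq eexp_def)

lemma eexp_neg_add:
  assumes "x \<noteq> - \<infinity>" "y \<noteq> - \<infinity>"
  shows "eexp (- (x + y)) = eexp (- x) * eexp (- y)"
  using assms
  by (cases x; cases y) (auto simp: eexp_def ennreal_mult'[symmetric] exp_add[symmetric] add.commute)

lemma sum_not_MInfty: "(\<And>i. i \<in> I \<Longrightarrow> f i \<noteq> (- \<infinity> :: ereal)) \<Longrightarrow> sum f I \<noteq> - \<infinity>"
  by (induction I rule: infinite_finite_induct) auto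

lemma eexp_neg_sum:
  assumes "finite I" "\<And>i. i \<in> I \<Longrightarrow> f i \<noteq> - \<infinity>"
  shows "eexp (- (\<Sum>i\<in>I. f i)) = (\<Prod>i\<in>I. eexp (- f i))"
  using assms
proof (induction I rule: finite_induct)
  case (insert i I)
  then show ?case by (simp add: eexp_neg_add sum_not_MInfty)
qed (simp add: eexp_def zero_ereal_def)

text \<open>After exponentiation, a real superlevel set is given by a strict inequality between
  functions that are continuous across the diagonal.\<close>

lemma lower_semicontinuous_pair_energy:
  assumes \<phi>: "continuous_on UNIV \<phi>"
  shows "lower_semicontinuous (\<lambda>(z, w). pair_energy \<phi> z w)"
  unfolding lower_semicontinuous_def
proof
  fix c :: ereal
  have cont: "continuous_on UNIV (\<lambda>p. \<phi> (fst p))" "continuous_on UNIV (\<lambda>p. \<phi> (snd p))"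
    by (intro continuous_on_compose2[OF \<phi>] continuous_intros; simp)+
  show "open {x. c < (case x of (z, w) \<Rightarrow> pair_energy \<phi> z w)}"
  proof (cases c)
    case (real r)
    have "c < pair_energy \<phi> z w \<longleftrightarrow> (cmod (z - w))\<^sup>2 < exp (\<phi> z + \<phi> w - r)" for z w
    proof (cases "z = w")
      case False
      then have "(cmod (z - w))\<^sup>2 = exp (ln (cmod (z - w)) + ln (cmod (z - w)))"
        by (simp only: exp_add) (simp add: power2_eq_square)
      then show ?thesis using False real by (auto simp: pair_energy_eq)
    qed (simp add: pair_energy_eq real)
    then have "{x. c < (case x of (z, w) \<Rightarrow> pair_energy \<phi> z w)}
        = {x. (cmod (fst x - snd x))\<^sup>2 < exp (\<phi> (fst x) + \<phi> (snd x) - r)}"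
      by auto
    moreover have "open \<dots>"
      by (intro open_Collect_less continuous_intros cont)
    ultimately show ?thesis by simp
  next
    case MInf
    then have "{x. c < (case x of (z, w) \<Rightarrow> pair_energy \<phi> z w)} = UNIV"
      by (auto simp: pair_energy_eq split: if_splits)
    then show ?thesis by simp
  qed simp
qed

section \<open>Consequences of the growth condition\<close>

text \<open>Near infinity the lower limit gives |z|^2 \<le> e^(-c) e^(\<phi> z), and on the
  remaining disc \<open>\<phi>\<close> attains a minimum. In this global multiplicative form the
  condition yields the lower bound of the pair energy, the finite partition function and the
  integrability of weighted polynomials.\<close>

lemma growth_bound:
  fixes \<phi> :: "complex \<Rightarrow> real"
  assumes \<phi>: "continuous_on UNIV \<phi>"
    and "Liminf at_infinity (\<lambda>z. ereal (\<phi> z - 2 * ln (cmod z))) > - \<infinity>"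
  obtains C where "C > 0" "\<forall>z. 1 + (cmod z)\<^sup>2 \<le> C * exp (\<phi> z)"
proof -
  obtain c where c: "ereal c < Liminf at_infinity (\<lambda>z. ereal (\<phi> z - 2 * ln (cmod z)))"
    using ereal_dense2[OF assms(2)] by blast
  obtain b where b: "\<And>z. cmod z \<ge> b \<Longrightarrow> c < \<phi> z - 2 * ln (cmod z)"
    using less_LiminfD[OF c] by (auto simp: eventually_at_infinity)
  define R where "R = max b 1"
  have ne: "cball (0 :: complex) R \<noteq> {}" by (simp add: R_def)
  obtain u where u: "\<forall>z\<in>cball 0 R. \<phi> u \<le> \<phi> z"
    using continuous_attains_inf[OF compact_cball ne continuous_on_subset[OF \<phi>]] by auto
  \<comment> \<open>The first summand serves outside the disc, where \<open>R\<close> being at least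
    1 gives 1 + |z|^2 \<le> 2 |z|^2; the second serves inside it.\<close>
  define C where "C = 2 * exp (- c) + (1 + R\<^sup>2) * exp (- \<phi> u)"
  have R2: "1 + R\<^sup>2 > 0" by (simp add: add_pos_nonneg)
  show ?thesis
  proof (rule that)
    show "C > 0" unfolding C_def using R2 by (intro add_pos_pos) auto
    have "1 + (cmod z)\<^sup>2 \<le> C * exp (\<phi> z)" for z
    proof (cases "cmod z \<le> R")
      case True
      then have "1 + (cmod z)\<^sup>2 \<le> 1 + R\<^sup>2" by (simp add: power_mono)
      also have "\<dots> \<le> (1 + R\<^sup>2) * exp (- \<phi> u + \<phi> z)"
        using u True R2 by simp
      also have "\<dots> = (1 + R\<^sup>2) * exp (- \<phi> u) * exp (\<phi> z)"
        by (simp only: exp_add mult.assoc)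
      also have "\<dots> \<le> C * exp (\<phi> z)"
        by (intro mult_right_mono) (auto simp: C_def)
      finally show ?thesis .
    next
      case False
      then have z: "cmod z \<ge> b" "cmod z \<ge> 1" by (auto simp: R_def)
      have "0 < cmod z" using z by linarith
      then have "(cmod z)\<^sup>2 = exp (ln (cmod z) + ln (cmod z))"
        by (simp only: exp_add) (simp add: power2_eq_square)
      also have "\<dots> \<le> exp (- c + \<phi> z)"
        using b[OF z(1)] by simp
      finally have "(cmod z)\<^sup>2 \<le> exp (- c) * exp (\<phi> z)" by (simp only: exp_add)
      moreover have "1 \<le> (cmod z)\<^sup>2" using z by simp
      moreover have "C * exp (\<phi> z) \<ge> 2 * exp (- c) * exp (\<phi> z)"
        using R2 by (simp add: C_def distrib_right)
      ultimately show ?thesis by linarith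
    qed
    then show "\<forall>z. 1 + (cmod z)\<^sup>2 \<le> C * exp (\<phi> z)" ..
  qed
qed

lemma nn_integral_inverse_1_plus_sq:
  "(\<integral>\<^sup>+ x. ennreal (1 / (1 + x\<^sup>2)) \<partial>lborel) < \<infinity>"
proof -
  let ?f = "\<lambda>x::real. 1 / (1 + x\<^sup>2)"
  have half: "(\<integral>\<^sup>+ x. ennreal (?f x) * indicator {0..} x \<partial>lborel) = ennreal (pi / 2 - arctan 0)"
  proof (rule nn_integral_FTC_atLeast)
    show "DERIV arctan x :> ?f x" for x
      using DERIV_arctan[of x] by (simp add: inverse_eq_divide)
    show "(arctan \<longlongrightarrow> pi / 2) at_top"
      by (rule tendsto_arctan_at_top)
  qed auto
  have "(\<integral>\<^sup>+ x. ennreal (?f x) * indicator {..0} x \<partial>lborel)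
      = (\<integral>\<^sup>+ x. ennreal (?f x) * indicator {0..} x \<partial>lborel)"
    by (subst nn_integral_real_affine[where c = "-1" and t = 0])
       (auto intro!: nn_integral_cong simp: indicator_def)
  then have neg: "(\<integral>\<^sup>+ x. ennreal (?f x) * indicator {..0} x \<partial>lborel) = ennreal (pi / 2 - arctan 0)"
    using half by simp
  have "(\<integral>\<^sup>+ x. ennreal (?f x) \<partial>lborel)
      \<le> (\<integral>\<^sup>+ x. ennreal (?f x) * indicator {0..} x + ennreal (?f x) * indicator {..0} x \<partial>lborel)"
    by (intro nn_integral_mono) (auto simp: indicator_def)
  also have "\<dots> = ennreal (pi / 2 - arctan 0) + ennreal (pi / 2 - arctan 0)"
    by (subst nn_integral_add) (auto simp: half neg)
  also have "\<dots> < \<infinity>" by simp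
  finally show ?thesis .
qed

locale planar_weight =
  fixes \<nu> :: "complex measure" and \<phi> :: "complex \<Rightarrow> real" and C :: real
  assumes prob_nu: "prob_space \<nu>" and sets_nu [measurable_cong]: "sets \<nu> = sets borel"
    and cont_phi: "continuous_on UNIV \<phi>"
    and C_pos: "C > 0" and growth: "1 + (cmod z)\<^sup>2 \<le> C * exp (\<phi> z)"
begin

sublocale prob_space \<nu> by (rule prob_nu)

lemma borel_measurable_phi [measurable]: "\<phi> \<in> borel_measurable borel"
  using cont_phi by (rule borel_measurable_continuous_onI)

lemma pair_energy_bounded_below: "\<exists>c::real. \<forall>z w. ereal c \<le> pair_energy \<phi> z w"
proof (intro exI allI)
  fix z w
  \<comment> \<open>The constant is read off from |z - w|^2 \<le> 2 (1 + |z|^2) (1 + |w|^2) \<le> 2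
    C^2 e^(\<phi> z + \<phi> w).\<close>
  show "ereal (- ln (2 * C\<^sup>2)) \<le> pair_energy \<phi> z w"
  proof (cases "z = w")
    case False
    have "(cmod (z - w))\<^sup>2 \<le> (cmod z + cmod w)\<^sup>2"
      by (intro power_mono norm_triangle_ineq4) auto
    also have "\<dots> \<le> 2 * ((1 + (cmod z)\<^sup>2) * (1 + (cmod w)\<^sup>2))"
    proof -
      have "2 * ((1 + (cmod z)\<^sup>2) * (1 + (cmod w)\<^sup>2)) - (cmod z + cmod w)\<^sup>2
          = 2 + (cmod z - cmod w)\<^sup>2 + 2 * (cmod z * cmod w)\<^sup>2"
        by (simp add: power2_eq_square algebra_simps)
      also have "\<dots> \<ge> 0" by simp
      finally show ?thesis by simp
    qed
    also have "\<dots> \<le> 2 * ((C * exp (\<phi> z)) * (C * exp (\<phi> w)))"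
      by (intro mult_left_mono mult_mono growth) (use C_pos in auto)
    also have "\<dots> = 2 * C\<^sup>2 * exp (\<phi> z + \<phi> w)"
      by (simp add: exp_add power2_eq_square)
    finally have "ln ((cmod (z - w))\<^sup>2) \<le> ln (2 * C\<^sup>2 * exp (\<phi> z + \<phi> w))"
      using False C_pos by (subst ln_le_cancel_iff) auto
    also have "\<dots> = ln (2 * C\<^sup>2) + (\<phi> z + \<phi> w)"
      using C_pos by (subst ln_mult) auto
    also have "ln ((cmod (z - w))\<^sup>2) = 2 * ln (cmod (z - w))"
      using False by (simp add: ln_realpow)
    finally show ?thesis using False by (simp add: pair_energy_eq)
  qed (simp add: pair_energy_eq)
qed

definition Z :: real where "Z = enn2real (\<integral>\<^sup>+ z. ennreal (exp (- 2 * \<phi> z)) \<partial>lborel)"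

text \<open>The growth bound gives e^(-2 \<phi>) \<le> C^2 / (1 + |z|^2)^2. Weakening this to a
  product of functions of the real and the imaginary part reduces the planar integral to the square
  of a Cauchy integral on the line.\<close>

lemma partition_finite: "(\<integral>\<^sup>+ z. ennreal (exp (- 2 * \<phi> z)) \<partial>(lborel :: complex measure)) < \<infinity>"
proof -
  have bound: "exp (- 2 * \<phi> z) \<le> C\<^sup>2 * (1 / (1 + (Re z)\<^sup>2) * (1 / (1 + (Im z)\<^sup>2)))" for z
  proof -
    have pos: "0 < (1 + (Re z)\<^sup>2) * (1 + (Im z)\<^sup>2)"
      by (intro mult_pos_pos add_pos_nonneg) auto
    have "(1 + (Re z)\<^sup>2) * (1 + (Im z)\<^sup>2) \<le> (1 + (cmod z)\<^sup>2)\<^sup>2"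
      unfolding power2_eq_square[of "1 + _"] by (intro mult_mono) (auto simp: cmod_power2)
    also have "\<dots> \<le> (C * exp (\<phi> z))\<^sup>2"
      by (intro power_mono growth) auto
    also have "\<dots> = C\<^sup>2 * exp (2 * \<phi> z)"
      by (simp add: power_mult_distrib exp_double)
    finally have "(1 + (Re z)\<^sup>2) * (1 + (Im z)\<^sup>2) * exp (- 2 * \<phi> z) \<le> C\<^sup>2 * exp (2 * \<phi> z) * exp (- 2 * \<phi> z)"
      by (rule mult_right_mono) auto
    also have "\<dots> = C\<^sup>2" by (simp add: mult.assoc exp_add[symmetric])
    finally have "exp (- 2 * \<phi> z) \<le> C\<^sup>2 / ((1 + (Re z)\<^sup>2) * (1 + (Im z)\<^sup>2))"
      using pos by (simp add: pos_le_divide_eq mult.commute)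
    then show ?thesis by simp
  qed
  have "(\<integral>\<^sup>+ z. ennreal (exp (- 2 * \<phi> z)) \<partial>lborel)
      \<le> (\<integral>\<^sup>+ z. ennreal (C\<^sup>2) * ennreal (1 / (1 + (Re z)\<^sup>2) * (1 / (1 + (Im z)\<^sup>2))) \<partial>lborel)"
    using bound by (intro nn_integral_mono) (simp add: ennreal_mult'[symmetric] del: times_divide_eq_right times_divide_eq_left)
  also have "\<dots> = ennreal (C\<^sup>2) * (\<integral>\<^sup>+ z. ennreal (1 / (1 + (Re z)\<^sup>2) * (1 / (1 + (Im z)\<^sup>2))) \<partial>lborel)"
    by (rule nn_integral_cmult) measurable
  also have "(\<integral>\<^sup>+ z. ennreal (1 / (1 + (Re z)\<^sup>2) * (1 / (1 + (Im z)\<^sup>2))) \<partial>lborel)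
      = (\<integral>\<^sup>+ x. ennreal (1 / (1 + x\<^sup>2)) \<partial>lborel)\<^sup>2"
    by (rule nn_integral_complex_prod) auto
  also have "ennreal (C\<^sup>2) * \<dots> < \<infinity>"
    using nn_integral_inverse_1_plus_sq by (simp add: ennreal_mult_less_top power_less_top_ennreal)
  finally show ?thesis .
qed

lemma Z_eq: "(\<integral>\<^sup>+ z. ennreal (exp (- 2 * \<phi> z)) \<partial>lborel) = ennreal Z" and Z_pos: "Z > 0"
proof -
  show eq: "(\<integral>\<^sup>+ z. ennreal (exp (- 2 * \<phi> z)) \<partial>lborel) = ennreal Z"
    unfolding Z_def using partition_finite by simp
  have "(\<integral>\<^sup>+ z. ennreal (exp (- 2 * \<phi> z)) \<partial>lborel) \<noteq> 0"
  proof
    assume "(\<integral>\<^sup>+ z. ennreal (exp (- 2 * \<phi> z)) \<partial>lborel) = 0"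
    then have "AE z in (lborel :: complex measure). ennreal (exp (- 2 * \<phi> z)) = 0"
      by (subst (asm) nn_integral_0_iff_AE) auto
    then have "AE z in (lborel :: complex measure). False" by simp
    then show False by (simp add: eventually_False ae_filter_eq_bot_iff)
  qed
  then show "Z > 0" unfolding eq by (simp add: ennreal_eq_0_iff)
qed

lemma ref_measure_eq: "ref_measure \<phi> = density lborel (\<lambda>z. ennreal (exp (- 2 * \<phi> z) / Z))"
  unfolding ref_measure_def Z_eq using Z_pos by (simp add: divide_ennreal)

lemma prob_space_ref_measure: "prob_space (ref_measure \<phi>)"
proof (rule prob_spaceI)
  have "emeasure (ref_measure \<phi>) (space (ref_measure \<phi>))
      = (\<integral>\<^sup>+ z. ennreal (1 / Z) * ennreal (exp (- 2 * \<phi> z)) \<partial>lborel)"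
    unfolding ref_measure_eq using Z_pos by (simp add: emeasure_density ennreal_mult'[symmetric])
  also have "\<dots> = ennreal (1 / Z) * ennreal Z"
    unfolding Z_eq[symmetric] by (rule nn_integral_cmult) measurable
  also have "\<dots> = 1" using Z_pos by (subst ennreal_mult'[symmetric]) auto
  finally show "emeasure (ref_measure \<phi>) (space (ref_measure \<phi>)) = 1" .
qed

lemma PiM_ref_measure:
  "(\<Pi>\<^sub>M i\<in>{..<n}. ref_measure \<phi>)
    = density (lebesgue_power n) (\<lambda>z. ennreal (exp (- 2 * (\<Sum>i<n. \<phi> (z i))) / Z ^ n))"
proof -
  have eq: "(\<Prod>i<n. ennreal (exp (- 2 * \<phi> (z i)) / Z)) = ennreal (exp (- 2 * (\<Sum>i<n. \<phi> (z i))) / Z ^ n)" for z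
  proof -
    have "(\<Prod>i<n. exp (- 2 * \<phi> (z i)) / Z) = exp (- 2 * (\<Sum>i<n. \<phi> (z i))) / Z ^ n"
      unfolding sum_distrib_left by (subst exp_sum) (auto simp: prod_dividef)
    then show ?thesis using Z_pos by (subst prod_ennreal) auto
  qed
  show ?thesis
    using prob_space_ref_measure unfolding ref_measure_eq eq[symmetric]
    by (intro PiM_density_power) (auto intro: lborel.sigma_finite_measure_axioms)
qed

end

section \<open>Sums and products over pairs\<close>

text \<open>Each of the \<open>n\<close> points belongs to \<open>n - 1\<close> pairs.\<close>

lemma vandermonde_exp_telescope:
  fixes z :: "nat \<Rightarrow> complex"
  shows "(\<Prod>j<n. \<Prod>i<j. (cmod (z i - z j))\<^sup>2 * exp (- (\<phi> (z i) + \<phi> (z j))))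
    = vandermonde_sq n z * exp (- (real n - 1) * (\<Sum>i<n. \<phi> (z i)))"
proof (induction n)
  case (Suc n)
  define S where "S = (\<Sum>i<n. \<phi> (z i))"
  have e: "(\<Prod>i<n. exp (- (\<phi> (z i) + \<phi> (z n)))) = exp (- S - real n * \<phi> (z n))"
    unfolding S_def by (subst exp_sum[symmetric]) (simp_all add: sum_negf sum.distrib sum_subtractf)
  have "(\<Prod>j<Suc n. \<Prod>i<j. (cmod (z i - z j))\<^sup>2 * exp (- (\<phi> (z i) + \<phi> (z j))))
      = vandermonde_sq n z * exp (- (real n - 1) * S)
        * ((\<Prod>i<n. (cmod (z i - z n))\<^sup>2) * exp (- S - real n * \<phi> (z n)))"
    unfolding prod.lessThan_Suc Suc.IH S_def[symmetric] unfolding prod.distrib e ..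
  also have "\<dots> = vandermonde_sq (Suc n) z * (exp (- (real n - 1) * S) * exp (- S - real n * \<phi> (z n)))"
    by (simp add: vandermonde_sq_def)
  also have "exp (- (real n - 1) * S) * exp (- S - real n * \<phi> (z n)) = exp (- (real (Suc n) - 1) * (S + \<phi> (z n)))"
    unfolding exp_add[symmetric] by (simp add: algebra_simps)
  finally show ?case by (simp add: S_def)
qed (simp add: vandermonde_sq_def)

text \<open>A permutation acts on two-element sets of indices. Such a set is encoded as a pair
  \<open>(j, i)\<close> with \<open>i < j\<close>; \<open>f\<close> sorts the two images, and the
  symmetry of \<open>g\<close> makes the sorting harmless.\<close>

lemma sum_pairs_permute:
  fixes g :: "'a \<Rightarrow> 'a \<Rightarrow> 'b :: comm_monoid_add"
  assumes \<sigma>: "\<sigma> permutes {..<n :: nat}" and sym: "\<And>x y. g x y = g y x"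
  shows "(\<Sum>j<n. \<Sum>i<j. g (z (\<sigma> i)) (z (\<sigma> j))) = (\<Sum>j<n. \<Sum>i<j. g (z i) (z j))"
proof -
  define S where "S = (SIGMA j:{..<n}. {..<j})"
  define f where "f \<tau> = (\<lambda>(j, i). (max (\<tau> i) (\<tau> j), min (\<tau> i) (\<tau> j)))" for \<tau> :: "nat \<Rightarrow> nat"
  have S: "p \<in> S \<longleftrightarrow> snd p < fst p \<and> fst p < n" for p
    by (cases p) (auto simp: S_def)
  have inv: "inv \<sigma> permutes {..<n}" by (rule permutes_inv[OF \<sigma>])
  have mem: "f \<tau> p \<in> S" if \<tau>: "\<tau> permutes {..<n}" and p: "p \<in> S" for \<tau> p
  proof -
    have "\<tau> (fst p) < n" "\<tau> (snd p) < n"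
      using permutes_in_image[OF \<tau>, of "fst p"] permutes_in_image[OF \<tau>, of "snd p"] p by (auto simp: S)
    moreover have "\<tau> (fst p) \<noteq> \<tau> (snd p)"
      using permutes_inj[OF \<tau>] p by (auto simp: S inj_eq)
    ultimately show ?thesis by (auto simp: S f_def case_prod_unfold)
  qed
  have cancel: "f \<tau>' (f \<tau> p) = p" if "\<And>x. \<tau>' (\<tau> x) = x" and p: "p \<in> S" for \<tau> \<tau>' p
    using p by (cases p) (auto simp: f_def S that max_def min_def)
  have "(\<Sum>p\<in>S. g (z (\<sigma> (snd p))) (z (\<sigma> (fst p)))) = (\<Sum>p\<in>S. g (z (snd p)) (z (fst p)))"
  proof (rule sum.reindex_bij_witness[of _ "f (inv \<sigma>)" "f \<sigma>"])
    show "f (inv \<sigma>) (f \<sigma> p) = p" if "p \<in> S" for p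
      by (rule cancel) (use that permutes_inverses[OF \<sigma>] in auto)
    show "f \<sigma> (f (inv \<sigma>) p) = p" if "p \<in> S" for p
      by (rule cancel) (use that permutes_inverses[OF \<sigma>] in auto)
    show "f \<sigma> p \<in> S" "f (inv \<sigma>) p \<in> S" if "p \<in> S" for p
      by (rule mem; fact)+
    show "g (z (snd (f \<sigma> p))) (z (fst (f \<sigma> p))) = g (z (\<sigma> (snd p))) (z (\<sigma> (fst p)))" for p
      by (cases p) (auto simp: f_def max_def min_def sym)
  qed
  then show ?thesis
    by (simp add: S_def sum.Sigma case_prod_unfold)
qed

section \<open>The weighted inner product\<close>

context planar_weight
begin

definition wdens :: "nat \<Rightarrow> complex \<Rightarrow> real" where "wdens n z = exp (- real n * \<phi> z)"

lemma wdens_measurable [measurable]: "wdens n \<in> borel_measurable borel"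
  unfolding wdens_def[abs_def] by measurable

lemma wdens_pos: "wdens n z > 0"
  by (simp add: wdens_def)

text \<open>With m = max 1 |z|, a polynomial of degree at most \<open>n\<close> is O(m^n) and m^2
  \<le> C e^(\<phi> z), so the weight e^(-n \<phi>) exactly absorbs the growth of |p|^2. Boundedness
  gives integrability against the probability measure \<open>\<nu>\<close>.\<close>

lemma poly_weight_bounded:
  assumes "p \<in> polys n"
  obtains B where "\<And>z. (cmod (poly p z))\<^sup>2 * wdens n z \<le> B"
proof -
  define A where "A = (\<Sum>i\<le>n. cmod (coeff p i))"
  have A: "A \<ge> 0" by (auto simp: A_def intro: sum_nonneg)
  have "(cmod (poly p z))\<^sup>2 * wdens n z \<le> A\<^sup>2 * C ^ n" for z
  proof -
    define m where "m = max 1 (cmod z)"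
    have m: "m \<ge> 1" "cmod z \<le> m" by (auto simp: m_def)
    have "cmod (poly p z) \<le> (\<Sum>i\<le>n. cmod (coeff p i * z ^ i))"
      unfolding poly_eq_sum_le[OF assms] by (rule norm_sum)
    also have "\<dots> \<le> (\<Sum>i\<le>n. cmod (coeff p i) * m ^ n)"
    proof (rule sum_mono)
      fix i assume "i \<in> {..n}"
      then have "cmod z ^ i \<le> m ^ n"
        using power_mono[OF m(2), of i] power_increasing[of i n m] m(1) by auto
      then show "cmod (coeff p i * z ^ i) \<le> cmod (coeff p i) * m ^ n"
        by (simp add: norm_mult norm_power mult_left_mono)
    qed
    also have "\<dots> = A * m ^ n" by (simp add: A_def sum_distrib_right)
    finally have "(cmod (poly p z))\<^sup>2 \<le> (A * m ^ n)\<^sup>2"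
      by (rule power_mono) simp
    also have "\<dots> = A\<^sup>2 * (m\<^sup>2) ^ n"
      by (simp add: power_mult_distrib power_mult[symmetric] mult.commute)
    also have "\<dots> \<le> A\<^sup>2 * (C * exp (\<phi> z)) ^ n"
    proof -
      have "m\<^sup>2 \<le> 1 + (cmod z)\<^sup>2"
        by (auto simp: m_def max_def)
      also have "\<dots> \<le> C * exp (\<phi> z)" by (rule growth)
      finally show ?thesis by (intro mult_left_mono power_mono) auto
    qed
    finally have "(cmod (poly p z))\<^sup>2 \<le> A\<^sup>2 * (C * exp (\<phi> z)) ^ n" .
    then have "(cmod (poly p z))\<^sup>2 * wdens n z \<le> A\<^sup>2 * (C * exp (\<phi> z)) ^ n * wdens n z"
      by (rule mult_right_mono) (simp add: wdens_def)
    also have "\<dots> = A\<^sup>2 * C ^ n * (exp (\<phi> z) ^ n * wdens n z)"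
      by (simp add: power_mult_distrib)
    also have "exp (\<phi> z) ^ n * wdens n z = 1"
      by (simp add: wdens_def exp_of_nat_mult[symmetric] exp_add[symmetric])
    finally show ?thesis by simp
  qed
  then show ?thesis by (rule that)
qed

lemma poly_measurable_nu [measurable]: "poly p \<in> borel_measurable \<nu>"
  by (simp add: measurable_cong_sets[OF sets_nu refl])

lemma integrable_sq:
  assumes "p \<in> polys n"
  shows "integrable \<nu> (\<lambda>z. (cmod (poly p z))\<^sup>2 * wdens n z)"
proof -
  obtain B where B: "\<And>z. (cmod (poly p z))\<^sup>2 * wdens n z \<le> B"
    using poly_weight_bounded[OF assms] by blast
  show ?thesis
    by (rule integrable_const_bound[where B = B])
       (use B in \<open>auto simp: abs_mult wdens_pos[THEN less_imp_le]\<close>)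
qed

lemma integrable_inner:
  assumes "p \<in> polys n" "q \<in> polys n"
  shows "integrable \<nu> (\<lambda>z. cnj (poly p z) * poly q z * of_real (wdens n z))"
proof (rule Bochner_Integration.integrable_bound)
  show "integrable \<nu> (\<lambda>z. (cmod (poly p z))\<^sup>2 * wdens n z + (cmod (poly q z))\<^sup>2 * wdens n z)"
    using assms by (intro Bochner_Integration.integrable_add integrable_sq)
  show "(\<lambda>z. cnj (poly p z) * poly q z * of_real (wdens n z)) \<in> borel_measurable \<nu>"
  proof -
    have [measurable]: "(\<lambda>z. cnj (poly p z)) \<in> borel_measurable \<nu>"
      by (rule measurable_compose[OF poly_measurable_nu])
         (intro borel_measurable_continuous_onI continuous_intros)
    show ?thesis by measurable
  qed
  show "AE z in \<nu>. cmod (cnj (poly p z) * poly q z * of_real (wdens n z))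
      \<le> norm ((cmod (poly p z))\<^sup>2 * wdens n z + (cmod (poly q z))\<^sup>2 * wdens n z)"
  proof (rule AE_I2)
    fix z
    have "2 * (cmod (poly p z) * cmod (poly q z)) \<le> (cmod (poly p z))\<^sup>2 + (cmod (poly q z))\<^sup>2"
      using sum_squares_bound[of "cmod (poly p z)" "cmod (poly q z)"] by (simp add: mult.assoc)
    moreover have "0 \<le> cmod (poly p z) * cmod (poly q z)" by simp
    ultimately have "cmod (poly p z) * cmod (poly q z) \<le> (cmod (poly p z))\<^sup>2 + (cmod (poly q z))\<^sup>2"
      by linarith
    then have "cmod (poly p z) * cmod (poly q z) * wdens n z \<le> ((cmod (poly p z))\<^sup>2 + (cmod (poly q z))\<^sup>2) * wdens n z"
      by (rule mult_right_mono) (simp add: wdens_def)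
    then show "cmod (cnj (poly p z) * poly q z * of_real (wdens n z))
      \<le> norm ((cmod (poly p z))\<^sup>2 * wdens n z + (cmod (poly q z))\<^sup>2 * wdens n z)"
      using wdens_pos[of n z] by (simp add: norm_mult distrib_right)
  qed
qed

abbreviation inner_n :: "nat \<Rightarrow> complex poly \<Rightarrow> complex poly \<Rightarrow> complex" where
  "inner_n n \<equiv> weighted_inner \<phi> \<nu> n"

lemma inner_eq: "inner_n n p q = (\<integral>z. cnj (poly p z) * poly q z * of_real (wdens n z) \<partial>\<nu>)"
  by (simp add: weighted_inner_def wdens_def)

lemma inner_add_right:
  assumes "p \<in> polys n" "q \<in> polys n" "r \<in> polys n"
  shows "inner_n n p (q + r) = inner_n n p q + inner_n n p r"
  unfolding inner_eq using integrable_inner[OF assms(1,2)] integrable_inner[OF assms(1,3)]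
  by (subst Bochner_Integration.integral_add[symmetric]) (auto simp: algebra_simps)

lemma inner_smult_right:
  assumes "p \<in> polys n" "q \<in> polys n"
  shows "inner_n n p (smult c q) = c * inner_n n p q"
  unfolding inner_eq
  by (subst integral_mult_right_zero[symmetric]) (simp add: mult_ac)

lemma inner_cnj: "inner_n n q p = cnj (inner_n n p q)"
  unfolding inner_eq by (subst Bochner_Integration.integral_cnj[symmetric]) (simp add: mult_ac)

lemma polys_smult: "p \<in> polys n \<Longrightarrow> smult c p \<in> polys n"
  by (auto simp: polys_def)

lemma polys_sum: "(\<And>k. k \<in> I \<Longrightarrow> f k \<in> polys n) \<Longrightarrow> (\<Sum>k\<in>I. f k) \<in> polys n"
  by (cases "finite I") (auto simp: polys_def intro!: degree_sum_le)

lemma inner_zero_right: "inner_n n p 0 = 0"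
  by (simp add: inner_eq)

lemma inner_sum_right:
  assumes "p \<in> polys n" "finite I" "\<And>k. k \<in> I \<Longrightarrow> b k \<in> polys n"
  shows "inner_n n p (\<Sum>k\<in>I. smult (c k) (b k)) = (\<Sum>k\<in>I. c k * inner_n n p (b k))"
  using assms(2,3)
proof (induction I rule: finite_induct)
  case (insert i I)
  then have "inner_n n p (smult (c i) (b i) + (\<Sum>k\<in>I. smult (c k) (b k)))
      = inner_n n p (smult (c i) (b i)) + inner_n n p (\<Sum>k\<in>I. smult (c k) (b k))"
    by (intro inner_add_right polys_smult polys_sum assms(1)) auto
  with insert show ?case by (simp add: inner_smult_right[OF assms(1)])
qed (simp add: inner_zero_right)

definition nsq :: "nat \<Rightarrow> complex poly \<Rightarrow> real" where
  "nsq n p = (\<integral>z. (cmod (poly p z))\<^sup>2 * wdens n z \<partial>\<nu>)"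

lemma inner_self: "inner_n n p p = of_real (nsq n p)"
proof -
  have "cnj (poly p z) * poly p z * of_real (wdens n z) = of_real ((cmod (poly p z))\<^sup>2 * wdens n z)" for z
    using complex_norm_square[of "poly p z"] by (simp add: mult.commute)
  then show ?thesis
    unfolding inner_eq nsq_def by (simp only: integral_complex_of_real)
qed

lemma nsq_smult: "nsq n (smult c p) = (cmod c)\<^sup>2 * nsq n p"
  unfolding nsq_def by (simp add: norm_mult power_mult_distrib mult.assoc)

lemma ennreal_nsq:
  assumes "p \<in> polys n"
  shows "ennreal (nsq n p) = (\<integral>\<^sup>+ z. ennreal ((cmod (poly p z))\<^sup>2 * wdens n z) \<partial>\<nu>)"
  unfolding nsq_def using integrable_sq[OF assms]
  by (intro nn_integral_eq_integral[symmetric]) (auto simp: wdens_pos[THEN less_imp_le])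

lemma nsq_nonneg: "nsq n p \<ge> 0"
  unfolding nsq_def by (intro Bochner_Integration.integral_nonneg) (simp add: wdens_pos[THEN less_imp_le])

lemma measurable_nsq [measurable]: "nsq n \<in> borel_measurable (polys_borel n)"
proof -
  have fs: "fst \<in> measurable (polys_borel n \<Otimes>\<^sub>M \<nu>) (polys_borel n)" by simp
  have sn: "snd \<in> borel_measurable (polys_borel n \<Otimes>\<^sub>M \<nu>)"
    using measurable_snd[of "polys_borel n" \<nu>] by (simp add: measurable_cong_sets[OF refl sets_nu])
  have [measurable]: "(\<lambda>x. poly (fst x) (snd x)) \<in> borel_measurable (polys_borel n \<Otimes>\<^sub>M \<nu>)"
    by (rule measurable_poly_eval[OF fs sn])
  have [measurable]: "(\<lambda>x. wdens n (snd x)) \<in> borel_measurable (polys_borel n \<Otimes>\<^sub>M \<nu>)"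
    by (rule measurable_compose[OF sn wdens_measurable])
  have "(\<lambda>p. \<integral>\<^sup>+ z. ennreal ((cmod (poly p z))\<^sup>2 * wdens n z) \<partial>\<nu>) \<in> borel_measurable (polys_borel n)"
    by (rule borel_measurable_nn_integral) (simp add: case_prod_unfold)
  then have "(\<lambda>p. enn2real (\<integral>\<^sup>+ z. ennreal ((cmod (poly p z))\<^sup>2 * wdens n z) \<partial>\<nu>)) \<in> borel_measurable (polys_borel n)"
    by measurable
  then show ?thesis
    by (rule measurable_cong[THEN iffD1, rotated])
       (simp add: ennreal_nsq[symmetric] nsq_nonneg)
qed

section \<open>Orthonormal bases\<close>

context
  fixes n :: nat
  assumes nondeg: "nondegenerate_on n (inner_n n)"
begin

text \<open>A polynomial of norm 0 vanishes \<open>\<nu>\<close>-almost everywhere and is therefore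
  orthogonal to every \<open>q\<close>, which nondegeneracy forbids.\<close>

lemma nsq_pos:
  assumes p: "p \<in> polys n" "p \<noteq> 0"
  shows "nsq n p > 0"
proof (rule ccontr)
  assume "\<not> nsq n p > 0"
  then have "nsq n p = 0" using nsq_nonneg[of n p] by simp
  then have "AE z in \<nu>. (cmod (poly p z))\<^sup>2 * wdens n z = 0"
    unfolding nsq_def
    by (subst (asm) integral_nonneg_eq_0_iff_AE[OF integrable_sq[OF p(1)]])
       (auto simp: wdens_pos[THEN less_imp_le])
  then have ae: "AE z in \<nu>. poly p z = 0"
    by eventually_elim (use wdens_pos in \<open>simp add: less_le\<close>)
  have "inner_n n p q = 0" for q
    unfolding inner_eq by (rule integral_eq_zero_AE) (use ae in eventually_elim, simp)
  then show False using nondeg p unfolding nondegenerate_on_def by blast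
qed

text \<open>Gram-Schmidt on the monomials. The degrees are kept in the statement so that spanning
  follows by eliminating leading coefficients, with no count of dimensions.\<close>

lemma orthonormal_triangular:
  "m \<le> Suc n \<Longrightarrow> \<exists>b. (\<forall>k<m. degree (b k) = k \<and> b k \<noteq> 0) \<and>
    (\<forall>j<m. \<forall>k<m. inner_n n (b j) (b k) = (if j = k then 1 else 0))"
proof (induction m)
  case (Suc m)
  then obtain b where deg: "\<And>k. k < m \<Longrightarrow> degree (b k) = k \<and> b k \<noteq> 0"
    and on: "\<And>j k. j < m \<Longrightarrow> k < m \<Longrightarrow> inner_n n (b j) (b k) = (if j = k then 1 else 0)"
    by auto
  have bp: "b k \<in> polys n" if "k < m" for k using deg[OF that] Suc.prems that by (simp add: polys_def)
  define X where "X = monom (1 :: complex) m"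
  have X: "X \<in> polys n" using Suc.prems by (simp add: X_def polys_def degree_monom_eq)
  \<comment> \<open>Minus the orthogonal projection of the monomial onto the earlier vectors; the
    form is linear in its second argument, where \<open>X\<close> stands.\<close>
  define v where "v = (\<Sum>k<m. smult (- inner_n n (b k) X) (b k))"
  define u where "u = X + v"
  have v: "v \<in> polys n" unfolding v_def by (intro polys_sum polys_smult bp) auto
  have cv: "coeff v i = 0" if "i \<ge> m" for i
    using that deg by (auto simp: v_def coeff_sum intro!: sum.neutral coeff_eq_0)
  have u: "u \<in> polys n" unfolding u_def by (rule polys_add[OF X v])
  have "coeff u m = 1" by (simp add: u_def X_def cv)
  then have u0: "u \<noteq> 0" by auto
  have "degree u \<le> m" by (rule degree_le) (simp add: u_def X_def cv)
  moreover have "degree u \<ge> m" by (rule le_degree) (simp add: \<open>coeff u m = 1\<close>)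
  ultimately have du: "degree u = m" by simp
  have orth: "inner_n n (b j) u = 0" if j: "j < m" for j
  proof -
    have "inner_n n (b j) v = (\<Sum>k<m. - inner_n n (b k) X * inner_n n (b j) (b k))"
      unfolding v_def by (rule inner_sum_right) (auto intro: bp j)
    also have "\<dots> = (\<Sum>k<m. if k = j then - inner_n n (b j) X else 0)"
      by (intro sum.cong) (auto simp: on j)
    also have "\<dots> = - inner_n n (b j) X" using j by simp
    finally show ?thesis unfolding u_def by (simp add: inner_add_right[OF bp[OF j] X v])
  qed
  define s where "s = sqrt (nsq n u)"
  have s: "s > 0" "s * s = nsq n u" using nsq_pos[OF u u0] by (auto simp: s_def)
  define w where "w = smult (of_real (1 / s)) u"
  have w: "w \<in> polys n" "degree w = m" "w \<noteq> 0" using u u0 du s by (auto simp: w_def polys_smult)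
  have "nsq n w = 1" using s by (simp add: w_def nsq_smult norm_divide power2_eq_square flip: s(2))
  then have ww: "inner_n n w w = 1" by (simp add: inner_self)
  have bw: "inner_n n (b j) w = 0" if "j < m" for j
    unfolding w_def by (simp add: inner_smult_right[OF bp[OF that] u] orth[OF that])
  have wb: "inner_n n w (b j) = 0" if "j < m" for j
    using inner_cnj[of n w "b j"] bw[OF that] by simp
  show ?case
    by (rule exI[of _ "b(m := w)"]) (auto simp: less_Suc_eq deg on w ww bw wb)
qed simp

lemma triangular_spans:
  assumes deg: "\<And>k. k < m \<Longrightarrow> degree (b k) = k \<and> b k \<noteq> (0 :: complex poly)"
    and "\<And>i. i \<ge> m \<Longrightarrow> coeff p i = 0"
  shows "\<exists>c. p = (\<Sum>k<m. smult (c k) (b k))"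
  using assms
proof (induction m arbitrary: p)
  case 0
  then show ?case by (auto intro: poly_eqI)
next
  case (Suc m)
  define l where "l = coeff (b m) m"
  have l: "l \<noteq> 0" using Suc.prems(1)[of m] by (auto simp: l_def) (metis leading_coeff_0_iff)
  define q where "q = p - smult (coeff p m / l) (b m)"
  have "coeff q i = 0" if "i \<ge> m" for i
  proof (cases "i = m")
    case False
    then have "coeff (b m) i = 0" using that Suc.prems(1)[of m] by (intro coeff_eq_0) auto
    then show ?thesis using False that Suc.prems(2)[of i] by (simp add: q_def)
  qed (use l in \<open>simp add: q_def l_def\<close>)
  then obtain c where "q = (\<Sum>k<m. smult (c k) (b k))"
    using Suc.IH[of q] Suc.prems(1) by auto
  then have "p = (\<Sum>k<Suc m. smult ((c(m := coeff p m / l)) k) (b k))"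
    by (simp add: q_def diff_eq_eq)
  then show ?case by blast
qed

lemma orthonormal_basis_exists: "\<exists>b. orthonormal_basis_on n (inner_n n) b"
proof -
  obtain b where deg: "\<And>k. k < Suc n \<Longrightarrow> degree (b k) = k \<and> b k \<noteq> 0"
    and on: "\<And>j k. j < Suc n \<Longrightarrow> k < Suc n \<Longrightarrow> inner_n n (b j) (b k) = (if j = k then 1 else 0)"
    using orthonormal_triangular[of "Suc n"] by auto
  have "orthonormal_basis_on n (inner_n n) b"
    unfolding orthonormal_basis_on_def
  proof (intro conjI allI impI ballI)
    show "b k \<in> polys n" if "k \<le> n" for k using deg[of k] that by (auto simp: polys_def)
    show "inner_n n (b j) (b k) = (if j = k then 1 else 0)" if "j \<le> n" "k \<le> n" for j k
      using on[of j k] that by simp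
    show "\<exists>c. p = (\<Sum>k\<le>n. smult (c k) (b k))" if "p \<in> polys n" for p
      using triangular_spans[of "Suc n" b p, OF deg] that
      by (simp add: lessThan_Suc_atMost polys_def coeff_eq_0)
  qed
  then show ?thesis by blast
qed

end

end

section \<open>The law of the zeros\<close>

text \<open>Each of the \<open>n\<close> lower coefficients is replaced by \<open>a\<close> times a
  new variable, at the price of one planar Jacobian |a|^2.\<close>

lemma nn_integral_lead_poly_scale:
  assumes a: "a \<noteq> 0" and "H \<in> borel_measurable (polys_borel n)"
  shows "(\<integral>\<^sup>+ x. H (lead_poly a n x) \<partial>lebesgue_power n)
    = ennreal ((cmod a)\<^sup>2) ^ n * (\<integral>\<^sup>+ x. H (smult a (lead_poly 1 n x)) \<partial>lebesgue_power n)"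
  using assms(2)
proof (induction n arbitrary: H)
  case (Suc n)
  note H = Suc.prems
  have pC: "(\<lambda>p. pCons (snd p) (fst p)) \<in> measurable (polys_borel n \<Otimes>\<^sub>M lborel) (polys_borel (Suc n))"
    by (intro measurable_poly_pCons) auto
  have H2: "(\<lambda>(q, y). H (pCons y q)) \<in> borel_measurable (polys_borel n \<Otimes>\<^sub>M lborel)"
    using measurable_compose[OF pC H] by (simp add: case_prod_unfold)
  have Hy: "(\<lambda>y. H (pCons y q)) \<in> borel_measurable borel" if "q \<in> polys n" for q
    using that by (intro measurable_compose[OF _ H] measurable_poly_pCons measurable_const) auto
  define H' where "H' q = (\<integral>\<^sup>+ y. H (pCons y q) \<partial>lborel)" for q
  have H' [measurable]: "H' \<in> borel_measurable (polys_borel n)"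
    unfolding H'_def by (rule lborel.borel_measurable_nn_integral[OF H2])
  have m1: "(\<lambda>x. H (lead_poly a (Suc n) x)) \<in> borel_measurable (lebesgue_power (Suc n))"
    by (rule borel_measurable_lead_poly[OF H]) auto
  have m2: "(\<lambda>x. H (smult a (lead_poly 1 (Suc n) x))) \<in> borel_measurable (lebesgue_power (Suc n))"
    by (intro measurable_compose[OF _ H] measurable_poly_smult measurable_lead_poly) auto
  have sp: "smult a (lead_poly 1 n x) \<in> polys n" for x
    using degree_lead_poly[of 1 n x] a by (simp add: polys_def)
  have scale: "H' (smult a (lead_poly 1 n x))
      = ennreal ((cmod a)\<^sup>2) * (\<integral>\<^sup>+ y. H (smult a (lead_poly 1 (Suc n) (x(n := y)))) \<partial>lborel)" for x
  proof -
    have m: "(\<lambda>w. H (pCons (a * w) (smult a (lead_poly 1 n x)))) \<in> borel_measurable borel"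
      by (rule measurable_compose[OF _ Hy[OF sp]]) measurable
    show ?thesis
      unfolding H'_def nn_integral_complex_scale[OF a Hy[OF sp], symmetric]
      using m by (subst nn_integral_multc) (auto simp: mult.commute)
  qed
  have "(\<integral>\<^sup>+ x. H (lead_poly a (Suc n) x) \<partial>lebesgue_power (Suc n))
      = (\<integral>\<^sup>+ x. H' (lead_poly a n x) \<partial>lebesgue_power n)"
    unfolding nn_integral_lebesgue_power_Suc(1)[OF m1] H'_def by simp
  also have "\<dots> = ennreal ((cmod a)\<^sup>2) ^ n * (\<integral>\<^sup>+ x. H' (smult a (lead_poly 1 n x)) \<partial>lebesgue_power n)"
    by (rule Suc.IH[OF H'])
  also have "(\<integral>\<^sup>+ x. H' (smult a (lead_poly 1 n x)) \<partial>lebesgue_power n)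
      = ennreal ((cmod a)\<^sup>2) * (\<integral>\<^sup>+ x. H (smult a (lead_poly 1 (Suc n) x)) \<partial>lebesgue_power (Suc n))"
    unfolding scale nn_integral_lebesgue_power_Suc(1)[OF m2]
  proof (rule nn_integral_cmult, rule lborel.borel_measurable_nn_integral)
    have "(\<lambda>p. smult a (pCons (snd p) (lead_poly 1 n (fst p)))) \<in> measurable (lebesgue_power n \<Otimes>\<^sub>M lborel) (polys_borel (Suc n))"
      by (intro measurable_poly_smult measurable_poly_pCons measurable_lead_poly) auto
    from measurable_compose[OF this H]
    show "(\<lambda>(x, y). H (smult a (lead_poly 1 (Suc n) (x(n := y))))) \<in> borel_measurable (lebesgue_power n \<Otimes>\<^sub>M lborel)"
      by (simp add: case_prod_unfold)
  qed
  finally show ?case by (simp add: mult_ac)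
qed simp

text \<open>In polar coordinates the value is pi * n!; below it enters as a constant with 0 < value
  < \<infinity>.\<close>

definition gaussian_moment :: "nat \<Rightarrow> ennreal" where
  "gaussian_moment n = (\<integral>\<^sup>+ w. ennreal (((cmod w)\<^sup>2) ^ n * exp (- (cmod w)\<^sup>2)) \<partial>lborel)"

text \<open>Substituting \<open>sqrt s * w\<close> for \<open>w\<close> yields \<open>n\<close>
  factors \<open>s\<close> from the power and one more from the planar Jacobian, hence the exponent
  \<open>Suc n\<close>. This is the origin of n + 1 in the energy.\<close>

lemma gaussian_moment_scaled:
  assumes s: "s > 0"
  shows "(\<integral>\<^sup>+ w. ennreal (((cmod w)\<^sup>2) ^ n * exp (- ((cmod w)\<^sup>2 * s))) \<partial>lborel)
    = gaussian_moment n * ennreal ((1 / s) ^ Suc n)"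
proof -
  define f where "f w = ennreal (((cmod w)\<^sup>2) ^ n * exp (- (cmod w)\<^sup>2))" for w
  have [measurable]: "f \<in> borel_measurable borel" unfolding f_def by measurable
  have "gaussian_moment n = (\<integral>\<^sup>+ w. f (of_real (sqrt s) * w) * ennreal ((cmod (of_real (sqrt s)))\<^sup>2) \<partial>lborel)"
    unfolding gaussian_moment_def f_def[symmetric]
    using s by (intro nn_integral_complex_scale[symmetric]) auto
  also have "\<dots> = (\<integral>\<^sup>+ w. ennreal (s ^ Suc n) * ennreal (((cmod w)\<^sup>2) ^ n * exp (- ((cmod w)\<^sup>2 * s))) \<partial>lborel)"
    using s by (intro nn_integral_cong)
      (simp add: f_def norm_mult power_mult_distrib ennreal_mult'[symmetric] mult_ac)
  also have "\<dots> = ennreal (s ^ Suc n) * (\<integral>\<^sup>+ w. ennreal (((cmod w)\<^sup>2) ^ n * exp (- ((cmod w)\<^sup>2 * s))) \<partial>lborel)"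
    by (rule nn_integral_cmult) measurable
  finally have "gaussian_moment n * ennreal ((1 / s) ^ Suc n)
      = (ennreal (s ^ Suc n) * ennreal ((1 / s) ^ Suc n)) * (\<integral>\<^sup>+ w. ennreal (((cmod w)\<^sup>2) ^ n * exp (- ((cmod w)\<^sup>2 * s))) \<partial>lborel)"
    by (simp only: mult_ac)
  also have "ennreal (s ^ Suc n) * ennreal ((1 / s) ^ Suc n) = 1"
    using s by (subst ennreal_mult'[symmetric]) (auto simp: power_mult_distrib[symmetric] simp del: power_Suc)
  finally show ?thesis by simp
qed

lemma gaussian_moment_pos: "gaussian_moment n > 0"
proof -
  have "gaussian_moment n \<noteq> 0"
  proof
    assume "gaussian_moment n = 0"
    then have "AE w in lborel. ennreal (((cmod w)\<^sup>2) ^ n * exp (- (cmod w)\<^sup>2)) = 0"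
      unfolding gaussian_moment_def by (subst (asm) nn_integral_0_iff_AE) auto
    moreover have "AE w in lborel. w \<noteq> (0 :: complex)" by (rule AE_lborel_singleton)
    ultimately have "AE w in (lborel :: complex measure). False"
    proof eventually_elim
      case (elim w)
      then have "0 < ((cmod w)\<^sup>2) ^ n * exp (- (cmod w)\<^sup>2)"
        by (intro mult_pos_pos zero_less_power) auto
      moreover from elim(1) have "((cmod w)\<^sup>2) ^ n * exp (- (cmod w)\<^sup>2) \<le> 0"
        by (subst (asm) ennreal_eq_0_iff)
      ultimately show False by linarith
    qed
    then show False by (simp add: eventually_False ae_filter_eq_bot_iff)
  qed
  then show ?thesis by (simp add: zero_less_iff_neq_zero)
qed

lemma gaussian_moment_finite:
  assumes n: "n \<ge> 1"
  shows "gaussian_moment n < \<infinity>"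
proof -
  \<comment> \<open>The inequality x \<le> e^x at x = t / (2n), raised to the power
    \<open>n\<close>, leaves half of the exponential decay.\<close>
  have bound: "t ^ n * exp (- t) \<le> (2 * real n) ^ n * exp (- (t * (1 / 2)))" if t: "t \<ge> 0" for t :: real
  proof -
    have "t / (2 * real n) \<le> exp (t / (2 * real n))"
      using exp_ge_add_one_self[of "t / (2 * real n)"] by linarith
    then have "(t / (2 * real n)) ^ n \<le> exp (t / (2 * real n)) ^ n"
      using t by (intro power_mono) auto
    also have "exp (t / (2 * real n)) ^ n = exp (t / 2)"
      using n by (simp add: exp_of_nat_mult[symmetric])
    finally have "t ^ n \<le> (2 * real n) ^ n * exp (t / 2)"
      using n by (simp add: power_divide pos_divide_le_eq mult.commute)
    then have "t ^ n * exp (- t) \<le> (2 * real n) ^ n * exp (t / 2) * exp (- t)"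
      by (rule mult_right_mono) simp
    also have "\<dots> = (2 * real n) ^ n * exp (t / 2 + - t)"
      by (simp only: exp_add mult.assoc)
    finally show ?thesis by (simp add: field_simps)
  qed
  have "gaussian_moment n \<le> (\<integral>\<^sup>+ w. ennreal ((2 * real n) ^ n) * ennreal (exp (- ((cmod w)\<^sup>2 * (1 / 2)))) \<partial>(lborel :: complex measure))"
    unfolding gaussian_moment_def using bound
    by (intro nn_integral_mono) (simp add: ennreal_mult'[symmetric] ennreal_leI)
  also have "\<dots> = ennreal ((2 * real n) ^ n) * (\<integral>\<^sup>+ w. ennreal (exp (- ((cmod w)\<^sup>2 * (1 / 2)))) \<partial>(lborel :: complex measure))"
    by (rule nn_integral_cmult) measurable
  also have "(\<integral>\<^sup>+ w. ennreal (exp (- ((cmod w)\<^sup>2 * (1 / 2)))) \<partial>(lborel :: complex measure)) = ennreal pi * ennreal 2"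
    using gaussian_moment_scaled[of "1 / 2" 0] by (simp add: gaussian_moment_def nn_integral_complex_gaussian)
  also have "ennreal ((2 * real n) ^ n) * (ennreal pi * ennreal 2) < \<infinity>"
    by (simp add: ennreal_mult_less_top)
  finally show ?thesis .
qed

section \<open>The Gibbs density as a function of the roots\<close>

context planar_weight
begin

text \<open>The \<open>n\<close> factors e^(-\<phi> u) make up the weight of the inner product, and
  the squared distances make up the squared modulus of the monic polynomial; the rest does not
  depend on \<open>u\<close>.\<close>

lemma nn_integral_confining:
  "(\<integral>\<^sup>+ u. eexp (- (\<Sum>i<n. pair_energy \<phi> u (z i))) \<partial>\<nu>)
    = ennreal (exp (- (\<Sum>i<n. \<phi> (z i))) * nsq n (\<Prod>i<n. [:- z i, 1:]))"
proof -
  let ?Q = "\<Prod>i<n. [:- z i, 1:]"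
  have "eexp (- (\<Sum>i<n. pair_energy \<phi> u (z i)))
      = ennreal (exp (- (\<Sum>i<n. \<phi> (z i)))) * ennreal ((cmod (poly ?Q u))\<^sup>2 * wdens n u)" for u
  proof -
    have "eexp (- (\<Sum>i<n. pair_energy \<phi> u (z i))) = (\<Prod>i<n. ennreal ((cmod (u - z i))\<^sup>2 * exp (- (\<phi> u + \<phi> (z i)))))"
      by (subst eexp_neg_sum) (auto simp: pair_energy_not_MInfty eexp_neg_pair_energy)
    also have "\<dots> = ennreal (\<Prod>i<n. (cmod (u - z i))\<^sup>2 * exp (- (\<phi> u + \<phi> (z i))))"
      by (rule prod_ennreal) simp
    also have "(\<Prod>i<n. (cmod (u - z i))\<^sup>2 * exp (- (\<phi> u + \<phi> (z i))))
        = (\<Prod>i<n. (cmod (u - z i))\<^sup>2) * exp (\<Sum>i<n. - (\<phi> u + \<phi> (z i)))"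
      by (simp only: prod.distrib exp_sum finite_lessThan)
    also have "(\<Prod>i<n. (cmod (u - z i))\<^sup>2) = (cmod (poly ?Q u))\<^sup>2"
      by (simp add: poly_prod prod_norm[symmetric] prod_power_distrib)
    also have "(\<Sum>i<n. - (\<phi> u + \<phi> (z i))) = - real n * \<phi> u + - (\<Sum>i<n. \<phi> (z i))"
      by (simp add: sum_negf sum.distrib sum_subtractf)
    also have "exp (- real n * \<phi> u + - (\<Sum>i<n. \<phi> (z i))) = wdens n u * exp (- (\<Sum>i<n. \<phi> (z i)))"
      unfolding wdens_def by (rule exp_add)
    finally show ?thesis by (simp add: ennreal_mult'[symmetric] mult_ac)
  qed
  then have "(\<integral>\<^sup>+ u. eexp (- (\<Sum>i<n. pair_energy \<phi> u (z i))) \<partial>\<nu>)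
      = ennreal (exp (- (\<Sum>i<n. \<phi> (z i)))) * (\<integral>\<^sup>+ u. ennreal ((cmod (poly ?Q u))\<^sup>2 * wdens n u) \<partial>\<nu>)"
    by (simp add: nn_integral_cmult)
  also have "\<dots> = ennreal (exp (- (\<Sum>i<n. \<phi> (z i))) * nsq n ?Q)"
    by (subst ennreal_nsq[OF prod_linear_polys, symmetric]) (simp add: ennreal_mult' nsq_nonneg)
  finally show ?thesis .
qed

context
  fixes n :: nat
  assumes n1: "n \<ge> 1" and nondeg: "nondegenerate_on n (inner_n n)"
begin

lemma nsq_prod_pos: "nsq n (\<Prod>i<n. [:- z i, 1:]) > 0"
  by (rule nsq_pos[OF nondeg prod_linear_polys prod_linear_nonzero])

definition repulsion :: "(nat \<Rightarrow> complex) \<Rightarrow> ereal" where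
  "repulsion z = (\<Sum>j<n. \<Sum>i<j. pair_energy \<phi> (z i) (z j))"

definition confining :: "(nat \<Rightarrow> complex) \<Rightarrow> real" where
  "confining z = exp (- (\<Sum>i<n. \<phi> (z i))) * nsq n (\<Prod>i<n. [:- z i, 1:])"

lemma confining_pos: "confining z > 0"
  by (simp add: confining_def nsq_prod_pos)

lemma repulsion_not_MInfty: "repulsion z \<noteq> - \<infinity>"
  unfolding repulsion_def by (intro sum_not_MInfty pair_energy_not_MInfty)

text \<open>Since the monic polynomial has positive norm, \<open>elog\<close> is an ordinary
  logarithm here, and infinite energy can come only from coinciding points.\<close>

lemma energy_eq:
  "energy \<phi> \<nu> n z = ereal (1 / (real n)\<^sup>2) * repulsion z + ereal ((real n + 1) / (real n)\<^sup>2 * ln (confining z))"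
  using confining_pos[of z]
  by (simp add: energy_def repulsion_def nn_integral_confining confining_def[symmetric] elog_def
      ennreal_eq_0_iff)

lemma energy_not_MInfty: "energy \<phi> \<nu> n z \<noteq> - \<infinity>"
  unfolding energy_eq using repulsion_not_MInfty[of z] n1
  by (cases "repulsion z") auto

lemma energy_permute:
  assumes "\<sigma> permutes {..<n}"
  shows "energy \<phi> \<nu> n (z \<circ> \<sigma>) = energy \<phi> \<nu> n z"
proof -
  have "repulsion (z \<circ> \<sigma>) = repulsion z"
    unfolding repulsion_def comp_def by (rule sum_pairs_permute[OF assms pair_energy_commute])
  moreover have "(\<Sum>i<n. \<phi> (z (\<sigma> i))) = (\<Sum>i<n. \<phi> (z i))"
    using sum.permute[OF assms, of "\<lambda>i. \<phi> (z i)"] by (simp add: comp_def)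
  moreover have "(\<Prod>i<n. [:- z (\<sigma> i), 1:]) = (\<Prod>i<n. [:- z i, 1:])"
    using prod.permute[OF assms, of "\<lambda>i. [:- z i, 1:]"] by (simp add: comp_def)
  ultimately show ?thesis by (simp add: energy_eq confining_def)
qed

lemma measurable_phi_component: "i < n \<Longrightarrow> (\<lambda>z. \<phi> (z i)) \<in> borel_measurable (lebesgue_power n)"
  by (rule measurable_compose[OF measurable_component borel_measurable_phi])

lemma measurable_nsq_prod [measurable]:
  "(\<lambda>z. nsq n (\<Prod>i<n. [:- z i, 1:])) \<in> borel_measurable (lebesgue_power n)"
  by (rule measurable_compose[OF _ measurable_nsq], rule measurable_prod_linear) simp

lemma measurable_energy: "energy \<phi> \<nu> n \<in> borel_measurable (\<Pi>\<^sub>M i\<in>{..<n}. borel)"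
proof -
  have "(\<lambda>z. pair_energy \<phi> (z i) (z j)) \<in> borel_measurable (lebesgue_power n)" if "j < n" "i < j" for i j
  proof -
    have [measurable]: "(\<lambda>z. z i) \<in> borel_measurable (lebesgue_power n)" "(\<lambda>z. z j) \<in> borel_measurable (lebesgue_power n)"
      "(\<lambda>z. \<phi> (z i)) \<in> borel_measurable (lebesgue_power n)" "(\<lambda>z. \<phi> (z j)) \<in> borel_measurable (lebesgue_power n)"
      using that by (auto intro: measurable_component measurable_phi_component)
    show ?thesis unfolding pair_energy_eq by measurable
  qed
  then have [measurable]: "repulsion \<in> borel_measurable (lebesgue_power n)"
    unfolding repulsion_def[abs_def] by (intro borel_measurable_ereal_sum) auto
  have [measurable]: "confining \<in> borel_measurable (lebesgue_power n)"
    unfolding confining_def[abs_def] by measurable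
  have "energy \<phi> \<nu> n \<in> borel_measurable (lebesgue_power n)"
    unfolding energy_eq[abs_def] by measurable
  moreover have "sets (lebesgue_power n) = sets (\<Pi>\<^sub>M i\<in>{..<n}. borel)"
    by (rule sets_PiM_cong) auto
  ultimately show ?thesis by (simp cong: measurable_cong_sets)
qed

text \<open>Writing S for the sum of the \<open>\<phi> (z i)\<close>, the pairs contribute e^(-(n -
  1) S) and the power -(n + 1) of \<open>confining\<close> contributes e^((n + 1) S), which leaves
  e^(2 S).\<close>

lemma gibbs_weight:
  "eexp (- (ereal ((real n)\<^sup>2) * energy \<phi> \<nu> n z))
    = ennreal (exp (2 * (\<Sum>i<n. \<phi> (z i)))) *
      ennreal (vandermonde_sq n z * (1 / nsq n (\<Prod>i<n. [:- z i, 1:])) ^ Suc n)"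
proof -
  define S where "S = (\<Sum>i<n. \<phi> (z i))"
  define r where "r = nsq n (\<Prod>i<n. [:- z i, 1:])"
  have r: "r > 0" unfolding r_def by (rule nsq_prod_pos)
  have conf: "confining z = exp (- S) * r" by (simp add: confining_def S_def r_def)
  \<comment> \<open>As \<open>n\<close> is nonzero, n^2 undoes the normalisation, also where the
    repulsion is infinite.\<close>
  have "ereal ((real n)\<^sup>2) * energy \<phi> \<nu> n z = repulsion z + ereal ((real n + 1) * ln (confining z))"
    unfolding energy_eq using repulsion_not_MInfty[of z] n1
    by (cases "repulsion z") (auto simp: field_simps)
  then have "eexp (- (ereal ((real n)\<^sup>2) * energy \<phi> \<nu> n z))
      = eexp (- repulsion z) * eexp (- ereal ((real n + 1) * ln (confining z)))"
    by (simp only:) (rule eexp_neg_add, use repulsion_not_MInfty[of z] in auto)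
  also have "eexp (- repulsion z) = (\<Prod>j<n. \<Prod>i<j. eexp (- pair_energy \<phi> (z i) (z j)))"
    unfolding repulsion_def
    by (subst eexp_neg_sum) (auto intro!: sum_not_MInfty pair_energy_not_MInfty prod.cong eexp_neg_sum)
  also have "\<dots> = ennreal (\<Prod>j<n. \<Prod>i<j. (cmod (z i - z j))\<^sup>2 * exp (- (\<phi> (z i) + \<phi> (z j))))"
    unfolding eexp_neg_pair_energy by (subst prod_ennreal[symmetric], simp add: prod_nonneg,
        intro prod.cong refl prod_ennreal) simp
  also have "\<dots> = ennreal (vandermonde_sq n z * exp (- (real n - 1) * S))"
    unfolding vandermonde_exp_telescope S_def ..
  also have "eexp (- ereal ((real n + 1) * ln (confining z))) = ennreal (exp ((real n + 1) * S) * (1 / r) ^ Suc n)"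
  proof -
    have "- ((real n + 1) * ln (confining z)) = (real n + 1) * S + real (Suc n) * ln (1 / r)"
      unfolding conf using r by (simp add: ln_mult ln_div algebra_simps)
    then have "exp (- ((real n + 1) * ln (confining z))) = exp ((real n + 1) * S) * exp (ln (1 / r)) ^ Suc n"
      by (simp only: exp_add exp_of_nat_mult)
    then show ?thesis using r by (simp add: eexp_def)
  qed
  also have "ennreal (vandermonde_sq n z * exp (- (real n - 1) * S)) * ennreal (exp ((real n + 1) * S) * (1 / r) ^ Suc n)
      = ennreal ((exp (- (real n - 1) * S) * exp ((real n + 1) * S)) * (vandermonde_sq n z * (1 / r) ^ Suc n))"
    using r by (subst ennreal_mult'[symmetric]) (auto simp: mult_ac vandermonde_sq_nonneg)
  also have "exp (- (real n - 1) * S) * exp ((real n + 1) * S) = exp (2 * S)"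
    unfolding exp_add[symmetric] by (simp add: algebra_simps)
  finally show ?thesis
    unfolding S_def r_def by (simp only: ennreal_mult'[symmetric] exp_ge_zero)
qed

text \<open>The factor left over in \<open>gibbs_weight\<close> cancels the density of
  \<open>ref_measure\<close>, of which only the normalisation \<open>Z ^ n\<close> survives.\<close>

lemma nn_integral_gibbs:
  assumes [measurable]: "f \<in> borel_measurable (lebesgue_power n)"
  shows "ennreal (Z ^ n) * (\<integral>\<^sup>+ z. f z \<partial>gibbs_measure \<phi> \<nu> n)
    = (\<integral>\<^sup>+ z. f z * ennreal (vandermonde_sq n z * (1 / nsq n (\<Prod>i<n. [:- z i, 1:])) ^ Suc n) \<partial>lebesgue_power n)"
proof -
  define h where "h z = ennreal (vandermonde_sq n z * (1 / nsq n (\<Prod>i<n. [:- z i, 1:])) ^ Suc n)" for z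
  define e where "e z = ennreal (exp (2 * (\<Sum>i<n. \<phi> (z i))))" for z
  define d where "d z = ennreal (exp (- 2 * (\<Sum>i<n. \<phi> (z i))) / Z ^ n)" for z
  have [measurable]: "h \<in> borel_measurable (lebesgue_power n)" "e \<in> borel_measurable (lebesgue_power n)"
    "d \<in> borel_measurable (lebesgue_power n)"
    unfolding h_def[abs_def] e_def[abs_def] d_def[abs_def] by measurable
  have Zn: "ennreal (Z ^ n) * (d z * (e z * h z * f z)) = f z * h z" for z
  proof -
    have "ennreal (Z ^ n) * d z * e z = ennreal (exp (- 2 * (\<Sum>i<n. \<phi> (z i))) * exp (2 * (\<Sum>i<n. \<phi> (z i))))"
      unfolding d_def e_def using Z_pos by (simp add: ennreal_mult'[symmetric])
    also have "\<dots> = 1" unfolding exp_add[symmetric] by simp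
    finally have *: "ennreal (Z ^ n) * d z * e z = 1" .
    have "ennreal (Z ^ n) * (d z * (e z * h z * f z)) = (ennreal (Z ^ n) * d z * e z) * (f z * h z)"
      by (simp only: mult_ac)
    then show ?thesis by (simp only: * mult_1)
  qed
  have gibbs: "gibbs_measure \<phi> \<nu> n = density (density (lebesgue_power n) d) (\<lambda>z. e z * h z)"
    unfolding gibbs_measure_def PiM_ref_measure gibbs_weight e_def h_def d_def ..
  have "(\<integral>\<^sup>+ z. f z \<partial>gibbs_measure \<phi> \<nu> n) = (\<integral>\<^sup>+ z. d z * (e z * h z * f z) \<partial>lebesgue_power n)"
    unfolding gibbs by (subst nn_integral_density, simp, simp, subst nn_integral_density) simp_all
  then have "ennreal (Z ^ n) * (\<integral>\<^sup>+ z. f z \<partial>gibbs_measure \<phi> \<nu> n)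
      = (\<integral>\<^sup>+ z. ennreal (Z ^ n) * (d z * (e z * h z * f z)) \<partial>lebesgue_power n)"
    by (simp add: nn_integral_cmult)
  then show ?thesis unfolding Zn unfolding h_def .
qed

section \<open>The Gaussian law in coefficient and root coordinates\<close>

lemma linear_coordinates_basis:
  assumes b: "orthonormal_basis_on n (inner_n n) b"
  shows "linear_coordinates n (\<lambda>a. \<Sum>k\<le>n. smult (a k) (b k))"
  unfolding linear_coordinates_def
proof (intro conjI allI impI ballI)
  have bp: "b k \<in> polys n" if "k \<le> n" for k using b that by (auto simp: orthonormal_basis_on_def)
  show "(\<lambda>a. \<Sum>k\<le>n. smult (a k) (b k)) \<in> measurable (lebesgue_power (Suc n)) (polys_borel n)"
  proof (rule measurable_polys_borelI)
    show "(\<Sum>k\<le>n. smult (a k) (b k)) \<in> polys n" for a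
      by (intro polys_sum polys_smult bp) auto
    have "(\<lambda>a. a k) \<in> borel_measurable (lebesgue_power (Suc n))" if "k \<le> n" for k
      using that by (intro measurable_component) simp
    then show "(\<lambda>a. coeff (\<Sum>k\<le>n. smult (a k) (b k)) i) \<in> borel_measurable (lebesgue_power (Suc n))" for i
      unfolding coeff_sum coeff_smult by (intro borel_measurable_sum borel_measurable_times) auto
  qed
  show "(\<Sum>k\<le>n. smult (x k + y k) (b k)) = (\<Sum>k\<le>n. smult (x k) (b k)) + (\<Sum>k\<le>n. smult (y k) (b k))" for x y
    by (simp add: smult_add_left sum.distrib)
  show "(\<Sum>k\<le>n. smult (x k) (b k)) = (\<Sum>k\<le>n. smult (y k) (b k))" if "\<forall>k\<le>n. x k = y k" for x y
    using that by (intro sum.cong) auto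
  show "\<exists>x. (\<Sum>k\<le>n. smult (x k) (b k)) = p" if "p \<in> polys n" for p
    using b that unfolding orthonormal_basis_on_def by metis
qed

lemma nsq_basis:
  assumes b: "orthonormal_basis_on n (inner_n n) b"
  shows "nsq n (\<Sum>k\<le>n. smult (a k) (b k)) = (\<Sum>k\<le>n. (cmod (a k))\<^sup>2)"
proof -
  have bp: "b k \<in> polys n" if "k \<le> n" for k using b that by (auto simp: orthonormal_basis_on_def)
  have on: "inner_n n (b j) (b k) = (if j = k then 1 else 0)" if "j \<le> n" "k \<le> n" for j k
    using b that by (auto simp: orthonormal_basis_on_def)
  let ?p = "\<Sum>k\<le>n. smult (a k) (b k)"
  have p: "?p \<in> polys n" by (intro polys_sum polys_smult bp) auto
  have bk: "inner_n n (b j) ?p = a j" if "j \<le> n" for j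
  proof -
    have "inner_n n (b j) ?p = (\<Sum>k\<le>n. a k * inner_n n (b j) (b k))"
      by (rule inner_sum_right) (auto intro: bp that)
    also have "\<dots> = (\<Sum>k\<le>n. if k = j then a j else 0)"
      by (intro sum.cong) (auto simp: on that)
    finally show ?thesis using that by simp
  qed
  have "of_real (nsq n ?p) = (\<Sum>k\<le>n. a k * inner_n n ?p (b k))"
    unfolding inner_self[symmetric] by (rule inner_sum_right[OF p]) (auto intro: bp)
  also have "\<dots> = (\<Sum>k\<le>n. a k * cnj (a k))"
    by (intro sum.cong refl) (simp add: inner_cnj[of n ?p] bk)
  also have "\<dots> = of_real (\<Sum>k\<le>n. (cmod (a k))\<^sup>2)"
    by (simp only: of_real_sum complex_norm_square)
  finally show ?thesis by (simp only: of_real_eq_iff)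
qed

text \<open>\<open>linear_coordinates_change\<close> is applied with \<open>g\<close> the Gaussian
  weight e^(-<p,p>). In orthonormal coordinates its integral is pi^(n+1) by Parseval; in coefficient
  coordinates it is \<open>c\<close>. Neither value involves the basis, so one \<open>c\<close>
  serves for all of them.\<close>

lemma gaussian_weight_coeffs:
  obtains c where "0 < c" "c < \<infinity>"
    "\<forall>b F. orthonormal_basis_on n (inner_n n) b \<longrightarrow> F \<in> borel_measurable (polys_borel n) \<longrightarrow>
      c * (\<integral>\<^sup>+ p. F p \<partial>gaussian_polynomial_law n b)
      = (\<integral>\<^sup>+ y. F (lead_poly (y n) n y) * ennreal (exp (- nsq n (lead_poly (y n) n y))) \<partial>lebesgue_power (Suc n))"
proof -
  let ?L = "lebesgue_power (Suc n)"
  let ?N = "\<lambda>y. lead_poly (y n) n y"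
  let ?M = "\<lambda>b a. \<Sum>k\<le>n. smult (a k) (b k)"
  define g where "g p = ennreal (exp (- nsq n p))" for p
  define P where "P = ennreal pi ^ Suc n"
  have "P = ennreal (pi ^ Suc n)" unfolding P_def by (rule ennreal_power) simp
  moreover have "pi ^ Suc n > 0" by (intro zero_less_power) simp
  ultimately have P: "P \<noteq> 0" "P \<noteq> \<infinity>" by (auto simp only: ennreal_eq_0_iff infinity_ennreal_def ennreal_neq_top)
  have g [measurable]: "g \<in> borel_measurable (polys_borel n)" unfolding g_def by measurable
  define c where "c = (\<integral>\<^sup>+ y. g (?N y) \<partial>?L)"
  have N: "linear_coordinates n ?N" by (rule linear_coordinates_lead_poly)
  have Nm: "?N \<in> measurable ?L (polys_borel n)" by (rule measurable_linear_coordinates[OF N])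
  have gM: "g (?M b a) = ennreal (exp (- (\<Sum>k<Suc n. (cmod (a k))\<^sup>2)))"
    if "orthonormal_basis_on n (inner_n n) b" for a b
    unfolding g_def nsq_basis[OF that] lessThan_Suc_atMost ..
  have gM': "(\<integral>\<^sup>+ a. g (- ?M b a) \<partial>?L) = P" if b: "orthonormal_basis_on n (inner_n n) b" for b
  proof -
    have "g (- p) = g p" for p using nsq_smult[of n "-1" p] by (simp add: g_def)
    then show ?thesis by (simp only: gM[OF b] nn_integral_gaussian_power P_def)
  qed
  have change: "(\<integral>\<^sup>+ a. f (?M b a) \<partial>?L) * c = P * (\<integral>\<^sup>+ y. f (?N y) \<partial>?L)"
    if b: "orthonormal_basis_on n (inner_n n) b" and f: "f \<in> borel_measurable (polys_borel n)" for f b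
    using linear_coordinates_change[OF linear_coordinates_basis[OF b] N f g] unfolding c_def gM'[OF b] .
  obtain b0 where b0: "orthonormal_basis_on n (inner_n n) b0"
    using orthonormal_basis_exists[OF nondeg] by blast
  \<comment> \<open>The weight is strictly positive, so a vanishing integral would make Lebesgue
    measure null and the Gaussian integral \<open>P\<close> zero.\<close>
  have c0: "c \<noteq> 0"
  proof
    assume "c = 0"
    then have "AE y in ?L. g (?N y) = 0"
      unfolding c_def using measurable_compose[OF Nm g] by (subst (asm) nn_integral_0_iff_AE) auto
    then have "AE y in ?L. False" by eventually_elim (simp add: g_def)
    then have "AE y in ?L. ennreal (exp (- (\<Sum>i<Suc n. (cmod (y i))\<^sup>2))) = 0"
      by eventually_elim simp
    then have "(\<integral>\<^sup>+ x. ennreal (exp (- (\<Sum>i<Suc n. (cmod (x i))\<^sup>2))) \<partial>?L) = (\<integral>\<^sup>+ x. 0 \<partial>?L)"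
      by (rule nn_integral_cong_AE)
    then have "P = 0" by (simp only: nn_integral_gaussian_power P_def) simp
    then show False using P by simp
  qed
  \<comment> \<open>Testing with the standard Gaussian \<open>h\<close> in the coefficients gives
    (integral of \<open>h\<close>) * c = P * P, where P * P is neither 0 nor infinite.\<close>
  have cfin: "c \<noteq> \<infinity>"
  proof
    assume cinf: "c = \<infinity>"
    define h where "h p = ennreal (exp (- (\<Sum>i\<le>n. (cmod (coeff p i))\<^sup>2)))" for p :: "complex poly"
    have h: "h \<in> borel_measurable (polys_borel n)" unfolding h_def by measurable
    have "(\<integral>\<^sup>+ y. h (?N y) \<partial>?L) = P"
      unfolding h_def sum_norm_coeff_lead_poly P_def nn_integral_gaussian_power[symmetric] by simp
    then have PP: "(\<integral>\<^sup>+ a. h (?M b0 a) \<partial>?L) * c = P * P"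
      using change[OF b0 h] by simp
    have fin: "P * P \<noteq> \<infinity>" using P by (simp add: ennreal_mult_eq_top_iff)
    show False
    proof (cases "(\<integral>\<^sup>+ a. h (?M b0 a) \<partial>?L) = 0")
      case True
      then have "P * P = 0" using PP by (simp only: mult_zero_left)
      then show False using P by simp
    next
      case False
      then have "(\<integral>\<^sup>+ a. h (?M b0 a) \<partial>?L) * \<infinity> = \<infinity>" by (simp add: ennreal_mult_eq_top_iff)
      with PP[unfolded cinf, symmetric] have "P * P = \<infinity>" by (rule trans)
      with fin show False by contradiction
    qed
  qed
  show thesis
  proof (rule that)
    show "0 < c" using c0 by (simp add: zero_less_iff_neq_zero)
    show "c < \<infinity>" using cfin by (simp add: less_top)
    show "\<forall>b F. orthonormal_basis_on n (inner_n n) b \<longrightarrow> F \<in> borel_measurable (polys_borel n) \<longrightarrow>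
      c * (\<integral>\<^sup>+ p. F p \<partial>gaussian_polynomial_law n b)
      = (\<integral>\<^sup>+ y. F (?N y) * ennreal (exp (- nsq n (?N y))) \<partial>?L)"
    proof (intro allI impI)
      fix b and F :: "complex poly \<Rightarrow> ennreal"
      assume b: "orthonormal_basis_on n (inner_n n) b" and F: "F \<in> borel_measurable (polys_borel n)"
      have Mm: "?M b \<in> measurable ?L (polys_borel n)"
        by (rule measurable_linear_coordinates[OF linear_coordinates_basis[OF b]])
      have law: "gaussian_polynomial_law n b = distr (density ?L (\<lambda>x. ennreal (1 / pi) ^ Suc n *
          ennreal (exp (- (\<Sum>i<Suc n. (cmod (x i))\<^sup>2))))) (polys_borel n) (?M b)"
        unfolding gaussian_polynomial_law_def lessThan_Suc_atMost[symmetric] PiM_std_complex_gaussian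
        unfolding lessThan_Suc_atMost ..
      have wm: "(\<lambda>x. ennreal (1 / pi) ^ Suc n * ennreal (exp (- (\<Sum>i<Suc n. (cmod (x i))\<^sup>2)))) \<in> borel_measurable ?L"
      proof -
        have "(\<lambda>a. g (?M b a)) \<in> borel_measurable ?L" by (rule measurable_compose[OF Mm g])
        then show ?thesis unfolding gM[OF b] by (intro borel_measurable_times_ennreal) auto
    qed
    have FM: "(\<lambda>a. F (?M b a)) \<in> borel_measurable ?L" by (rule measurable_compose[OF Mm F])
    have Fg: "(\<lambda>p. F p * g p) \<in> borel_measurable (polys_borel n)" using F by measurable
    have "(\<integral>\<^sup>+ p. F p \<partial>gaussian_polynomial_law n b) = (\<integral>\<^sup>+ a. F (?M b a) \<partial>density ?L (\<lambda>x. ennreal (1 / pi) ^ Suc n *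
        ennreal (exp (- (\<Sum>i<Suc n. (cmod (x i))\<^sup>2)))))"
      unfolding law using Mm F by (intro nn_integral_distr) auto
    also have "\<dots> = (\<integral>\<^sup>+ a. ennreal (1 / pi) ^ Suc n * (F (?M b a) * g (?M b a)) \<partial>?L)"
      unfolding gM[OF b] by (subst nn_integral_density[OF wm FM]) (simp only: mult_ac)
    also have "\<dots> = ennreal (1 / pi) ^ Suc n * (\<integral>\<^sup>+ a. F (?M b a) * g (?M b a) \<partial>?L)"
      by (rule nn_integral_cmult) (rule measurable_compose[OF Mm Fg])
    finally have "c * (\<integral>\<^sup>+ p. F p \<partial>gaussian_polynomial_law n b)
        = ennreal (1 / pi) ^ Suc n * ((\<integral>\<^sup>+ a. F (?M b a) * g (?M b a) \<partial>?L) * c)"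
      by (simp only: mult_ac)
    also have "\<dots> = (ennreal (1 / pi) ^ Suc n * P) * (\<integral>\<^sup>+ y. F (?N y) * g (?N y) \<partial>?L)"
      unfolding change[OF b Fg] by (simp only: mult.assoc)
    also have "ennreal (1 / pi) ^ Suc n * P = 1"
      unfolding P_def power_mult_distrib[symmetric] by (subst ennreal_mult'[symmetric]) auto
    finally show "c * (\<integral>\<^sup>+ p. F p \<partial>gaussian_polynomial_law n b)
      = (\<integral>\<^sup>+ y. F (?N y) * ennreal (exp (- nsq n (?N y))) \<partial>?L)"
      unfolding g_def by simp
    qed
  qed
qed

text \<open>By \<open>Ff\<close> the value of \<open>F\<close> is unaffected by the leading
  coefficient \<open>a\<close>, so for fixed roots the integral over \<open>a\<close> is a scaled
  Gaussian moment, with the squared norm of the monic polynomial as scale.\<close>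

lemma nn_integral_gaussian_roots:
  fixes F :: "complex poly \<Rightarrow> ennreal"
  assumes F: "F \<in> borel_measurable (polys_borel n)" and f: "f \<in> borel_measurable (lebesgue_power n)"
    and Ff: "\<And>a z. a \<noteq> 0 \<Longrightarrow> F (smult a (\<Prod>i<n. [:- z i, 1:])) = f z"
  shows "fact n * (\<integral>\<^sup>+ y. F (lead_poly (y n) n y) * ennreal (exp (- nsq n (lead_poly (y n) n y))) \<partial>lebesgue_power (Suc n))
    = gaussian_moment n * (\<integral>\<^sup>+ z. f z * ennreal (vandermonde_sq n z * (1 / nsq n (\<Prod>i<n. [:- z i, 1:])) ^ Suc n) \<partial>lebesgue_power n)"
proof -
  let ?L = "lebesgue_power n"
  let ?Q = "\<lambda>z. \<Prod>i<n. [:- z i, 1:]"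
  interpret L: sigma_finite_measure ?L by (rule sigma_finite_lebesgue_power)
  interpret pair_sigma_finite "lborel :: complex measure" ?L by standard
  note f [measurable]
  define H where "H p = F p * ennreal (exp (- nsq n p))" for p
  have H [measurable]: "H \<in> borel_measurable (polys_borel n)" unfolding H_def using F by measurable
  have HN: "(\<lambda>y. H (lead_poly (y n) n y)) \<in> borel_measurable (lebesgue_power (Suc n))"
    by (rule borel_measurable_lead_poly[OF H]) (auto intro: measurable_component)
  define k where "k a z = ennreal ((cmod a)\<^sup>2) ^ n * (f z * ennreal (exp (- ((cmod a)\<^sup>2 * nsq n (?Q z)))) * ennreal (vandermonde_sq n z))" for a z
  have ae: "AE a in lborel. a \<noteq> (0 :: complex)" by (rule AE_lborel_singleton)
  have inner: "fact n * (\<integral>\<^sup>+ x. H (lead_poly a n x) \<partial>?L) = (\<integral>\<^sup>+ z. k a z \<partial>?L)" if a: "a \<noteq> 0" for a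
  proof -
    have id: "(\<lambda>q. q) \<in> measurable (polys_borel n) (polys_borel n)" by simp
    have Ha: "(\<lambda>q. H (smult a q)) \<in> borel_measurable (polys_borel n)"
      by (rule measurable_compose[OF measurable_poly_smult[OF id measurable_const] H]) simp
    have eq: "H (smult a (?Q z)) = f z * ennreal (exp (- ((cmod a)\<^sup>2 * nsq n (?Q z))))" for z
      unfolding H_def Ff[OF a] nsq_smult ..
    have "fact n * (\<integral>\<^sup>+ x. H (lead_poly a n x) \<partial>?L)
        = ennreal ((cmod a)\<^sup>2) ^ n * (fact n * (\<integral>\<^sup>+ x. H (smult a (lead_poly 1 n x)) \<partial>?L))"
      unfolding nn_integral_lead_poly_scale[OF a H] by (simp only: mult_ac)
    also have "\<dots> = ennreal ((cmod a)\<^sup>2) ^ n * (\<integral>\<^sup>+ z. H (smult a (?Q z)) * ennreal (vandermonde_sq n z) \<partial>?L)"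
      unfolding nn_integral_roots_coeffs[OF Ha] ..
    also have "\<dots> = (\<integral>\<^sup>+ z. k a z \<partial>?L)"
      unfolding k_def eq by (rule nn_integral_cmult[symmetric]) measurable
    finally show ?thesis .
  qed
  have "fact n * (\<integral>\<^sup>+ y. H (lead_poly (y n) n y) \<partial>lebesgue_power (Suc n))
      = fact n * (\<integral>\<^sup>+ a. \<integral>\<^sup>+ x. H (lead_poly a n x) \<partial>?L \<partial>lborel)"
    unfolding nn_integral_lebesgue_power_Suc(2)[OF HN] by simp
  also have "\<dots> = (\<integral>\<^sup>+ a. fact n * (\<integral>\<^sup>+ x. H (lead_poly a n x) \<partial>?L) \<partial>lborel)"
  proof (rule nn_integral_cmult[symmetric])
    have "(\<lambda>(a, x). H (lead_poly a n x)) \<in> borel_measurable (lborel \<Otimes>\<^sub>M ?L)"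
      unfolding case_prod_unfold by (rule borel_measurable_lead_poly[OF H]) auto
    then show "(\<lambda>a. \<integral>\<^sup>+ x. H (lead_poly a n x) \<partial>?L) \<in> borel_measurable lborel"
      by (rule L.borel_measurable_nn_integral)
  qed
  \<comment> \<open>The excluded value \<open>a = 0\<close> is a null set.\<close>
  also have "\<dots> = (\<integral>\<^sup>+ a. \<integral>\<^sup>+ z. k a z \<partial>?L \<partial>lborel)"
    by (rule nn_integral_cong_AE) (use ae inner in \<open>auto elim!: eventually_mono\<close>)
  also have "\<dots> = (\<integral>\<^sup>+ z. \<integral>\<^sup>+ a. k a z \<partial>lborel \<partial>?L)"
  proof (rule Fubini'[symmetric])
    have [measurable]: "(\<lambda>x. f (snd x)) \<in> borel_measurable (lborel \<Otimes>\<^sub>M ?L)"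
      "(\<lambda>x. nsq n (?Q (snd x))) \<in> borel_measurable (lborel \<Otimes>\<^sub>M ?L)"
      "(\<lambda>x. vandermonde_sq n (snd x)) \<in> borel_measurable (lborel \<Otimes>\<^sub>M ?L)"
      by (rule measurable_compose[OF measurable_snd f] measurable_compose[OF measurable_snd measurable_nsq_prod]
          measurable_compose[OF measurable_snd borel_measurable_vandermonde_sq])+
    show "(\<lambda>(a, z). k a z) \<in> borel_measurable (lborel \<Otimes>\<^sub>M ?L)"
      unfolding case_prod_unfold k_def by measurable
  qed
  also have "\<dots> = (\<integral>\<^sup>+ z. gaussian_moment n * (f z * ennreal (vandermonde_sq n z * (1 / nsq n (?Q z)) ^ Suc n)) \<partial>?L)"
  proof (rule nn_integral_cong)
    fix z
    let ?s = "nsq n (?Q z)"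
    have s: "?s > 0" by (rule nsq_prod_pos)
    have "(\<integral>\<^sup>+ a. k a z \<partial>lborel)
        = (\<integral>\<^sup>+ a. (f z * ennreal (vandermonde_sq n z)) * ennreal (((cmod a)\<^sup>2) ^ n * exp (- ((cmod a)\<^sup>2 * ?s))) \<partial>lborel)"
      unfolding k_def by (intro nn_integral_cong) (simp add: ennreal_mult' ennreal_power mult_ac)
    also have "\<dots> = (f z * ennreal (vandermonde_sq n z)) * (gaussian_moment n * ennreal ((1 / ?s) ^ Suc n))"
      unfolding gaussian_moment_scaled[OF s, symmetric] by (rule nn_integral_cmult) measurable
    also have "\<dots> = gaussian_moment n * (f z * (ennreal (vandermonde_sq n z) * ennreal ((1 / ?s) ^ Suc n)))"
      by (simp only: mult_ac)
    also have "ennreal (vandermonde_sq n z) * ennreal ((1 / ?s) ^ Suc n) = ennreal (vandermonde_sq n z * (1 / ?s) ^ Suc n)"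
      by (rule ennreal_mult'[symmetric]) (rule vandermonde_sq_nonneg)
    finally show "(\<integral>\<^sup>+ a. k a z \<partial>lborel)
        = gaussian_moment n * (f z * ennreal (vandermonde_sq n z * (1 / ?s) ^ Suc n))" .
  qed
  also have "\<dots> = gaussian_moment n * (\<integral>\<^sup>+ z. f z * ennreal (vandermonde_sq n z * (1 / nsq n (?Q z)) ^ Suc n) \<partial>?L)"
    by (rule nn_integral_cmult) measurable
  finally show ?thesis unfolding H_def .
qed

lemma sets_gibbs: "sets (gibbs_measure \<phi> \<nu> n) = sets (lebesgue_power n)"
  unfolding gibbs_measure_def by (simp add: ref_measure_def cong: sets_PiM_cong)

text \<open>The constants of the two changes of variables are never computed: they are fixed by the total
  mass one of the Gaussian law.\<close>

lemma zeros_of_gaussian: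
  obtains D where "0 < D" "D < \<infinity>"
    "\<forall>b F f. orthonormal_basis_on n (inner_n n) b \<longrightarrow> F \<in> borel_measurable (polys_borel n) \<longrightarrow>
      f \<in> borel_measurable (lebesgue_power n) \<longrightarrow>
      (\<forall>a z. a \<noteq> 0 \<longrightarrow> F (smult a (\<Prod>i<n. [:- z i, 1:])) = f z) \<longrightarrow>
      D * (\<integral>\<^sup>+ p. F p \<partial>gaussian_polynomial_law n b) = (\<integral>\<^sup>+ z. f z \<partial>gibbs_measure \<phi> \<nu> n)"
proof -
  obtain c where c: "0 < c" "c < \<infinity>" and law: "\<forall>b F. orthonormal_basis_on n (inner_n n) b \<longrightarrow> F \<in> borel_measurable (polys_borel n) \<longrightarrow>
      c * (\<integral>\<^sup>+ p. F p \<partial>gaussian_polynomial_law n b)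
      = (\<integral>\<^sup>+ y. F (lead_poly (y n) n y) * ennreal (exp (- nsq n (lead_poly (y n) n y))) \<partial>lebesgue_power (Suc n))"
    by (rule gaussian_weight_coeffs)
  \<comment> \<open>\<open>A\<close> collects the constants on the side of the polynomials, the
    number of orderings of the roots and the Gaussian weight; \<open>B\<close> collects those on the
    side of the roots.\<close>
  define A where "A = fact n * c"
  define B where "B = gaussian_moment n * ennreal (Z ^ n)"
  have fact_fin: "(fact n :: ennreal) = ennreal (fact n)"
    by (metis ennreal_of_nat_eq_real_of_nat of_nat_fact)
  have A: "A \<noteq> 0" "A \<noteq> \<infinity>"
    using c by (auto simp: A_def fact_fin ennreal_mult_eq_top_iff ennreal_eq_0_iff fact_gt_zero not_le)
  have B: "B \<noteq> 0" "B \<noteq> \<infinity>"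
    using gaussian_moment_pos[of n] gaussian_moment_finite[OF n1] Z_pos
    by (auto simp: B_def ennreal_mult_eq_top_iff ennreal_eq_0_iff not_le)
  show thesis
  proof (rule that)
    show "0 < A / B" using A B by (simp add: ennreal_zero_less_divide zero_less_iff_neq_zero less_top)
    have "A / B \<noteq> \<infinity>" using A B by (simp add: ennreal_divide_eq_top_iff)
    then show "A / B < \<infinity>" by (simp add: less_top)
    show "\<forall>b F f. orthonormal_basis_on n (inner_n n) b \<longrightarrow> F \<in> borel_measurable (polys_borel n) \<longrightarrow>
      f \<in> borel_measurable (lebesgue_power n) \<longrightarrow>
      (\<forall>a z. a \<noteq> 0 \<longrightarrow> F (smult a (\<Prod>i<n. [:- z i, 1:])) = f z) \<longrightarrow>
      A / B * (\<integral>\<^sup>+ p. F p \<partial>gaussian_polynomial_law n b) = (\<integral>\<^sup>+ z. f z \<partial>gibbs_measure \<phi> \<nu> n)"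
    proof (intro allI impI)
      fix b and F :: "complex poly \<Rightarrow> ennreal" and f
      assume b: "orthonormal_basis_on n (inner_n n) b" and F: "F \<in> borel_measurable (polys_borel n)"
        and f: "f \<in> borel_measurable (lebesgue_power n)"
        and Ff: "\<forall>a z. a \<noteq> 0 \<longrightarrow> F (smult a (\<Prod>i<n. [:- z i, 1:])) = f z"
      let ?I = "\<integral>\<^sup>+ p. F p \<partial>gaussian_polynomial_law n b" and ?J = "\<integral>\<^sup>+ z. f z \<partial>gibbs_measure \<phi> \<nu> n"
      have "A * ?I = fact n * (c * ?I)" by (simp only: A_def mult_ac)
      also have "\<dots> = fact n * (\<integral>\<^sup>+ y. F (lead_poly (y n) n y) * ennreal (exp (- nsq n (lead_poly (y n) n y))) \<partial>lebesgue_power (Suc n))"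
        by (rule arg_cong[where f = "\<lambda>t. fact n * t"], rule law[rule_format, OF b F])
      also have "\<dots> = gaussian_moment n * (\<integral>\<^sup>+ z. f z * ennreal (vandermonde_sq n z * (1 / nsq n (\<Prod>i<n. [:- z i, 1:])) ^ Suc n) \<partial>lebesgue_power n)"
        by (rule nn_integral_gaussian_roots[OF F f]) (use Ff in blast)
      also have "\<dots> = gaussian_moment n * (ennreal (Z ^ n) * ?J)"
        by (simp only: nn_integral_gibbs[OF f])
      also have "\<dots> = ?J * B" by (simp only: B_def mult_ac)
      finally have "A * ?I / B = ?J"
        using B by (simp add: ennreal_mult_divide_eq)
      then show "A / B * ?I = ?J"
        by (simp only: divide_ennreal_def mult_ac)
    qed
  qed
qed

section \<open>Comparison of the two laws\<close>

lemma prob_space_gaussian_polynomial_law: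
  assumes b: "orthonormal_basis_on n (inner_n n) b"
  shows "prob_space (gaussian_polynomial_law n b)"
  unfolding gaussian_polynomial_law_def
proof (rule prob_space.prob_space_distr)
  show "prob_space (\<Pi>\<^sub>M k\<in>{..n}. std_complex_gaussian)"
    by (rule prob_space_PiM) (rule prob_space_std_complex_gaussian)
  have "sets (\<Pi>\<^sub>M k\<in>{..n}. std_complex_gaussian) = sets (lebesgue_power (Suc n))"
    unfolding lessThan_Suc_atMost by (intro sets_PiM_cong) (auto simp: std_complex_gaussian_def)
  then show "(\<lambda>a. \<Sum>k\<le>n. smult (a k) (b k)) \<in> measurable (\<Pi>\<^sub>M k\<in>{..n}. std_complex_gaussian) (polys_borel n)"
    using measurable_linear_coordinates[OF linear_coordinates_basis[OF b]]
    by (simp cong: measurable_cong_sets)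
qed

lemma sets_gaussian_polynomial_law: "sets (gaussian_polynomial_law n b) = sets (polys_borel n)"
  by (simp add: gaussian_polynomial_law_def)

text \<open>In \<open>zeros_of_gaussian\<close> the constant function 1 identifies the total mass as
  \<open>D\<close>, because the Gaussian law is a probability. The indicator of an event about the
  zeros then gives the law, with \<open>inverse D\<close> as the normalisation.\<close>

lemma gibbs_total_mass:
  "0 < emeasure (gibbs_measure \<phi> \<nu> n) (space (gibbs_measure \<phi> \<nu> n))"
  "emeasure (gibbs_measure \<phi> \<nu> n) (space (gibbs_measure \<phi> \<nu> n)) < \<infinity>"
  and zeros_law: "orthonormal_basis_on n (inner_n n) b \<Longrightarrow>
    distr (restrict_space (gaussian_polynomial_law n b) (polys n - polys (n - 1))) weak_borel (zero_measure n)
      = distr (normalize_measure (gibbs_measure \<phi> \<nu> n)) weak_borel (empirical n)"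
proof -
  let ?\<gamma> = "gibbs_measure \<phi> \<nu> n"
  obtain D where D: "0 < D" "D < \<infinity>" and key:
    "\<forall>b F f. orthonormal_basis_on n (inner_n n) b \<longrightarrow> F \<in> borel_measurable (polys_borel n) \<longrightarrow>
      f \<in> borel_measurable (lebesgue_power n) \<longrightarrow>
      (\<forall>a z. a \<noteq> 0 \<longrightarrow> F (smult a (\<Prod>i<n. [:- z i, 1:])) = f z) \<longrightarrow>
      D * (\<integral>\<^sup>+ p. F p \<partial>gaussian_polynomial_law n b) = (\<integral>\<^sup>+ z. f z \<partial>?\<gamma>)"
    by (rule zeros_of_gaussian)
  have total: "emeasure ?\<gamma> (space ?\<gamma>) = D"
  proof -
    obtain b where b: "orthonormal_basis_on n (inner_n n) b"
      using orthonormal_basis_exists[OF nondeg] by blast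
    have "D * (\<integral>\<^sup>+ p. 1 \<partial>gaussian_polynomial_law n b) = (\<integral>\<^sup>+ z. 1 \<partial>?\<gamma>)"
      by (rule key[rule_format, OF b]) auto
    then show ?thesis
      using prob_space.emeasure_space_1[OF prob_space_gaussian_polynomial_law[OF b]] by simp
  qed
  show "0 < emeasure ?\<gamma> (space ?\<gamma>)" "emeasure ?\<gamma> (space ?\<gamma>) < \<infinity>"
    unfolding total by (rule D)+
  assume b: "orthonormal_basis_on n (inner_n n) b"
  let ?G = "gaussian_polynomial_law n b" and ?D = "polys n - polys (n - 1)"
  have spG: "space ?G = polys n"
    using sets_eq_imp_space_eq[OF sets_gaussian_polynomial_law[of b]] by simp
  have zm: "zero_measure n \<in> measurable (restrict_space ?G ?D) weak_borel"
    by (rule measurable_zero_measure[OF n1 sets_gaussian_polynomial_law])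
  have sets_\<gamma>: "sets ?\<gamma> = sets (lebesgue_power n)" by (rule sets_gibbs)
  have emp: "empirical n \<in> measurable (lebesgue_power n) weak_borel"
    by (rule measurable_empirical[OF n1])
  have emp': "empirical n \<in> measurable (normalize_measure ?\<gamma>) weak_borel"
    using emp by (subst measurable_cong_sets[OF _ refl]) (auto simp: normalize_measure_def sets_\<gamma>)
  have Dset: "?D \<inter> space ?G \<in> sets ?G"
  proof -
    \<comment> \<open>Describing the domain by a nonvanishing coefficient makes it measurable;
      \<open>n \<ge> 1\<close> excludes the zero polynomial from degree \<open>n\<close>.\<close>
    have "?D = {p \<in> space (polys_borel n). coeff p n \<noteq> 0}"
    proof (intro set_eqI iffI)
      fix p assume "p \<in> ?D"
      then have "degree p = n" by (auto simp: polys_def)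
      moreover from this have "p \<noteq> 0" using n1 by auto
      ultimately show "p \<in> {p \<in> space (polys_borel n). coeff p n \<noteq> 0}"
        by (auto simp: polys_def simp flip: leading_coeff_0_iff)
    next
      fix p assume "p \<in> {p \<in> space (polys_borel n). coeff p n \<noteq> 0}"
      then show "p \<in> ?D"
        using le_degree[of p n] n1 by (auto simp: polys_def)
    qed
    also have "\<dots> \<in> sets (polys_borel n)" by measurable
    finally show ?thesis
      unfolding sets_gaussian_polynomial_law spG by (simp add: Int_absorb2)
  qed
  show "distr (restrict_space ?G ?D) weak_borel (zero_measure n)
      = distr (normalize_measure ?\<gamma>) weak_borel (empirical n)"
  proof (rule measure_eqI)
    fix A assume "A \<in> sets (distr (restrict_space ?G ?D) weak_borel (zero_measure n))"
    then have A: "A \<in> sets weak_borel" by simp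
    define E where "E = zero_measure n -` A \<inter> space (restrict_space ?G ?D)"
    have "E \<in> sets (restrict_space ?G ?D)"
      unfolding E_def by (rule measurable_sets[OF zm A])
    then have E: "E \<in> sets ?G" "E \<subseteq> ?D"
      using sets_restrict_space_iff[OF Dset] by (auto simp: E_def space_restrict_space)
    \<comment> \<open>\<open>E\<close> lies inside the domain of degree \<open>n\<close>, but so
      does every polynomial with \<open>n\<close> prescribed roots and nonzero leading coefficient;
      hence \<open>f\<close> represents the indicator of \<open>E\<close> at all points.\<close>
    define f where "f z = (indicator A (empirical n z) :: ennreal)" for z
    have f: "f \<in> borel_measurable (lebesgue_power n)"
      unfolding f_def by (rule measurable_compose[OF emp borel_measurable_indicator[OF A]])
    have ind: "indicator E \<in> borel_measurable (polys_borel n)"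
      using E(1) unfolding sets_gaussian_polynomial_law by (rule borel_measurable_indicator)
    have roots: "indicator E (smult a (\<Prod>i<n. [:- z i, 1:])) = f z" if a: "a \<noteq> 0" for a z
    proof -
      have "degree (smult a (\<Prod>i<n. [:- z i, 1:])) = n" by (rule degree_smult_prod_linear[OF a])
      then have "smult a (\<Prod>i<n. [:- z i, 1:]) \<in> space (restrict_space ?G ?D)"
        using n1 by (simp add: space_restrict_space spG polys_def)
      then show ?thesis
        by (simp only: E_def f_def indicator_def vimage_def Int_iff mem_Collect_eq simp_thms
            zero_measure_smult_prod[OF a])
    qed
    have fE: "(\<integral>\<^sup>+ z. f z \<partial>?\<gamma>) = emeasure ?\<gamma> (empirical n -` A \<inter> space ?\<gamma>)"
    proof -
      have "empirical n -` A \<inter> space ?\<gamma> \<in> sets ?\<gamma>"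
        using measurable_sets[OF emp A] sets_eq_imp_space_eq[OF sets_\<gamma>] by (simp add: sets_\<gamma>)
      then have "(\<integral>\<^sup>+ z. indicator (empirical n -` A \<inter> space ?\<gamma>) z \<partial>?\<gamma>) = emeasure ?\<gamma> (empirical n -` A \<inter> space ?\<gamma>)"
        by (rule nn_integral_indicator)
      moreover have "(\<integral>\<^sup>+ z. f z \<partial>?\<gamma>) = (\<integral>\<^sup>+ z. indicator (empirical n -` A \<inter> space ?\<gamma>) z \<partial>?\<gamma>)"
        by (intro nn_integral_cong) (auto simp: f_def indicator_def)
      ultimately show ?thesis by simp
    qed
    have "emeasure (distr (restrict_space ?G ?D) weak_borel (zero_measure n)) A = emeasure ?G E"
      unfolding E_def[symmetric] emeasure_distr[OF zm A]
      by (rule emeasure_restrict_space[OF Dset E(2)])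
    also have "\<dots> = inverse D * (D * emeasure ?G E)"
    proof -
      have "D / D = 1" using D by (intro ennreal_divide_self) auto
      then have "inverse D * D = 1" by (simp only: divide_ennreal_def mult.commute)
      then show ?thesis by (simp only: mult.assoc[symmetric] mult_1)
    qed
    also have "D * emeasure ?G E = (\<integral>\<^sup>+ z. f z \<partial>?\<gamma>)"
      using key[rule_format, OF b ind f roots] E(1) by simp
    also have "inverse D * \<dots> = emeasure (normalize_measure ?\<gamma>) (empirical n -` A \<inter> space (normalize_measure ?\<gamma>))"
      unfolding fE normalize_measure_def total by (simp add: space_scale_measure)
    also have "\<dots> = emeasure (distr (normalize_measure ?\<gamma>) weak_borel (empirical n)) A"
      by (rule emeasure_distr[OF emp' A, symmetric])
    finally show "emeasure (distr (restrict_space ?G ?D) weak_borel (zero_measure n)) A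
        = emeasure (distr (normalize_measure ?\<gamma>) weak_borel (empirical n)) A" .
  qed simp
qed

end

end

text \<open>The existence of \<open>\<G>\<close> keeps the final claim from being vacuous, and the
  two bounds on the total mass make the normalisation a genuine one.\<close>

theorem proposition4p12:
  fixes \<nu> :: "complex measure" and \<phi> :: "complex \<Rightarrow> real"
  assumes "prob_space \<nu>" and "sets \<nu> = sets borel"
    and "continuous_on UNIV \<phi>"
    and "Liminf at_infinity (\<lambda>z. ereal (\<phi> z - 2 * ln (cmod z))) > - \<infinity>"
  shows "lower_semicontinuous (\<lambda>(z, w). pair_energy \<phi> z w) \<and>
    (\<exists>c::real. \<forall>z w. ereal c \<le> pair_energy \<phi> z w) \<and>
    (\<integral>\<^sup>+ z. ennreal (exp (- 2 * \<phi> z)) \<partial>(lborel :: complex measure)) < \<infinity> \<and>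
    prob_space (ref_measure \<phi>) \<and>
    (\<forall>n\<ge>1. nondegenerate_on n (weighted_inner \<phi> \<nu> n) \<longrightarrow>
      (\<forall>z. energy \<phi> \<nu> n z \<noteq> - \<infinity>) \<and>
      (\<forall>z \<sigma>. \<sigma> permutes {..<n} \<longrightarrow> energy \<phi> \<nu> n (z \<circ> \<sigma>) = energy \<phi> \<nu> n z) \<and>
      energy \<phi> \<nu> n \<in> borel_measurable (\<Pi>\<^sub>M i\<in>{..<n}. borel) \<and>
      0 < emeasure (gibbs_measure \<phi> \<nu> n) (space (gibbs_measure \<phi> \<nu> n)) \<and>
      emeasure (gibbs_measure \<phi> \<nu> n) (space (gibbs_measure \<phi> \<nu> n)) < \<infinity> \<and>
      (\<exists>\<G>. is_complex_gaussian n (weighted_inner \<phi> \<nu> n) \<G>) \<and>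
      (\<forall>\<G>. is_complex_gaussian n (weighted_inner \<phi> \<nu> n) \<G> \<longrightarrow>
        distr (restrict_space \<G> (polys n - polys (n - 1))) weak_borel (zero_measure n)
        = distr (normalize_measure (gibbs_measure \<phi> \<nu> n)) weak_borel (empirical n)))"
proof -
  obtain C where C: "C > 0" "\<forall>z. 1 + (cmod z)\<^sup>2 \<le> C * exp (\<phi> z)"
    by (rule growth_bound[OF assms(3,4)])
  interpret planar_weight \<nu> \<phi> C
    by (rule planar_weight.intro[OF assms(1-3) C(1) C(2)[rule_format]])
  show ?thesis
  proof (intro conjI allI impI)
    show "lower_semicontinuous (\<lambda>(z, w). pair_energy \<phi> z w)"
      by (rule lower_semicontinuous_pair_energy[OF assms(3)])
    show "\<exists>c::real. \<forall>z w. ereal c \<le> pair_energy \<phi> z w"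
      by (rule pair_energy_bounded_below)
    show "(\<integral>\<^sup>+ z. ennreal (exp (- 2 * \<phi> z)) \<partial>(lborel :: complex measure)) < \<infinity>"
      by (rule partition_finite)
    show "prob_space (ref_measure \<phi>)"
      by (rule prob_space_ref_measure)
    fix n :: nat assume n: "n \<ge> 1" and nondeg: "nondegenerate_on n (weighted_inner \<phi> \<nu> n)"
    show "energy \<phi> \<nu> n z \<noteq> - \<infinity>" for z
      by (rule energy_not_MInfty[OF n nondeg])
    show "energy \<phi> \<nu> n (z \<circ> \<sigma>) = energy \<phi> \<nu> n z" if "\<sigma> permutes {..<n}" for z \<sigma>
      by (rule energy_permute[OF n nondeg that])
    show "energy \<phi> \<nu> n \<in> borel_measurable (\<Pi>\<^sub>M i\<in>{..<n}. borel)"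
      by (rule measurable_energy[OF n nondeg])
    show "0 < emeasure (gibbs_measure \<phi> \<nu> n) (space (gibbs_measure \<phi> \<nu> n))"
      "emeasure (gibbs_measure \<phi> \<nu> n) (space (gibbs_measure \<phi> \<nu> n)) < \<infinity>"
      by (rule gibbs_total_mass[OF n nondeg])+
    show "\<exists>\<G>. is_complex_gaussian n (weighted_inner \<phi> \<nu> n) \<G>"
      using orthonormal_basis_exists[OF nondeg] unfolding is_complex_gaussian_def by blast
    show "distr (restrict_space \<G> (polys n - polys (n - 1))) weak_borel (zero_measure n)
        = distr (normalize_measure (gibbs_measure \<phi> \<nu> n)) weak_borel (empirical n)"
      if \<G>: "is_complex_gaussian n (weighted_inner \<phi> \<nu> n) \<G>" for \<G>
      using \<G> zeros_law[OF n nondeg] unfolding is_complex_gaussian_def by blast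
  qed
qed

end
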